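(* Let $\mathbb{K}$ be a field, $n$ a positive integer, $\chi:\mathbb{Z}^n\times\mathbb{Z}^n\to\mathbb{K}^*$ an alternating bicharacter, and $\phi:\mathbb{Z}^n\to\Gamma$ a surjective group homomorphism, where $\Gamma$ is a free abelian group. Assign to $\mathcal{O}_\chi(\mathbb{K}^n)$ and $\mathcal{T}^n_\chi(\mathbb{K})$ the $\Gamma$-gradings induced from their standard $\mathbb{Z}^n$-gradings along $\phi$ (so that $y_i$ is homogeneous of degree $\phi(e_i)$). Then for every inclusion of $\Gamma$-graded $\mathbb{K}$-algebras $$\mathcal{O}_\chi(\mathbb{K}^n)\subseteq A\subseteq\mathcal{T}^n_\chi(\mathbb{K}),$$ one has $$\mathrm{tw}_\Gamma(A)=\langle\chi(\ker\phi,\,\mathbb{Z}^n)\rangle\subseteq\mathbb{K}^*,$$ where the right-hand side is the subgroup of $\mathbb{K}^*$ generated by all $\chi(s,t)$ with $s\in\ker\phi$, $t\in\mathbb{Z}^n$.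
   Context: All algebras are unital associative $\mathbb{K}$-algebras; $\mathbb{K}^*$ is identified with the nonzero scalar multiples of the identity. $e_1,\dots,e_n$ is the standard basis of $\mathbb{Z}^n$. A bicharacter on an abelian group $\Gamma$ is a map $\Gamma\times\Gamma\to\mathbb{K}^*$ that is a homomorphism in each variable; it is alternating if its value at $(s,s)$ is $1$ for all $s$. A matrix $\boldsymbol{q}=(q_{ij})\in M_n(\mathbb{K}^* )$ is multiplicatively skew-symmetric if $q_{ii}=1$ and $q_{ij}q_{ji}=1$ for all $i,j$. The quantum affine space is $\mathcal{O}_{\boldsymbol q}(\mathbb{K}^n)=\mathbb{K}\langle y_1,\dots,y_n\mid y_iy_j=q_{ij}y_jy_i\ \forall i,j\rangle$, and the quantum torus $\mathcal{T}^n_{\boldsymbol q}(\mathbb{K})$ is its localization obtained by inverting $y_1,\dots,y_n$; both have the standard $\mathbb{Z}^n$-grading with $\deg y_i=e_i$. For an alternating bicharacter $\chi$ on $\mathbb{Z}^n$, let $\boldsymbol q(\chi)=(\chi(e_i,e_j))$, $\mathcal{O}_\chi(\mathbb{K}^n)=\mathcal{O}_{\boldsymbol q(\chi)}(\mathbb{K}^n)$ and $\mathcal{T}^n_\chi(\mathbb{K})=\mathcal{T}^n_{\boldsymbol q(\chi)}(\mathbb{K})$. For a semiprime right Goldie $\mathbb{K}$-algebra $A$ with classical right quotient ring $\mathrm{Fract}\,A$, $\mathrm{AD}(A)$ is the intersection of $\mathbb{K}^*$ with the commutator (derived) subgroup of the group of units of $\mathrm{Fract}\,A$. For an abelian group $\Gamma$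 (written additively), $Z^2(\Gamma,\mathbb{K}^* )$ is the set of maps $\mathbf{c}:\Gamma\times\Gamma\to\mathbb{K}^*$ with $\mathbf c(s,t+u)\mathbf c(t,u)=\mathbf c(s+t,u)\mathbf c(s,t)$ for all $s,t,u$. For a $\Gamma$-graded algebra $A$ and $\mathbf c\in Z^2(\Gamma,\mathbb{K}^* )$, the twist $A^{\mathbf c}$ is the graded vector space $A$ with multiplication $x*_{\mathbf c}y=\mathbf c(s,t)xy$ for $x\in A_s$, $y\in A_t$ (its identity is $\mathbf c(0,0)^{-1}1$). For a $\Gamma$-graded semiprime right Goldie algebra $A$, $\mathrm{tw}_\Gamma(A)=\bigcap_{\mathbf c\in Z^2(\Gamma,\mathbb{K}^* )}\mathrm{AD}(A^{\mathbf c})$. *)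

theory Defs
  imports
    "HOL-Algebra.Algebraic_Closure_Type"
    "HOL-Algebra.Free_Abelian_Groups"
    "HOL-Algebra.Multiplicative_Group"
    "HOL-Algebra.QuotRing"
    "HOL-Analysis.Finite_Cartesian_Product"
begin

section \<open>Associative algebras over a field\<close>

text \<open>
  The base field is a type \<open>'k\<close> of class \<^class>\<open>field\<close>; \<^const>\<open>ring_of_type_algebra\<close> turns it into
  a record.  The locale \<^locale>\<open>algebra\<close> of the library requires commutative multiplication, hence
  the following definition.
\<close>

definition k_algebra :: "('k::field, 'a) module \<Rightarrow> bool" where
  "k_algebra R \<longleftrightarrow>
     Ring.ring R \<and> Module.module (ring_of_type_algebra :: 'k ring) R \<and>
     (\<forall>c. \<forall>x\<in>carrier R. \<forall>y\<in>carrier R.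
        (c \<odot>\<^bsub>R\<^esub> x) \<otimes>\<^bsub>R\<^esub> y = c \<odot>\<^bsub>R\<^esub> (x \<otimes>\<^bsub>R\<^esub> y) \<and>
        x \<otimes>\<^bsub>R\<^esub> (c \<odot>\<^bsub>R\<^esub> y) = c \<odot>\<^bsub>R\<^esub> (x \<otimes>\<^bsub>R\<^esub> y))"

definition alg_hom :: "('k::field, 'a) module \<Rightarrow> ('k, 'b) module \<Rightarrow> ('a \<Rightarrow> 'b) set" where
  "alg_hom R S = {f \<in> ring_hom R S. \<forall>c. \<forall>x\<in>carrier R. f (c \<odot>\<^bsub>R\<^esub> x) = c \<odot>\<^bsub>S\<^esub> f x}"

definition lin_span :: "('k::field, 'a) module \<Rightarrow> 'a set \<Rightarrow> 'a set" where
  "lin_span R B = \<Inter>{H. submodule H (ring_of_type_algebra :: 'k ring) R \<and> B \<subseteq> H}"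

section \<open>Graded algebras and cocycle twists\<close>

definition homogeneous_decomposition ::
    "('k::field, 'a) module \<Rightarrow> ('g \<Rightarrow> 'a set) \<Rightarrow> 'a \<Rightarrow> ('g \<Rightarrow> 'a) \<Rightarrow> bool" where
  "homogeneous_decomposition R G x f \<longleftrightarrow>
     (\<forall>s. f s \<in> G s) \<and> finite {s. f s \<noteq> \<zero>\<^bsub>R\<^esub>} \<and> x = finsum R f {s. f s \<noteq> \<zero>\<^bsub>R\<^esub>}"

definition graded_algebra ::
    "('k::field, 'a) module \<Rightarrow> ('g::ab_group_add \<Rightarrow> 'a set) \<Rightarrow> bool" where
  "graded_algebra R G \<longleftrightarrow>
     k_algebra R \<and>
     (\<forall>s. submodule (G s) (ring_of_type_algebra :: 'k ring) R) \<and>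
     (\<forall>s t. \<forall>x\<in>G s. \<forall>y\<in>G t. x \<otimes>\<^bsub>R\<^esub> y \<in> G (s + t)) \<and>
     (\<forall>x\<in>carrier R. \<exists>!f. homogeneous_decomposition R G x f)"

definition homogeneous_component ::
    "('k::field, 'a) module \<Rightarrow> ('g \<Rightarrow> 'a set) \<Rightarrow> 'g \<Rightarrow> 'a \<Rightarrow> 'a" where
  "homogeneous_component R G s x = (THE f. homogeneous_decomposition R G x f) s"

definition homogeneous_support ::
    "('k::field, 'a) module \<Rightarrow> ('g \<Rightarrow> 'a set) \<Rightarrow> 'a \<Rightarrow> 'g set" where
  "homogeneous_support R G x = {s. homogeneous_component R G s x \<noteq> \<zero>\<^bsub>R\<^esub>}"

definition graded_inclusion ::
    "('k::field, 'a) module \<Rightarrow> ('g \<Rightarrow> 'a set) \<Rightarrow> ('k, 'b) module \<Rightarrow> ('g \<Rightarrow> 'b set) \<Rightarrow> ('a \<Rightarrow> 'b) \<Rightarrow> bool"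
  where
  "graded_inclusion R G S H f \<longleftrightarrow>
     f \<in> alg_hom R S \<and> inj_on f (carrier R) \<and> (\<forall>s. f ` G s \<subseteq> H s)"

definition induced_grading ::
    "('k::field, 'a) module \<Rightarrow> ('h \<Rightarrow> 'a set) \<Rightarrow> ('h \<Rightarrow> 'g) \<Rightarrow> 'g \<Rightarrow> 'a set" where
  "induced_grading R G phi \<gamma> = lin_span R (\<Union>s\<in>{s. phi s = \<gamma>}. G s)"

definition cocycles2 :: "('g::ab_group_add \<Rightarrow> 'g \<Rightarrow> 'k::field) set" where
  "cocycles2 = {c. (\<forall>s t. c s t \<noteq> 0) \<and> (\<forall>s t u. c s (t + u) * c t u = c (s + t) u * c s t)}"

text \<open>The product on the twist is the bilinear extension of its values on homogeneous elements.\<close>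

definition twist ::
    "('k::field, 'a) module \<Rightarrow> ('g::ab_group_add \<Rightarrow> 'a set) \<Rightarrow> ('g \<Rightarrow> 'g \<Rightarrow> 'k) \<Rightarrow> ('k, 'a) module" where
  "twist R G c = R\<lparr>
     monoid.mult := (\<lambda>x y.
       finsum R
         (\<lambda>(s, t). c s t \<odot>\<^bsub>R\<^esub> (homogeneous_component R G s x \<otimes>\<^bsub>R\<^esub> homogeneous_component R G t y))
         (homogeneous_support R G x \<times> homogeneous_support R G y)),
     one := inverse (c 0 0) \<odot>\<^bsub>R\<^esub> \<one>\<^bsub>R\<^esub>\<rparr>"

section \<open>Localization and semiprime right Goldie algebras\<close>

text \<open>\<open>(Q, \<iota>)\<close> is the right ring of fractions of \<open>R\<close> with respect to \<open>S\<close>.\<close>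

definition is_right_localization ::
    "('k::field, 'a) module \<Rightarrow> 'a set \<Rightarrow> ('k, 'b) module \<Rightarrow> ('a \<Rightarrow> 'b) \<Rightarrow> bool" where
  "is_right_localization R S Q \<iota> \<longleftrightarrow>
     k_algebra Q \<and> \<iota> \<in> alg_hom R Q \<and>
     (\<forall>s\<in>S. \<iota> s \<in> Units Q) \<and>
     (\<forall>q\<in>carrier Q. \<exists>a\<in>carrier R. \<exists>s\<in>S. q = \<iota> a \<otimes>\<^bsub>Q\<^esub> inv\<^bsub>Q\<^esub> (\<iota> s)) \<and>
     (\<forall>a\<in>carrier R. \<iota> a = \<zero>\<^bsub>Q\<^esub> \<longleftrightarrow> (\<exists>s\<in>S. a \<otimes>\<^bsub>R\<^esub> s = \<zero>\<^bsub>R\<^esub>))"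

definition regular_elements :: "('k::field, 'a) module \<Rightarrow> 'a set" where
  "regular_elements R = {s \<in> carrier R. \<forall>x\<in>carrier R.
     (s \<otimes>\<^bsub>R\<^esub> x = \<zero>\<^bsub>R\<^esub> \<longrightarrow> x = \<zero>\<^bsub>R\<^esub>) \<and> (x \<otimes>\<^bsub>R\<^esub> s = \<zero>\<^bsub>R\<^esub> \<longrightarrow> x = \<zero>\<^bsub>R\<^esub>)}"

text \<open>
  The classical right quotient ring is unique up to isomorphism over \<open>R\<close>, so any choice will do.
  When it exists, it has a copy on the type below: represent a fraction by the set of all pairs
  (numerator, denominator) defining it.
\<close>

definition Fract :: "('k::field, 'a) module \<Rightarrow> ('k, ('a \<times> 'a) set) module" where
  "Fract R = (SOME Q. \<exists>\<iota>. is_right_localization R (regular_elements R) Q \<iota>)"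

definition semiprime :: "('k::field, 'a) module \<Rightarrow> bool" where
  "semiprime R \<longleftrightarrow>
     (\<forall>I. ideal I R \<and> (\<forall>x\<in>I. \<forall>y\<in>I. x \<otimes>\<^bsub>R\<^esub> y = \<zero>\<^bsub>R\<^esub>) \<longrightarrow> I = {\<zero>\<^bsub>R\<^esub>})"

definition right_ideal :: "'a set \<Rightarrow> ('k::field, 'a) module \<Rightarrow> bool" where
  "right_ideal J R \<longleftrightarrow> additive_subgroup J R \<and> (\<forall>x\<in>J. \<forall>r\<in>carrier R. x \<otimes>\<^bsub>R\<^esub> r \<in> J)"

definition right_annihilator :: "('k::field, 'a) module \<Rightarrow> 'a set \<Rightarrow> 'a set" where
  "right_annihilator R B = {r \<in> carrier R. \<forall>x\<in>B. x \<otimes>\<^bsub>R\<^esub> r = \<zero>\<^bsub>R\<^esub>}"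

text \<open>
  Right Goldie: the ascending chain condition on right annihilators, and no infinite direct sum of
  nonzero right ideals.
\<close>

definition right_goldie :: "('k::field, 'a) module \<Rightarrow> bool" where
  "right_goldie R \<longleftrightarrow>
     (\<forall>B :: nat \<Rightarrow> 'a set.
        (\<forall>i. B i \<subseteq> carrier R \<and> right_annihilator R (B i) \<subseteq> right_annihilator R (B (Suc i))) \<longrightarrow>
        (\<exists>N. \<forall>i\<ge>N. right_annihilator R (B i) = right_annihilator R (B N))) \<and>
     \<not> (\<exists>J :: nat \<Rightarrow> 'a set.
          (\<forall>i. right_ideal (J i) R \<and> J i \<noteq> {\<zero>\<^bsub>R\<^esub>}) \<and>
          (\<forall>m f. (\<forall>i\<le>m. f i \<in> J i) \<and> finsum R f {..m} = \<zero>\<^bsub>R\<^esub> \<longrightarrow> (\<forall>i\<le>m. f i = \<zero>\<^bsub>R\<^esub>)))"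

definition semiprime_right_goldie :: "('k::field, 'a) module \<Rightarrow> bool" where
  "semiprime_right_goldie R \<longleftrightarrow> k_algebra R \<and> semiprime R \<and> right_goldie R"

text \<open>
  Both invariants are meant for semiprime right Goldie algebras only: the classical right quotient
  ring need not exist otherwise.
\<close>

definition AD :: "('k::field, 'a) module \<Rightarrow> 'k set" where
  "AD R = {a. a \<noteq> 0 \<and>
     a \<odot>\<^bsub>Fract R\<^esub> \<one>\<^bsub>Fract R\<^esub> \<in> derived (units_of (Fract R)) (carrier (units_of (Fract R)))}"

definition tw :: "('k::field, 'a) module \<Rightarrow> ('g::ab_group_add \<Rightarrow> 'a set) \<Rightarrow> 'k set" where
  "tw R G = (\<Inter>c\<in>cocycles2. AD (twist R G c))"

section \<open>Quantum affine spaces and quantum tori\<close>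

text \<open>
  The free algebra on generators indexed by \<open>'n\<close> is the monoid algebra, with convolution product,
  of the monoid of words; the library has no additive monoid structure on lists.
\<close>

datatype 'n free_monoid = Word (letters: "'n list")

instantiation free_monoid :: (type) monoid_add
begin

definition "0 = Word []"
definition "v + w = Word (letters v @ letters w)"

instance
  by standard (simp_all add: zero_free_monoid_def plus_free_monoid_def)

end

type_synonym ('n, 'k) free_algebra = "'n free_monoid \<Rightarrow>\<^sub>0 'k"

definition free_gen :: "'n \<Rightarrow> ('n, 'k::field) free_algebra" where
  "free_gen i = Poly_Mapping.single (Word [i]) 1"

definition free_scalar :: "'k::field \<Rightarrow> ('n, 'k) free_algebra" where
  "free_scalar c = Poly_Mapping.single 0 c"

definition quantum_ideal :: "('n \<Rightarrow> 'n \<Rightarrow> 'k::field) \<Rightarrow> ('n, 'k) free_algebra set" where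
  "quantum_ideal q = Idl\<^bsub>ring_of_type_algebra\<^esub>
     {free_gen i * free_gen j - free_scalar (q i j) * free_gen j * free_gen i | i j. True}"

definition quantum_affine ::
    "('n \<Rightarrow> 'n \<Rightarrow> 'k::field) \<Rightarrow> ('k, ('n, 'k) free_algebra set) module" where
  "quantum_affine q = (let Q = ring_of_type_algebra Quot quantum_ideal q in
     \<lparr>carrier = carrier Q, monoid.mult = monoid.mult Q, one = one Q,
      ring.zero = ring.zero Q, add = add Q,
      module.smult = (\<lambda>c C. (quantum_ideal q +>\<^bsub>ring_of_type_algebra\<^esub> free_scalar c) \<otimes>\<^bsub>Q\<^esub> C)\<rparr>)"

definition affine_gen :: "('n \<Rightarrow> 'n \<Rightarrow> 'k::field) \<Rightarrow> 'n \<Rightarrow> ('n, 'k) free_algebra set" where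
  "affine_gen q i = quantum_ideal q +>\<^bsub>ring_of_type_algebra\<^esub> free_gen i"

inductive_set generated_submonoid :: "('k::field, 'a) module \<Rightarrow> 'a set \<Rightarrow> 'a set"
  for R :: "('k, 'a) module" and B :: "'a set" where
  one: "\<one>\<^bsub>R\<^esub> \<in> generated_submonoid R B"
| mult: "m \<in> generated_submonoid R B \<Longrightarrow> x \<in> B \<Longrightarrow> m \<otimes>\<^bsub>R\<^esub> x \<in> generated_submonoid R B"

definition is_quantum_torus ::
    "('n \<Rightarrow> 'n \<Rightarrow> 'k::field) \<Rightarrow> ('k, 'a) module \<Rightarrow> (('n, 'k) free_algebra set \<Rightarrow> 'a) \<Rightarrow> bool" where
  "is_quantum_torus q T \<iota> \<longleftrightarrow>
     is_right_localization (quantum_affine q)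
       (generated_submonoid (quantum_affine q) (range (affine_gen q))) T \<iota>"

text \<open>
  \<open>degree_monomial R y m s\<close>: \<open>m\<close> is a product of the \<open>y i\<close> and of the inverses of those \<open>y i\<close> that
  are invertible in \<open>R\<close>, of total degree \<open>s\<close> when \<open>y i\<close> has degree \<open>axis i 1\<close>.  In a quantum torus
  these are the Laurent monomials.  In a quantum affine space no \<open>y i\<close> is invertible, and one gets
  the ordinary monomials.  So the standard grading of both is given by the same formula.
\<close>

inductive degree_monomial ::
    "('k::field, 'a) module \<Rightarrow> ('n::finite \<Rightarrow> 'a) \<Rightarrow> 'a \<Rightarrow> int ^ 'n \<Rightarrow> bool"
  for R :: "('k, 'a) module" and y :: "'n \<Rightarrow> 'a" where
  one: "degree_monomial R y \<one>\<^bsub>R\<^esub> 0"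
| gen: "degree_monomial R y m s \<Longrightarrow> degree_monomial R y (m \<otimes>\<^bsub>R\<^esub> y i) (s + axis i 1)"
| gen_inv: "degree_monomial R y m s \<Longrightarrow> y i \<in> Units R \<Longrightarrow>
    degree_monomial R y (m \<otimes>\<^bsub>R\<^esub> inv\<^bsub>R\<^esub> (y i)) (s - axis i 1)"

definition standard_grading ::
    "('k::field, 'a) module \<Rightarrow> ('n::finite \<Rightarrow> 'a) \<Rightarrow> int ^ 'n \<Rightarrow> 'a set" where
  "standard_grading R y s = lin_span R {m. degree_monomial R y m s}"

section \<open>Bicharacters and free abelian groups\<close>

definition bicharacter :: "('g::ab_group_add \<Rightarrow> 'g \<Rightarrow> 'k::field) \<Rightarrow> bool" where
  "bicharacter chi \<longleftrightarrow> (\<forall>s t. chi s t \<noteq> 0) \<and>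
     (\<forall>s s' t. chi (s + s') t = chi s t * chi s' t) \<and> (\<forall>s t t'. chi s (t + t') = chi s t * chi s t')"

definition alternating_bicharacter :: "('g::ab_group_add \<Rightarrow> 'g \<Rightarrow> 'k::field) \<Rightarrow> bool" where
  "alternating_bicharacter chi \<longleftrightarrow> bicharacter chi \<and> (\<forall>s. chi s s = 1)"

definition bicharacter_matrix :: "(int ^ 'n \<Rightarrow> int ^ 'n \<Rightarrow> 'k::field) \<Rightarrow> 'n::finite \<Rightarrow> 'n \<Rightarrow> 'k" where
  "bicharacter_matrix chi i j = chi (axis i 1) (axis j 1)"

text \<open>A basis of a free abelian group is a subset of it, so \<open>B\<close> may be taken in \<open>'g\<close>.\<close>

definition free_abelian :: "'g::ab_group_add itself \<Rightarrow> bool" where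
  "free_abelian _ \<longleftrightarrow>
     (\<exists>B :: 'g set.
        \<lparr>carrier = (UNIV :: 'g set), monoid.mult = (+), one = 0\<rparr> \<cong> free_Abelian_group B)"

end

theory Submission
  imports Defs
begin

text \<open>
  The twist of \<open>A\<close> by \<open>c\<close> embeds into a twisted group algebra of \<open>int ^ 'n\<close> in which the
  monomials of degrees \<open>s\<close> and \<open>t\<close> have commutator
  \<open>r s t = chi s t * c (phi s) (phi t) / c (phi t) (phi s)\<close>.  Leading terms for a lexicographic
  order show that it is a domain, and polynomial growth gives the right Ore condition.  The leading
  term extends to a homomorphism from the units of the quotient division ring to a central extension
  of \<open>int ^ 'n\<close> whose derived subgroup is generated by the scalars \<open>r s t\<close>.  So these scalars
  generate \<open>AD\<close> of the twist.  For \<open>s\<close> in the kernel of \<open>phi\<close> they do not depend on \<open>c\<close>, and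
  a suitable \<open>c\<close>, built from a section of \<open>phi\<close>, cancels everything else.
\<close>

text \<open>\<open>Fract\<close> is an unspecified choice among localizations. Its existence is
  therefore proved once, on the type where the choice is made, and afterwards only the defining
  properties of a right localization are used. An intermediate algebra may lack the inverses of the
  generators, and it need not contain the Laurent components of its elements. What it surely
  contains is the monomials with nonnegative exponents. So the Ore equation is solved with such
  exponents, and commutators are computed for such monomials and then extended to all exponents by
  bimultiplicativity. The torus is known only through a presentation and a localization, so the
  linear independence of its monomials has to be proved: a concrete model, the twisted group algebra
  of \<open>\<beta>\<close>, receives a map from the free algebra that kills the relations. The
  cocycle of this model cannot be \<open>chi\<close>, whose commutators would be the squares of its
  values, nor a square root of \<open>chi\<close>, which need not exist over the field. The function
  \<open>\<beta>\<close> arises instead from bringing a product of monomials into a fixed order of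
  the generators.\<close>

no_notation fps_nth (infixl \<open>$\<close> 75)

text \<open>The rule would turn \<open>single 0 1\<close> into the class constant \<open>1\<close>,
  which belongs to the untwisted product and is invisible to the rules about
  \<open>single\<close>.\<close>

declare single_one [simp del]

section \<open>Scalar multiples and supports of finitely supported functions\<close>

definition pscale :: "'k::field \<Rightarrow> ('g \<Rightarrow>\<^sub>0 'k) \<Rightarrow> ('g \<Rightarrow>\<^sub>0 'k)" where
  "pscale c p = Poly_Mapping.map ((*) c) p"

lemma lookup_pscale [simp]: "Poly_Mapping.lookup (pscale c p) s = c * Poly_Mapping.lookup p s"
  by (simp add: pscale_def Poly_Mapping.map.rep_eq when_def)

lemma pscale_zero [simp]: "pscale c 0 = 0"
  by (simp add: poly_mapping_eq_iff fun_eq_iff)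

lemma pscale_single [simp]: "pscale c (Poly_Mapping.single s a) = Poly_Mapping.single s (c * a)"
  by (auto simp add: poly_mapping_eq_iff fun_eq_iff lookup_single when_def)

lemma pscale_one [simp]: "pscale 1 p = p"
  by (simp add: poly_mapping_eq_iff fun_eq_iff)

lemma pscale_pscale [simp]: "pscale c (pscale d p) = pscale (c * d) p"
  by (simp add: poly_mapping_eq_iff fun_eq_iff mult.assoc)

lemma pscale_add: "pscale c (p + q) = pscale c p + pscale c q"
  by (simp add: poly_mapping_eq_iff fun_eq_iff lookup_add algebra_simps)

lemma pscale_add_left: "pscale (c + d) p = pscale c p + pscale d p"
  by (simp add: poly_mapping_eq_iff fun_eq_iff lookup_add algebra_simps)

lemma pscale_sum: "pscale c (sum f S) = (\<Sum>x\<in>S. pscale c (f x))"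
  by (induction S rule: infinite_finite_induct) (auto simp: pscale_add)

lemma pscale_eq_0_iff: "pscale c p = 0 \<longleftrightarrow> c = 0 \<or> p = 0"
  by (auto simp add: poly_mapping_eq_iff fun_eq_iff)

lemma keys_pscale: "Poly_Mapping.keys (pscale c p) \<subseteq> Poly_Mapping.keys p"
  by (auto simp: in_keys_iff)

lemma poly_mapping_expand:
  fixes p :: "'a \<Rightarrow>\<^sub>0 'b::comm_monoid_add"
  assumes "finite S" "Poly_Mapping.keys p \<subseteq> S"
  shows "p = (\<Sum>s\<in>S. Poly_Mapping.single s (Poly_Mapping.lookup p s))"
proof (rule poly_mapping_eqI)
  fix k
  have "(\<Sum>s\<in>S. Poly_Mapping.lookup p s when s = k) = (\<Sum>s\<in>S. if k = s then Poly_Mapping.lookup p s else 0)"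
    by (rule sum.cong) (auto simp: when_def)
  then show "Poly_Mapping.lookup p k = Poly_Mapping.lookup (\<Sum>s\<in>S. Poly_Mapping.single s (Poly_Mapping.lookup p s)) k"
    using assms by (auto simp: lookup_sum lookup_single sum.delta in_keys_iff)
qed

lemma poly_mapping_single_induct [case_names zero single add]:
  fixes p :: "'a \<Rightarrow>\<^sub>0 'b::comm_monoid_add"
  assumes "P 0" "\<And>s a. P (Poly_Mapping.single s a)" "\<And>p q. P p \<Longrightarrow> P q \<Longrightarrow> P (p + q)"
  shows "P p"
proof -
  have "P (\<Sum>s\<in>S. Poly_Mapping.single s (Poly_Mapping.lookup p s))" for S
    by (induction S rule: infinite_finite_induct) (auto intro: assms)
  then show ?thesis
    by (subst poly_mapping_expand[of "Poly_Mapping.keys p" p]) simp_all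
qed

section \<open>Twisted group algebras\<close>

text \<open>Stated for an arbitrary function, so that the same product serves for
  \<open>\<beta>\<close>, for its twist by a cocycle and for the normalised twist; associativity and
  the unit are derived from the cocycle identity separately.\<close>

definition tmul :: "('g::ab_group_add \<Rightarrow> 'g \<Rightarrow> 'k::field) \<Rightarrow> ('g \<Rightarrow>\<^sub>0 'k) \<Rightarrow> ('g \<Rightarrow>\<^sub>0 'k) \<Rightarrow> ('g \<Rightarrow>\<^sub>0 'k)" where
  "tmul \<kappa> p q = (\<Sum>s\<in>Poly_Mapping.keys p. \<Sum>t\<in>Poly_Mapping.keys q.
     Poly_Mapping.single (s + t) (\<kappa> s t * Poly_Mapping.lookup p s * Poly_Mapping.lookup q t))"

text \<open>The supports in the definition change under addition and scaling. Summing over larger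
  fixed sets makes bilinearity a termwise statement.\<close>

lemma tmul_superset:
  assumes "finite S" "Poly_Mapping.keys p \<subseteq> S" "finite S'" "Poly_Mapping.keys q \<subseteq> S'"
  shows "tmul \<kappa> p q = (\<Sum>s\<in>S. \<Sum>t\<in>S'.
     Poly_Mapping.single (s + t) (\<kappa> s t * Poly_Mapping.lookup p s * Poly_Mapping.lookup q t))"
proof -
  have "(\<Sum>t\<in>Poly_Mapping.keys q. Poly_Mapping.single (s + t) (\<kappa> s t * Poly_Mapping.lookup p s * Poly_Mapping.lookup q t))
      = (\<Sum>t\<in>S'. Poly_Mapping.single (s + t) (\<kappa> s t * Poly_Mapping.lookup p s * Poly_Mapping.lookup q t))" for s
    by (rule sum.mono_neutral_left) (use assms in \<open>auto simp: in_keys_iff\<close>)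
  then show ?thesis
    unfolding tmul_def by (simp, intro sum.mono_neutral_left) (use assms in \<open>auto simp: in_keys_iff\<close>)
qed

lemma tmul_add_left: "tmul \<kappa> (p + p') q = tmul \<kappa> p q + tmul \<kappa> p' q"
proof -
  define S where "S = Poly_Mapping.keys p \<union> Poly_Mapping.keys p'"
  have "finite S" "Poly_Mapping.keys p \<subseteq> S" "Poly_Mapping.keys p' \<subseteq> S" "Poly_Mapping.keys (p + p') \<subseteq> S"
    unfolding S_def using keys_add[of p p'] by auto
  then show ?thesis
    by (simp add: tmul_superset[of S _ "Poly_Mapping.keys q"] lookup_add distrib_left distrib_right single_add sum.distrib)
qed

lemma tmul_add_right: "tmul \<kappa> p (q + q') = tmul \<kappa> p q + tmul \<kappa> p q'"
proof -
  define S where "S = Poly_Mapping.keys q \<union> Poly_Mapping.keys q'"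
  have "finite S" "Poly_Mapping.keys q \<subseteq> S" "Poly_Mapping.keys q' \<subseteq> S" "Poly_Mapping.keys (q + q') \<subseteq> S"
    unfolding S_def using keys_add[of q q'] by auto
  then show ?thesis
    by (simp add: tmul_superset[of "Poly_Mapping.keys p" _ S] lookup_add distrib_left single_add sum.distrib)
qed

lemma tmul_zero_left [simp]: "tmul \<kappa> 0 q = 0"
  and tmul_zero_right [simp]: "tmul \<kappa> p 0 = 0"
  by (simp_all add: tmul_def)

lemma tmul_single [simp]:
  "tmul \<kappa> (Poly_Mapping.single s a) (Poly_Mapping.single t b) = Poly_Mapping.single (s + t) (\<kappa> s t * a * b)"
  by (subst tmul_superset[of "{s}" _ "{t}"]) auto

lemma tmul_sum_left: "tmul \<kappa> (sum f S) q = (\<Sum>x\<in>S. tmul \<kappa> (f x) q)"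
  by (induction S rule: infinite_finite_induct) (auto simp: tmul_add_left)

lemma tmul_sum_right: "tmul \<kappa> p (sum f S) = (\<Sum>x\<in>S. tmul \<kappa> p (f x))"
  by (induction S rule: infinite_finite_induct) (auto simp: tmul_add_right)

lemma tmul_pscale_left: "tmul \<kappa> (pscale c p) q = pscale c (tmul \<kappa> p q)"
  by (subst tmul_superset[of "Poly_Mapping.keys p" _ "Poly_Mapping.keys q"])
    (auto simp: keys_pscale tmul_def pscale_sum mult_ac)

lemma tmul_pscale_right: "tmul \<kappa> p (pscale c q) = pscale c (tmul \<kappa> p q)"
  by (subst tmul_superset[of "Poly_Mapping.keys p" _ "Poly_Mapping.keys q"])
    (auto simp: keys_pscale tmul_def pscale_sum mult_ac)

lemma keys_tmul: "Poly_Mapping.keys (tmul \<kappa> p q) \<subseteq> {s + t | s t. s \<in> Poly_Mapping.keys p \<and> t \<in> Poly_Mapping.keys q}"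
  unfolding tmul_def
  by (rule order_trans[OF keys_sum], rule UN_least, rule order_trans[OF keys_sum]) auto

lemma cocycles2D:
  assumes "\<kappa> \<in> cocycles2"
  shows "\<kappa> s t \<noteq> 0" "\<kappa> s (t + u) * \<kappa> t u = \<kappa> (s + t) u * \<kappa> s t"
  using assms by (auto simp: cocycles2_def)

text \<open>The cocycle identity with two zero arguments, after cancelling a nonzero value. Hence
  normalising the single value at (0, 0) is enough to get a unit.\<close>

lemma cocycles2_zero:
  assumes "\<kappa> \<in> cocycles2"
  shows "\<kappa> 0 t = \<kappa> 0 0" "\<kappa> s 0 = \<kappa> 0 0"
  using cocycles2D(2)[OF assms, of 0 0 t] cocycles2D(2)[OF assms, of s 0 0] cocycles2D(1)[OF assms]
  by auto

text \<open>Both sides are additive in each argument, and on three monomials the claim is exactly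
  the cocycle identity.\<close>

lemma tmul_assoc:
  assumes "\<kappa> \<in> cocycles2"
  shows "tmul \<kappa> (tmul \<kappa> p q) r = tmul \<kappa> p (tmul \<kappa> q r)"
proof -
  have single: "tmul \<kappa> (tmul \<kappa> (Poly_Mapping.single s a) (Poly_Mapping.single t b)) (Poly_Mapping.single u c)
    = tmul \<kappa> (Poly_Mapping.single s a) (tmul \<kappa> (Poly_Mapping.single t b) (Poly_Mapping.single u c))" for s t u a b c
  proof -
    have "\<kappa> (s + t) u * (\<kappa> s t * a * b) * c = (\<kappa> (s + t) u * \<kappa> s t) * (a * b * c)"
      by (simp add: mult_ac)
    also have "\<dots> = (\<kappa> s (t + u) * \<kappa> t u) * (a * b * c)"
      by (simp only: cocycles2D(2)[OF assms])
    also have "\<dots> = \<kappa> s (t + u) * a * (\<kappa> t u * b * c)"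
      by (simp add: mult_ac)
    finally show ?thesis by (simp only: tmul_single add.assoc)
  qed
  have "tmul \<kappa> (tmul \<kappa> (Poly_Mapping.single s a) (Poly_Mapping.single t b)) r
    = tmul \<kappa> (Poly_Mapping.single s a) (tmul \<kappa> (Poly_Mapping.single t b) r)" for s t a b
    by (induction r rule: poly_mapping_single_induct) (simp_all add: single tmul_add_right del: tmul_single)
  then have "tmul \<kappa> (tmul \<kappa> (Poly_Mapping.single s a) q) r
    = tmul \<kappa> (Poly_Mapping.single s a) (tmul \<kappa> q r)" for s a
    by (induction q rule: poly_mapping_single_induct) (simp_all add: tmul_add_left tmul_add_right)
  then show ?thesis
    by (induction p rule: poly_mapping_single_induct) (simp_all add: tmul_add_left)
qed

lemma tmul_one:
  assumes "\<kappa> \<in> cocycles2" "\<kappa> 0 0 = 1"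
  shows "tmul \<kappa> (Poly_Mapping.single 0 1) p = p" "tmul \<kappa> p (Poly_Mapping.single 0 1) = p"
proof -
  have "\<kappa> 0 s = 1" "\<kappa> s 0 = 1" for s
    using cocycles2_zero[OF assms(1)] assms(2) by metis+
  then show "tmul \<kappa> (Poly_Mapping.single 0 1) p = p" "tmul \<kappa> p (Poly_Mapping.single 0 1) = p"
    by (induction p rule: poly_mapping_single_induct) (simp_all add: tmul_add_left tmul_add_right)
qed

text \<open>The commutator of \<open>single s 1\<close> and \<open>single t 1\<close> in the twisted group algebra.\<close>

definition alt_of :: "('g::ab_group_add \<Rightarrow> 'g \<Rightarrow> 'k::field) \<Rightarrow> 'g \<Rightarrow> 'g \<Rightarrow> 'k" where
  "alt_of \<kappa> s t = \<kappa> s t / \<kappa> t s"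

lemma alt_of_nonzero: "\<kappa> \<in> cocycles2 \<Longrightarrow> alt_of \<kappa> s t \<noteq> 0"
  by (simp add: alt_of_def cocycles2D(1))

lemma alt_of_swap: "\<kappa> \<in> cocycles2 \<Longrightarrow> alt_of \<kappa> t s = inverse (alt_of \<kappa> s t)"
  by (simp add: alt_of_def)

lemma alt_of_add_left:
  assumes "\<kappa> \<in> cocycles2"
  shows "alt_of \<kappa> (s + s') t = alt_of \<kappa> s t * alt_of \<kappa> s' t"
proof -
  note c = cocycles2D(2)[OF assms] and nz = cocycles2D(1)[OF assms]
  \<comment> \<open>The cocycle identity for the triples (s, s', t), (t, s, s') and (s, t, s'), one
    for each position of \<open>t\<close>; all auxiliary values cancel in the quotient.\<close>
  have 1: "\<kappa> s (s' + t) * \<kappa> s' t = \<kappa> (s + s') t * \<kappa> s s'" using c .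
  have 2: "\<kappa> t (s + s') * \<kappa> s s' = \<kappa> (t + s) s' * \<kappa> t s" using c .
  have 3: "\<kappa> s (t + s') * \<kappa> t s' = \<kappa> (s + t) s' * \<kappa> s t" using c .
  have 4: "\<kappa> (s + s') t = \<kappa> s (s' + t) * \<kappa> s' t / \<kappa> s s'"
    and 5: "\<kappa> t (s + s') = \<kappa> (t + s) s' * \<kappa> t s / \<kappa> s s'"
    and 6: "\<kappa> s (s' + t) = \<kappa> (t + s) s' * \<kappa> s t / \<kappa> t s'"
    using 1 2 3 nz by (simp_all add: eq_divide_eq add.commute)
  show ?thesis unfolding alt_of_def 4 5 6 using nz by (simp add: field_simps)
qed

subsection \<open>Leading terms\<close>

text \<open>The positive elements of a translation-invariant total order, in which \<open>t\<close>
  lies below \<open>s\<close> when \<open>pos (s - t)\<close>.\<close>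

locale positive_cone =
  fixes pos :: "'g::ab_group_add \<Rightarrow> bool"
  assumes pos_add: "pos s \<Longrightarrow> pos t \<Longrightarrow> pos (s + t)"
    and pos_total: "s = 0 \<or> pos s \<or> pos (- s)"
    and not_pos_0: "\<not> pos 0"
begin

definition lead :: "('g \<Rightarrow>\<^sub>0 'k::field) \<Rightarrow> 'g" where
  "lead p = (SOME s. s \<in> Poly_Mapping.keys p \<and> (\<forall>t\<in>Poly_Mapping.keys p. t = s \<or> pos (s - t)))"

lemma exists_greatest:
  assumes "finite S" "S \<noteq> {}"
  shows "\<exists>s\<in>S. \<forall>t\<in>S. t = s \<or> pos (s - t)"
  using assms
proof (induction rule: finite_ne_induct)
  case (insert x S)
  then obtain s where s: "s \<in> S" "\<forall>t\<in>S. t = s \<or> pos (s - t)" by auto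
  consider "x = s" | "pos (x - s)" | "pos (s - x)"
    using pos_total[of "x - s"] by auto
  then show ?case
  proof cases
    case 2
    have "pos (x - t)" if "t \<in> S" for t
      using s(2) that 2 pos_add[OF 2, of "s - t"] by auto
    then show ?thesis by blast
  qed (use s in auto)
qed auto

lemma lead:
  assumes "p \<noteq> 0"
  shows "lead p \<in> Poly_Mapping.keys p" "t \<in> Poly_Mapping.keys p \<Longrightarrow> t = lead p \<or> pos (lead p - t)"
proof -
  have "\<exists>s. s \<in> Poly_Mapping.keys p \<and> (\<forall>t\<in>Poly_Mapping.keys p. t = s \<or> pos (s - t))"
    using exists_greatest[of "Poly_Mapping.keys p"] assms by auto
  from someI_ex[OF this]
  show "lead p \<in> Poly_Mapping.keys p" "t \<in> Poly_Mapping.keys p \<Longrightarrow> t = lead p \<or> pos (lead p - t)"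
    unfolding lead_def by auto
qed

lemma lead_eqI:
  assumes "s \<in> Poly_Mapping.keys p" "\<And>t. t \<in> Poly_Mapping.keys p \<Longrightarrow> t = s \<or> pos (s - t)"
  shows "lead p = s"
proof (rule ccontr)
  assume *: "lead p \<noteq> s"
  have "p \<noteq> 0" using assms(1) by auto
  with lead[of p] assms * have "pos (s - lead p)" "pos (lead p - s)" by metis+
  from pos_add[OF this] show False by (simp add: not_pos_0)
qed

definition lcoeff :: "('g \<Rightarrow>\<^sub>0 'k::field) \<Rightarrow> 'k" where
  "lcoeff p = Poly_Mapping.lookup p (lead p)"

lemma lcoeff_nonzero: "p \<noteq> 0 \<Longrightarrow> lcoeff p \<noteq> 0"
  using lead(1)[of p] by (simp add: lcoeff_def in_keys_iff)

lemma lead_single [simp]: "a \<noteq> 0 \<Longrightarrow> lead (Poly_Mapping.single s a) = s"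
  by (rule lead_eqI) auto

lemma lcoeff_single [simp]: "a \<noteq> 0 \<Longrightarrow> lcoeff (Poly_Mapping.single s a) = a"
  by (simp add: lcoeff_def)

text \<open>Only one pair of exponents reaches the top degree: another pair with the same sum would
  differ from the leading one in both entries, and the two positive differences would add up to
  0.\<close>

lemma lookup_tmul_lead:
  assumes "p \<noteq> 0" "q \<noteq> 0"
  shows "Poly_Mapping.lookup (tmul \<kappa> p q) (lead p + lead q) = \<kappa> (lead p) (lead q) * lcoeff p * lcoeff q"
proof -
  have *: "s = lead p \<and> t = lead q"
    if "s \<in> Poly_Mapping.keys p" "t \<in> Poly_Mapping.keys q" "s + t = lead p + lead q" for s t
  proof (rule ccontr)
    assume "\<not> (s = lead p \<and> t = lead q)"
    then have "s \<noteq> lead p" "t \<noteq> lead q" using that(3) by auto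
    then have "pos (lead p - s)" "pos (lead q - t)"
      using that(1,2) lead(2)[OF assms(1)] lead(2)[OF assms(2)] by blast+
    moreover have "(lead p - s) + (lead q - t) = 0" using that(3) by (simp add: algebra_simps)
    ultimately show False using pos_add not_pos_0 by metis
  qed
  have "Poly_Mapping.lookup (tmul \<kappa> p q) (lead p + lead q) =
     (\<Sum>s\<in>Poly_Mapping.keys p. \<Sum>t\<in>Poly_Mapping.keys q. \<kappa> s t * Poly_Mapping.lookup p s * Poly_Mapping.lookup q t when s + t = lead p + lead q)"
    by (simp add: tmul_def lookup_sum lookup_single)
  also have "\<dots> = (\<Sum>s\<in>Poly_Mapping.keys p. if s = lead p then \<Sum>t\<in>Poly_Mapping.keys q. if t = lead q then \<kappa> s t * Poly_Mapping.lookup p s * Poly_Mapping.lookup q t else 0 else 0)"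
  proof (intro sum.cong refl)
    fix s assume s: "s \<in> Poly_Mapping.keys p"
    show "(\<Sum>t\<in>Poly_Mapping.keys q. \<kappa> s t * Poly_Mapping.lookup p s * Poly_Mapping.lookup q t when s + t = lead p + lead q)
      = (if s = lead p then \<Sum>t\<in>Poly_Mapping.keys q. if t = lead q then \<kappa> s t * Poly_Mapping.lookup p s * Poly_Mapping.lookup q t else 0 else 0)"
      using *[OF s] lead(1)[OF assms(1)] by (cases "s = lead p") (force simp: when_def intro!: sum.cong sum.neutral)+
  qed
  finally show ?thesis
    using lead(1)[OF assms(1)] lead(1)[OF assms(2)] by (simp add: sum.delta lcoeff_def)
qed

text \<open>Besides the absence of zero divisors this yields the multiplication rule for pairs of
  leading coefficient and leading exponent, which is the product of \<open>lead_group\<close>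
  below.\<close>

lemma lead_tmul:
  assumes "p \<noteq> 0" "q \<noteq> 0" "\<kappa> (lead p) (lead q) \<noteq> 0"
  shows "tmul \<kappa> p q \<noteq> 0" "lead (tmul \<kappa> p q) = lead p + lead q"
    "lcoeff (tmul \<kappa> p q) = \<kappa> (lead p) (lead q) * lcoeff p * lcoeff q"
proof -
  have nz: "Poly_Mapping.lookup (tmul \<kappa> p q) (lead p + lead q) \<noteq> 0"
    using lookup_tmul_lead[OF assms(1,2), of \<kappa>] assms(3) lcoeff_nonzero[OF assms(1)] lcoeff_nonzero[OF assms(2)] by simp
  then show "tmul \<kappa> p q \<noteq> 0" by auto
  show l: "lead (tmul \<kappa> p q) = lead p + lead q"
  proof (rule lead_eqI)
    show "lead p + lead q \<in> Poly_Mapping.keys (tmul \<kappa> p q)" using nz by (simp add: in_keys_iff)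
    fix u assume "u \<in> Poly_Mapping.keys (tmul \<kappa> p q)"
    then obtain s t where st: "u = s + t" "s \<in> Poly_Mapping.keys p" "t \<in> Poly_Mapping.keys q"
      using keys_tmul[of \<kappa> p q] by auto
    have *: "lead p + lead q - u = (lead p - s) + (lead q - t)" using st by simp
    then show "u = lead p + lead q \<or> pos (lead p + lead q - u)"
      unfolding * using lead(2)[OF assms(1) st(2)] lead(2)[OF assms(2) st(3)] pos_add[of "lead p - s" "lead q - t"] st(1)
      by (elim disjE) simp_all
  qed
  show "lcoeff (tmul \<kappa> p q) = \<kappa> (lead p) (lead q) * lcoeff p * lcoeff q"
    using lookup_tmul_lead[OF assms(1,2), of \<kappa>] by (simp add: lcoeff_def[of "tmul \<kappa> p q"] l)
qed

end

section \<open>Lexicographic orders on integer vectors\<close>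

fun lex_pos :: "'n list \<Rightarrow> int ^ 'n::finite \<Rightarrow> bool" where
  "lex_pos [] s \<longleftrightarrow> False"
| "lex_pos (i # is) s \<longleftrightarrow> 0 < s $ i \<or> (s $ i = 0 \<and> lex_pos is s)"

text \<open>The list has to reach every index for totality: a vector that vanishes at all listed
  indices must be 0. Repetitions are harmless.\<close>

lemma positive_cone_lex:
  assumes "set is = UNIV"
  shows "positive_cone (lex_pos is)"
proof
  fix s t :: "int ^ 'a"
  have "lex_pos js s \<Longrightarrow> lex_pos js t \<Longrightarrow> lex_pos js (s + t)" for js
    by (induction js) auto
  then show "lex_pos is s \<Longrightarrow> lex_pos is t \<Longrightarrow> lex_pos is (s + t)" .
  have "(\<forall>i\<in>set js. s $ i = 0) \<or> lex_pos js s \<or> lex_pos js (- s)" for js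
    by (induction js) auto
  from this[of "is"] show "s = 0 \<or> lex_pos is s \<or> lex_pos is (- s)"
    using assms by (auto simp: vec_eq_iff)
  have "\<not> lex_pos js 0" for js :: "'a list" by (induction js) auto
  then show "\<not> lex_pos is 0" .
qed

section \<open>Algebras over a field given as a type\<close>

lemma carrier_type_ring [simp]: "carrier ring_of_type_algebra = UNIV"
  and mult_type_ring [simp]: "x \<otimes>\<^bsub>ring_of_type_algebra\<^esub> y = x * y"
  and add_type_ring [simp]: "x \<oplus>\<^bsub>ring_of_type_algebra\<^esub> y = x + y"
  and one_type_ring [simp]: "\<one>\<^bsub>ring_of_type_algebra\<^esub> = 1"
  and zero_type_ring [simp]: "\<zero>\<^bsub>ring_of_type_algebra\<^esub> = 0"
  by (simp_all add: ring_of_type_algebra_def)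

locale assoc_algebra =
  fixes R :: "('k::field, 'a) module" (structure)
  assumes k_algebra: "k_algebra R"
begin

sublocale ring R
  using k_algebra by (simp add: k_algebra_def)

lemma module_R: "module (ring_of_type_algebra :: 'k ring) R"
  using k_algebra by (simp add: k_algebra_def)

lemma smult_closed [simp, intro]: "x \<in> carrier R \<Longrightarrow> c \<odot> x \<in> carrier R"
  using module.smult_closed[OF module_R, of c x] by simp

lemma smult_mult:
  assumes "x \<in> carrier R" "y \<in> carrier R"
  shows "(c \<odot> x) \<otimes> y = c \<odot> (x \<otimes> y)" "x \<otimes> (c \<odot> y) = c \<odot> (x \<otimes> y)"
  using k_algebra assms by (auto simp: k_algebra_def)

lemma smult_add_right: "x \<in> carrier R \<Longrightarrow> y \<in> carrier R \<Longrightarrow> c \<odot> (x \<oplus> y) = c \<odot> x \<oplus> c \<odot> y"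
  using module.smult_r_distr[OF module_R, of c x y] by simp

lemma smult_add_left: "x \<in> carrier R \<Longrightarrow> (c + d) \<odot> x = c \<odot> x \<oplus> d \<odot> x"
  using module.smult_l_distr[OF module_R, of c d x] by simp

lemma smult_smult: "x \<in> carrier R \<Longrightarrow> c \<odot> (d \<odot> x) = (c * d) \<odot> x"
  using module.smult_assoc1[OF module_R, of c d x] by simp

lemma smult_one_left [simp]: "x \<in> carrier R \<Longrightarrow> 1 \<odot> x = x"
  using module.smult_one[OF module_R, of x] by simp

lemma smult_zero_left [simp]: "x \<in> carrier R \<Longrightarrow> 0 \<odot> x = \<zero>"
  using module.smult_l_null[OF module_R, of x] by simp

lemma smult_zero_right [simp]: "c \<odot> \<zero> = \<zero>"
  using module.smult_r_null[OF module_R, of c] by simp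

lemma smult_eq_zero_iff: "x \<in> carrier R \<Longrightarrow> c \<odot> x = \<zero> \<longleftrightarrow> c = 0 \<or> x = \<zero>"
proof
  assume x: "x \<in> carrier R" and eq: "c \<odot> x = \<zero>"
  show "c = 0 \<or> x = \<zero>"
  proof (rule disjCI)
    assume "x \<noteq> \<zero>"
    have "inverse c \<odot> (c \<odot> x) = \<zero>" by (simp add: eq)
    with x \<open>x \<noteq> \<zero>\<close> show "c = 0"
      using smult_smult[of x "inverse c" c] by (cases "c = 0") auto
  qed
qed auto

end

lemma k_algebraI:
  fixes R :: "('k::field, 'a) module" (structure)
  assumes "ring R"
    and "\<And>c x. x \<in> carrier R \<Longrightarrow> c \<odot> x \<in> carrier R"
    and "\<And>c d x. x \<in> carrier R \<Longrightarrow> (c + d) \<odot> x = c \<odot> x \<oplus> d \<odot> x"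
    and "\<And>c x y. x \<in> carrier R \<Longrightarrow> y \<in> carrier R \<Longrightarrow> c \<odot> (x \<oplus> y) = c \<odot> x \<oplus> c \<odot> y"
    and "\<And>c d x. x \<in> carrier R \<Longrightarrow> (c * d) \<odot> x = c \<odot> (d \<odot> x)"
    and "\<And>x. x \<in> carrier R \<Longrightarrow> 1 \<odot> x = x"
    and "\<And>c x y. x \<in> carrier R \<Longrightarrow> y \<in> carrier R \<Longrightarrow> (c \<odot> x) \<otimes> y = c \<odot> (x \<otimes> y)"
    and "\<And>c x y. x \<in> carrier R \<Longrightarrow> y \<in> carrier R \<Longrightarrow> x \<otimes> (c \<odot> y) = c \<odot> (x \<otimes> y)"
  shows "k_algebra R"
  unfolding k_algebra_def
  using assms ring.is_abelian_group[OF assms(1)] by (auto intro!: moduleI)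

section \<open>Ore localization of a right Ore domain\<close>

locale ore_domain = assoc_algebra R for R :: "('k::field, 'a) module" (structure) +
  assumes one_not_zero: "\<one> \<noteq> \<zero>"
    and domain: "x \<in> carrier R \<Longrightarrow> y \<in> carrier R \<Longrightarrow> x \<otimes> y = \<zero> \<Longrightarrow> x = \<zero> \<or> y = \<zero>"
    and ore: "x \<in> carrier R \<Longrightarrow> y \<in> carrier R \<Longrightarrow> x \<noteq> \<zero> \<Longrightarrow> y \<noteq> \<zero> \<Longrightarrow>
      \<exists>u\<in>carrier R. \<exists>v\<in>carrier R. x \<otimes> u = y \<otimes> v \<and> x \<otimes> u \<noteq> \<zero>"
begin

lemma right_cancel:
  assumes "x \<in> carrier R" "y \<in> carrier R" "v \<in> carrier R" "v \<noteq> \<zero>" "x \<otimes> v = y \<otimes> v"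
  shows "x = y"
proof -
  have "(x \<ominus> y) \<otimes> v = \<zero>"
    using assms by (simp add: minus_eq l_distr l_minus r_neg)
  then show ?thesis using assms domain[of "x \<ominus> y" v] by (simp add: r_right_minus_eq)
qed

text \<open>
  A right fraction \<open>q\<close> is represented by the set of all \<open>(x, y)\<close> with \<open>x = q y\<close>, the graph of a
  partial endomorphism of the right module \<open>R\<close> that has no proper extension.
\<close>

definition partial_endo :: "('a \<times> 'a) set \<Rightarrow> bool" where
  "partial_endo G \<longleftrightarrow> G \<subseteq> carrier R \<times> carrier R \<and>
     (\<forall>x y x' y'. (x, y) \<in> G \<longrightarrow> (x', y') \<in> G \<longrightarrow> (x \<oplus> x', y \<oplus> y') \<in> G) \<and>
     (\<forall>x y r. (x, y) \<in> G \<longrightarrow> r \<in> carrier R \<longrightarrow> (x \<otimes> r, y \<otimes> r) \<in> G) \<and>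
     (\<forall>x. (x, \<zero>) \<in> G \<longrightarrow> x = \<zero>) \<and> (\<exists>x y. (x, y) \<in> G \<and> y \<noteq> \<zero>)"

text \<open>Cancelling nonzero right factors produces the largest extension of a partial
  endomorphism, so that equal fractions become equal sets.\<close>

definition saturation :: "('a \<times> 'a) set \<Rightarrow> ('a \<times> 'a) set" where
  "saturation G = {(x, y). x \<in> carrier R \<and> y \<in> carrier R \<and>
     (\<exists>v\<in>carrier R. v \<noteq> \<zero> \<and> (x \<otimes> v, y \<otimes> v) \<in> G)}"

definition fraction :: "('a \<times> 'a) set \<Rightarrow> bool" where
  "fraction G \<longleftrightarrow> partial_endo G \<and> saturation G \<subseteq> G"

lemma partial_endoD:
  assumes "partial_endo G"
  shows "(x, y) \<in> G \<Longrightarrow> x \<in> carrier R" "(x, y) \<in> G \<Longrightarrow> y \<in> carrier R"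
    "(x, y) \<in> G \<Longrightarrow> (x', y') \<in> G \<Longrightarrow> (x \<oplus> x', y \<oplus> y') \<in> G"
    "(x, y) \<in> G \<Longrightarrow> r \<in> carrier R \<Longrightarrow> (x \<otimes> r, y \<otimes> r) \<in> G"
    "(x, \<zero>) \<in> G \<Longrightarrow> x = \<zero>"
  using assms by (auto simp: partial_endo_def)

lemma partial_endo_nonzero:
  assumes "partial_endo G"
  obtains x y where "(x, y) \<in> G" "y \<noteq> \<zero>"
  using assms by (auto simp: partial_endo_def)

lemma partial_endo_zero: "partial_endo G \<Longrightarrow> (\<zero>, \<zero>) \<in> G"
  using partial_endo_nonzero[of G] partial_endoD(1,2)[of G] partial_endoD(4)[of G _ _ \<zero>] by (metis r_null zero_closed)

lemma partial_endo_minus: "partial_endo G \<Longrightarrow> (x, y) \<in> G \<Longrightarrow> (\<ominus> x, \<ominus> y) \<in> G"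
  using partial_endoD(1,2)[of G x y] partial_endoD(4)[of G x y "\<ominus> \<one>"] by (simp add: r_minus)

lemma partial_endo_functional:
  assumes "partial_endo G" "(x, y) \<in> G" "(x', y) \<in> G"
  shows "x = x'"
proof -
  note D = partial_endoD(1,2)[OF assms(1)]
  have "(x \<oplus> \<ominus> x', y \<oplus> \<ominus> y) \<in> G"
    using partial_endoD(3)[OF assms(1,2) partial_endo_minus[OF assms(1,3)]] .
  then have "x \<oplus> \<ominus> x' = \<zero>"
    using partial_endoD(5)[OF assms(1)] D[OF assms(2)] by (simp add: r_neg)
  then show ?thesis
    using D[OF assms(2)] D[OF assms(3)] by (metis minus_equality minus_minus a_inv_closed a_comm)
qed

lemma saturation_superset: "partial_endo G \<Longrightarrow> G \<subseteq> saturation G"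
  unfolding saturation_def
  using one_not_zero partial_endoD(1,2)[of G] by (clarsimp, intro conjI bexI[of _ \<one>]) (metis r_one one_closed)+

lemma fraction_saturation:
  assumes G: "partial_endo G"
  shows "fraction (saturation G)"
proof -
  note D = partial_endoD[OF G]
  have "partial_endo (saturation G)"
    unfolding partial_endo_def
  proof (intro conjI allI impI)
    show "saturation G \<subseteq> carrier R \<times> carrier R" by (auto simp: saturation_def)
  next
    fix x y x' y' assume "(x, y) \<in> saturation G" "(x', y') \<in> saturation G"
    then obtain v v' where v: "x \<in> carrier R" "y \<in> carrier R" "x' \<in> carrier R" "y' \<in> carrier R"
      "v \<in> carrier R" "v' \<in> carrier R" "v \<noteq> \<zero>" "v' \<noteq> \<zero>"
      "(x \<otimes> v, y \<otimes> v) \<in> G" "(x' \<otimes> v', y' \<otimes> v') \<in> G"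
      by (auto simp: saturation_def)
    \<comment> \<open>A common right multiple of the two clearing factors \<open>v\<close> and
      \<open>v'\<close> clears both pairs at once.\<close>
    obtain u u' where u: "u \<in> carrier R" "u' \<in> carrier R" "v \<otimes> u = v' \<otimes> u'" "v \<otimes> u \<noteq> \<zero>"
      using ore[of v v'] v by auto
    have "(x \<otimes> v \<otimes> u \<oplus> x' \<otimes> v' \<otimes> u', y \<otimes> v \<otimes> u \<oplus> y' \<otimes> v' \<otimes> u') \<in> G"
      using D(3)[OF D(4)[OF v(9) u(1)] D(4)[OF v(10) u(2)]] .
    then have "((x \<oplus> x') \<otimes> (v \<otimes> u), (y \<oplus> y') \<otimes> (v \<otimes> u)) \<in> G"
      using v u by (simp add: m_assoc l_distr)
    then show "(x \<oplus> x', y \<oplus> y') \<in> saturation G"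
      unfolding saturation_def using v(1-5) u by (auto intro!: bexI[of _ "v \<otimes> u"])
  next
    fix x y r assume "(x, y) \<in> saturation G" and r: "r \<in> carrier R"
    then obtain v where v: "x \<in> carrier R" "y \<in> carrier R" "v \<in> carrier R" "v \<noteq> \<zero>" "(x \<otimes> v, y \<otimes> v) \<in> G"
      by (auto simp: saturation_def)
    \<comment> \<open>A nonzero \<open>w\<close> is needed that moves \<open>r\<close> into the
      right ideal of \<open>v\<close>. The Ore condition provides it for nonzero \<open>r\<close>;
      for \<open>r = \<zero>\<close> it is silent and \<open>\<one>\<close> serves.\<close>
    have "\<exists>u\<in>carrier R. \<exists>w\<in>carrier R. v \<otimes> u = r \<otimes> w \<and> w \<noteq> \<zero>"
    proof (cases "r = \<zero>")
      case True
      then show ?thesis using v one_not_zero by (intro bexI[of _ \<zero>] bexI[of _ \<one>]) auto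
    next
      case False
      then obtain u w where "u \<in> carrier R" "w \<in> carrier R" "v \<otimes> u = r \<otimes> w" "v \<otimes> u \<noteq> \<zero>"
        using ore[OF v(3) r v(4)] by blast
      then show ?thesis using r by (intro bexI[of _ u] bexI[of _ w]) auto
    qed
    then obtain u w where u: "u \<in> carrier R" "w \<in> carrier R" "v \<otimes> u = r \<otimes> w" "w \<noteq> \<zero>" by auto
    have "(x \<otimes> v \<otimes> u, y \<otimes> v \<otimes> u) \<in> G" using D(4)[OF v(5) u(1)] .
    then have "((x \<otimes> r) \<otimes> w, (y \<otimes> r) \<otimes> w) \<in> G" using u v r by (simp add: m_assoc)
    then show "(x \<otimes> r, y \<otimes> r) \<in> saturation G"
      unfolding saturation_def using v(1,2) u(2,4) r by (auto intro!: bexI[of _ w])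
  next
    fix x assume "(x, \<zero>) \<in> saturation G"
    then obtain v where v: "x \<in> carrier R" "v \<in> carrier R" "v \<noteq> \<zero>" "(x \<otimes> v, \<zero> \<otimes> v) \<in> G"
      by (auto simp: saturation_def)
    then have "(x \<otimes> v, \<zero>) \<in> G" by simp
    then have "x \<otimes> v = \<zero>" by (rule D(5))
    from domain[OF v(1,2) this] v(3) show "x = \<zero>" by simp
  next
    show "\<exists>x y. (x, y) \<in> saturation G \<and> y \<noteq> \<zero>"
    proof -
      obtain x y where "(x, y) \<in> G" "y \<noteq> \<zero>" using partial_endo_nonzero[OF G] .
      then show ?thesis using saturation_superset[OF G] by (intro exI[of _ x] exI[of _ y]) auto
    qed
  qed
  moreover have "saturation (saturation G) \<subseteq> saturation G"
  proof
    fix p assume "p \<in> saturation (saturation G)"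
    then obtain x y v w where *: "p = (x, y)" "x \<in> carrier R" "y \<in> carrier R" "v \<in> carrier R" "v \<noteq> \<zero>"
      "w \<in> carrier R" "w \<noteq> \<zero>" "(x \<otimes> v \<otimes> w, y \<otimes> v \<otimes> w) \<in> G"
      by (auto simp: saturation_def)
    then have "v \<otimes> w \<noteq> \<zero>" "(x \<otimes> (v \<otimes> w), y \<otimes> (v \<otimes> w)) \<in> G"
      using domain[of v w] by (auto simp: m_assoc)
    then show "p \<in> saturation G"
      unfolding saturation_def using * by auto
  qed
  ultimately show ?thesis by (simp add: fraction_def)
qed

lemma denominator_meets:
  assumes G: "partial_endo G" and H: "partial_endo H"
  obtains x x' y where "(x, y) \<in> G" "(x', y) \<in> H" "y \<noteq> \<zero>"
proof -
  obtain x y x' y' where *: "(x, y) \<in> G" "y \<noteq> \<zero>" "(x', y') \<in> H" "y' \<noteq> \<zero>"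
    using partial_endo_nonzero[OF G] partial_endo_nonzero[OF H] by metis
  obtain u v where u: "u \<in> carrier R" "v \<in> carrier R" "y \<otimes> u = y' \<otimes> v" "y \<otimes> u \<noteq> \<zero>"
    using ore[OF partial_endoD(2)[OF G *(1)] partial_endoD(2)[OF H *(3)] *(2,4)] by blast
  show ?thesis
    using that[OF partial_endoD(4)[OF G *(1) u(1)] _ u(4)] partial_endoD(4)[OF H *(3) u(2)] u(3) by simp
qed

text \<open>A denominator of \<open>G\<close> is matched with a numerator of \<open>H\<close>, which
  makes the composite nontrivial. If the numerator of \<open>H\<close> is zero, it is matched with
  the zero pair of \<open>G\<close> instead.\<close>

lemma numerator_meets:
  assumes G: "partial_endo G" and H: "partial_endo H"
  obtains x y z where "(x, y) \<in> G" "(y, z) \<in> H" "z \<noteq> \<zero>"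
proof -
  obtain x y x' y' where *: "(x, y) \<in> G" "y \<noteq> \<zero>" "(x', y') \<in> H" "y' \<noteq> \<zero>"
    using partial_endo_nonzero[OF G] partial_endo_nonzero[OF H] by metis
  note D = partial_endoD[OF G] partial_endoD[OF H]
  show ?thesis
  proof (cases "x' = \<zero>")
    case True
    then show ?thesis using that[OF partial_endo_zero[OF G] _ *(4)] *(3) by simp
  next
    case False
    obtain u v where u: "u \<in> carrier R" "v \<in> carrier R" "y \<otimes> u = x' \<otimes> v" "y \<otimes> u \<noteq> \<zero>"
      using ore[OF D(2)[OF *(1)] D(6)[OF *(3)] *(2) False] by blast
    have "v \<noteq> \<zero>" using u D(6)[OF *(3)] by auto
    then have nz: "y' \<otimes> v \<noteq> \<zero>" using domain[OF D(7)[OF *(3)] u(2)] *(4) by auto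
    show ?thesis
      using that[OF D(4)[OF *(1) u(1)] _ nz] D(9)[OF *(3) u(2)] u(3) by simp
  qed
qed

text \<open>By the Ore condition any pair of one graph can be moved over the shared nonzero
  denominator, where both graphs agree; saturation of the other graph then cancels the multiplier.
  Thus every identity between fractions below is checked at a single pair.\<close>

lemma fraction_eqI:
  assumes "fraction G" "fraction H" "(x, y) \<in> G" "(x, y) \<in> H" "y \<noteq> \<zero>"
  shows "G = H"
proof -
  have "G' \<subseteq> H'" if G: "fraction G'" and H: "fraction H'" and *: "(x, y) \<in> G'" "(x, y) \<in> H'" for G' H'
  proof
    fix p assume "p \<in> G'"
    then obtain a b where p: "p = (a, b)" "(a, b) \<in> G'" by (cases p) auto
    note D = partial_endoD[of G'] partial_endoD[of H']
    have ph: "partial_endo G'" "partial_endo H'" using G H by (auto simp: fraction_def)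
    have cr: "a \<in> carrier R" "b \<in> carrier R" "x \<in> carrier R" "y \<in> carrier R"
      using D(1,2)[OF ph(1) p(2)] D(1,2)[OF ph(1) *(1)] by auto
    show "p \<in> H'"
    proof (cases "b = \<zero>")
      case True
      then show ?thesis using p D(5)[OF ph(1), of a] partial_endo_zero[OF ph(2)] by simp
    next
      case False
      then obtain u v where u: "u \<in> carrier R" "v \<in> carrier R" "b \<otimes> u = y \<otimes> v" "b \<otimes> u \<noteq> \<zero>"
        using ore[OF cr(2,4) False assms(5)] by blast
      have "(a \<otimes> u, y \<otimes> v) \<in> G'" "(x \<otimes> v, y \<otimes> v) \<in> G'" "(x \<otimes> v, y \<otimes> v) \<in> H'"
        using partial_endoD(4)[OF ph(1) p(2) u(1)] partial_endoD(4)[OF ph(1) *(1) u(2)]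
          partial_endoD(4)[OF ph(2) *(2) u(2)] u by auto
      then have "(a \<otimes> u, b \<otimes> u) \<in> H'" using partial_endo_functional[OF ph(1)] u by metis
      moreover have "u \<noteq> \<zero>" using u cr by auto
      ultimately show ?thesis using H cr u(1) p(1) unfolding fraction_def saturation_def by auto
    qed
  qed
  then show ?thesis using assms by blast
qed

definition graph_sum :: "('a \<times> 'a) set \<Rightarrow> ('a \<times> 'a) set \<Rightarrow> ('a \<times> 'a) set" where
  "graph_sum G H = {(x \<oplus> x', y) | x x' y. (x, y) \<in> G \<and> (x', y) \<in> H}"

definition graph_smult :: "'k \<Rightarrow> ('a \<times> 'a) set \<Rightarrow> ('a \<times> 'a) set" where
  "graph_smult c G = {(c \<odot> x, y) | x y. (x, y) \<in> G}"

definition graph_of :: "'a \<Rightarrow> ('a \<times> 'a) set" where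
  "graph_of a = {(a \<otimes> y, y) | y. y \<in> carrier R}"

lemma partial_endo_sum:
  assumes G: "partial_endo G" and H: "partial_endo H"
  shows "partial_endo (graph_sum G H)"
  unfolding partial_endo_def
proof (intro conjI allI impI)
  note D = partial_endoD[OF G] partial_endoD[OF H]
  show "graph_sum G H \<subseteq> carrier R \<times> carrier R" using D(1,2,6,7) by (auto simp: graph_sum_def)
  obtain a b y where "(a, y) \<in> G" "(b, y) \<in> H" "y \<noteq> \<zero>" using denominator_meets[OF G H] .
  then have "(a \<oplus> b, y) \<in> graph_sum G H" by (auto simp: graph_sum_def)
  with \<open>y \<noteq> \<zero>\<close> show "\<exists>x y. (x, y) \<in> graph_sum G H \<and> y \<noteq> \<zero>" by auto
  show "x = \<zero>" if x: "(x, \<zero>) \<in> graph_sum G H" for x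
  proof -
    obtain a b where "x = a \<oplus> b" "(a, \<zero>) \<in> G" "(b, \<zero>) \<in> H" using x by (auto simp: graph_sum_def)
    then show ?thesis using D(5)[of a] D(10)[of b] by simp
  qed
  show "(x \<otimes> r, y \<otimes> r) \<in> graph_sum G H" if *: "(x, y) \<in> graph_sum G H" "r \<in> carrier R" for x y r
  proof -
    obtain a b where ab: "x = a \<oplus> b" "(a, y) \<in> G" "(b, y) \<in> H" using *(1) unfolding graph_sum_def by blast
    then show ?thesis
      unfolding graph_sum_def using D(4)[OF ab(2) *(2)] D(9)[OF ab(3) *(2)] D(1,6) *(2) l_distr by fastforce
  qed
  show "(x \<oplus> x', y \<oplus> y') \<in> graph_sum G H" if *: "(x, y) \<in> graph_sum G H" "(x', y') \<in> graph_sum G H" for x y x' y'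
  proof -
    obtain a b a' b' where ab: "x = a \<oplus> b" "(a, y) \<in> G" "(b, y) \<in> H" "x' = a' \<oplus> b'" "(a', y') \<in> G" "(b', y') \<in> H"
      using * unfolding graph_sum_def by blast
    have "x \<oplus> x' = (a \<oplus> a') \<oplus> (b \<oplus> b')"
      using ab D(1,6) by (simp add: a_ac)
    then show ?thesis
      unfolding graph_sum_def using D(3)[OF ab(2,5)] D(8)[OF ab(3,6)] by auto
  qed
qed

lemma partial_endo_comp:
  assumes G: "partial_endo G" and H: "partial_endo H"
  shows "partial_endo (G O H)"
  unfolding partial_endo_def
proof (intro conjI allI impI)
  note D = partial_endoD[OF G] partial_endoD[OF H]
  show "G O H \<subseteq> carrier R \<times> carrier R" using D(1,7) by auto
  obtain x y z where "(x, y) \<in> G" "(y, z) \<in> H" "z \<noteq> \<zero>" using numerator_meets[OF G H] .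
  then show "\<exists>x y. (x, y) \<in> G O H \<and> y \<noteq> \<zero>" by auto
  show "x = \<zero>" if x: "(x, \<zero>) \<in> G O H" for x
  proof -
    obtain y where "(x, y) \<in> G" "(y, \<zero>) \<in> H" using x by auto
    then show ?thesis using D(5)[of x] D(10)[of y] by simp
  qed
  show "(x \<otimes> r, y \<otimes> r) \<in> G O H" if "(x, y) \<in> G O H" "r \<in> carrier R" for x y r
    using that D(4,9) by blast
  show "(x \<oplus> x', y \<oplus> y') \<in> G O H" if "(x, y) \<in> G O H" "(x', y') \<in> G O H" for x y x' y'
    using that D(3,8) by blast
qed

lemma partial_endo_smult:
  assumes G: "partial_endo G"
  shows "partial_endo (graph_smult c G)"
  unfolding partial_endo_def
proof (intro conjI allI impI)
  note D = partial_endoD[OF G]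
  show "graph_smult c G \<subseteq> carrier R \<times> carrier R" using D(1,2) by (auto simp: graph_smult_def)
  obtain x y where "(x, y) \<in> G" "y \<noteq> \<zero>" using partial_endo_nonzero[OF G] .
  then show "\<exists>x y. (x, y) \<in> graph_smult c G \<and> y \<noteq> \<zero>"
    unfolding graph_smult_def by blast
  show "x = \<zero>" if x: "(x, \<zero>) \<in> graph_smult c G" for x
  proof -
    obtain y where "x = c \<odot> y" "(y, \<zero>) \<in> G" using x by (auto simp: graph_smult_def)
    then show ?thesis using D(5)[of y] by simp
  qed
  show "(x \<otimes> r, y \<otimes> r) \<in> graph_smult c G" if *: "(x, y) \<in> graph_smult c G" "r \<in> carrier R" for x y r
  proof -
    obtain a where a: "x = c \<odot> a" "(a, y) \<in> G" using *(1) by (auto simp: graph_smult_def)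
    have "x \<otimes> r = c \<odot> (a \<otimes> r)" using a D(1)[OF a(2)] *(2) by (simp add: smult_mult)
    then show ?thesis using D(4)[OF a(2) *(2)] by (auto simp: graph_smult_def)
  qed
  show "(x \<oplus> x', y \<oplus> y') \<in> graph_smult c G"
    if *: "(x, y) \<in> graph_smult c G" "(x', y') \<in> graph_smult c G" for x y x' y'
  proof -
    obtain a a' where a: "x = c \<odot> a" "(a, y) \<in> G" "x' = c \<odot> a'" "(a', y') \<in> G"
      using * by (auto simp: graph_smult_def)
    have "x \<oplus> x' = c \<odot> (a \<oplus> a')" using a D(1)[OF a(2)] D(1)[OF a(4)] by (simp add: smult_add_right)
    then show ?thesis using D(3)[OF a(2,4)] by (auto simp: graph_smult_def)
  qed
qed

lemma fraction_graph_of: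
  assumes a: "a \<in> carrier R"
  shows "fraction (graph_of a)"
proof -
  have "partial_endo (graph_of a)"
    unfolding partial_endo_def graph_of_def
    using a one_not_zero by (auto simp: r_distr m_assoc)
  moreover have "saturation (graph_of a) \<subseteq> graph_of a"
  proof
    fix p assume "p \<in> saturation (graph_of a)"
    then obtain x y v where *: "p = (x, y)" "x \<in> carrier R" "y \<in> carrier R" "v \<in> carrier R" "v \<noteq> \<zero>"
      "x \<otimes> v = a \<otimes> (y \<otimes> v)"
      by (auto simp: saturation_def graph_of_def)
    then have "x = a \<otimes> y" using right_cancel[of x "a \<otimes> y" v] a by (simp add: m_assoc)
    then show "p \<in> graph_of a" using * by (auto simp: graph_of_def)
  qed
  ultimately show ?thesis by (simp add: fraction_def)
qed

text \<open>Pairs carry the value first, so that the relational composite \<open>G O H\<close> is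
  the product of \<open>G\<close> and \<open>H\<close> in this order. Sums, composites and scalar
  multiples of maximal graphs need not be maximal, hence the saturations.\<close>

definition fraction_ring :: "('k, ('a \<times> 'a) set) module" where
  "fraction_ring = \<lparr>carrier = Collect fraction,
     monoid.mult = (\<lambda>G H. saturation (G O H)), one = graph_of \<one>, ring.zero = graph_of \<zero>,
     add = (\<lambda>G H. saturation (graph_sum G H)), module.smult = (\<lambda>c G. saturation (graph_smult c G))\<rparr>"

lemma fraction_partial_endo: "fraction G \<Longrightarrow> partial_endo G"
  by (simp add: fraction_def)

lemma fraction_ring_simps [simp]:
  "G \<in> carrier fraction_ring \<longleftrightarrow> fraction G"
  "\<one>\<^bsub>fraction_ring\<^esub> = graph_of \<one>" "\<zero>\<^bsub>fraction_ring\<^esub> = graph_of \<zero>"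
  by (simp_all add: fraction_ring_def)

lemma fraction_ops [simp]:
  assumes "fraction G" "fraction H"
  shows "fraction (G \<oplus>\<^bsub>fraction_ring\<^esub> H)" "fraction (G \<otimes>\<^bsub>fraction_ring\<^esub> H)"
  using assms by (simp_all add: fraction_ring_def fraction_saturation fraction_partial_endo
      partial_endo_sum partial_endo_comp)

lemma fraction_smult [simp]: "fraction G \<Longrightarrow> fraction (c \<odot>\<^bsub>fraction_ring\<^esub> G)"
  by (simp add: fraction_ring_def fraction_saturation fraction_partial_endo partial_endo_smult)

lemma in_fraction_add:
  assumes "fraction G" "fraction H" "(x, y) \<in> G" "(x', y) \<in> H"
  shows "(x \<oplus> x', y) \<in> G \<oplus>\<^bsub>fraction_ring\<^esub> H"
  using assms saturation_superset[OF partial_endo_sum[of G H]]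
  by (auto simp: fraction_ring_def fraction_partial_endo graph_sum_def)

lemma in_fraction_mult:
  assumes "fraction G" "fraction H" "(x, y) \<in> G" "(y, z) \<in> H"
  shows "(x, z) \<in> G \<otimes>\<^bsub>fraction_ring\<^esub> H"
  using assms saturation_superset[OF partial_endo_comp[of G H]]
  by (auto simp: fraction_ring_def fraction_partial_endo)

lemma in_fraction_smult:
  assumes "fraction G" "(x, y) \<in> G"
  shows "(c \<odot> x, y) \<in> c \<odot>\<^bsub>fraction_ring\<^esub> G"
  using assms saturation_superset[OF partial_endo_smult[of G c]]
  by (auto simp: fraction_ring_def fraction_partial_endo graph_smult_def)

lemma in_graph_of: "y \<in> carrier R \<Longrightarrow> a \<otimes> y = x \<Longrightarrow> (x, y) \<in> graph_of a"
  by (auto simp: graph_of_def)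

lemmas fraction_carrier = partial_endoD(1,2)[OF fraction_partial_endo]

lemma fraction_meet2:
  assumes "fraction G" "fraction H"
  obtains x x' y where "(x, y) \<in> G" "(x', y) \<in> H" "y \<noteq> \<zero>"
  using denominator_meets[OF fraction_partial_endo[OF assms(1)] fraction_partial_endo[OF assms(2)]] .

lemma fraction_meet3:
  assumes "fraction G" "fraction H" "fraction K"
  obtains x x' x'' y where "(x, y) \<in> G" "(x', y) \<in> H" "(x'', y) \<in> K" "y \<noteq> \<zero>"
proof -
  have GH: "partial_endo (graph_sum G H)" using assms by (simp add: partial_endo_sum fraction_partial_endo)
  obtain w x'' y where *: "(w, y) \<in> graph_sum G H" "(x'', y) \<in> K" "y \<noteq> \<zero>"
    using denominator_meets[OF GH fraction_partial_endo[OF assms(3)]] .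
  from *(1) obtain x x' where "(x, y) \<in> G" "(x', y) \<in> H" by (auto simp: graph_sum_def)
  with *(2,3) show ?thesis using that by simp
qed

lemma abelian_group_fraction_ring: "abelian_group fraction_ring"
proof (rule abelian_groupI)
  fix G H assume "G \<in> carrier fraction_ring" "H \<in> carrier fraction_ring"
  then have f: "fraction G" "fraction H" by auto
  then show "G \<oplus>\<^bsub>fraction_ring\<^esub> H \<in> carrier fraction_ring" by simp
  obtain x x' y where *: "(x, y) \<in> G" "(x', y) \<in> H" "y \<noteq> \<zero>" using fraction_meet2[OF f] .
  show "G \<oplus>\<^bsub>fraction_ring\<^esub> H = H \<oplus>\<^bsub>fraction_ring\<^esub> G"
    using in_fraction_add[OF f *(1,2)] in_fraction_add[OF f(2,1) *(2,1)] f *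
      fraction_carrier[OF f(1) *(1)] fraction_carrier[OF f(2) *(2)] fraction_eqI a_comm by (metis fraction_ops(1))
next
  show "\<zero>\<^bsub>fraction_ring\<^esub> \<in> carrier fraction_ring" by (simp add: fraction_graph_of)
next
  fix G H K assume "G \<in> carrier fraction_ring" "H \<in> carrier fraction_ring" "K \<in> carrier fraction_ring"
  then have f: "fraction G" "fraction H" "fraction K" by auto
  obtain x x' x'' y where *: "(x, y) \<in> G" "(x', y) \<in> H" "(x'', y) \<in> K" "y \<noteq> \<zero>" using fraction_meet3[OF f] .
  have "((x \<oplus> x') \<oplus> x'', y) \<in> G \<oplus>\<^bsub>fraction_ring\<^esub> H \<oplus>\<^bsub>fraction_ring\<^esub> K"
    using f * by (intro in_fraction_add fraction_ops fraction_smult) 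
  moreover have "(x \<oplus> (x' \<oplus> x''), y) \<in> G \<oplus>\<^bsub>fraction_ring\<^esub> (H \<oplus>\<^bsub>fraction_ring\<^esub> K)"
    using f * by (intro in_fraction_add fraction_ops fraction_smult)
  ultimately show "G \<oplus>\<^bsub>fraction_ring\<^esub> H \<oplus>\<^bsub>fraction_ring\<^esub> K = G \<oplus>\<^bsub>fraction_ring\<^esub> (H \<oplus>\<^bsub>fraction_ring\<^esub> K)"
    using f * fraction_carrier by (intro fraction_eqI[where x = "(x \<oplus> x') \<oplus> x''" and y = y]) (auto simp: a_assoc)
next
  fix G assume "G \<in> carrier fraction_ring"
  then have f: "fraction G" by simp
  obtain x y where *: "(x, y) \<in> G" "y \<noteq> \<zero>" using partial_endo_nonzero[OF fraction_partial_endo[OF f]] .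
  note c = fraction_carrier[OF f *(1)]
  show "\<zero>\<^bsub>fraction_ring\<^esub> \<oplus>\<^bsub>fraction_ring\<^esub> G = G"
    using in_fraction_add[OF fraction_graph_of[of \<zero>] f _ *(1), of \<zero>] in_graph_of[of y \<zero> \<zero>] c f *
    by (intro fraction_eqI[where x = x and y = y]) (auto simp: fraction_graph_of)
  let ?H = "(-1) \<odot>\<^bsub>fraction_ring\<^esub> G"
  have "(-1) \<odot> x \<oplus> x = \<zero>"
    using smult_add_left[of x "-1" 1] c by simp
  then have "(\<zero>, y) \<in> ?H \<oplus>\<^bsub>fraction_ring\<^esub> G"
    using in_fraction_add[OF fraction_smult[OF f] f in_fraction_smult[OF f *(1)] *(1), of "-1"] by simp
  then have "?H \<oplus>\<^bsub>fraction_ring\<^esub> G = \<zero>\<^bsub>fraction_ring\<^esub>"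
    using in_graph_of[of y \<zero> \<zero>] c f * by (intro fraction_eqI[where x = \<zero> and y = y]) (auto simp: fraction_graph_of)
  then show "\<exists>H\<in>carrier fraction_ring. H \<oplus>\<^bsub>fraction_ring\<^esub> G = \<zero>\<^bsub>fraction_ring\<^esub>"
    using f by (intro bexI[of _ ?H]) auto
qed

lemma monoid_fraction_ring: "monoid fraction_ring"
proof (rule monoidI)
  fix G assume "G \<in> carrier fraction_ring"
  then have f: "fraction G" by simp
  obtain x y where *: "(x, y) \<in> G" "y \<noteq> \<zero>" using partial_endo_nonzero[OF fraction_partial_endo[OF f]] .
  note c = fraction_carrier[OF f *(1)]
  show "\<one>\<^bsub>fraction_ring\<^esub> \<otimes>\<^bsub>fraction_ring\<^esub> G = G"
    using in_fraction_mult[OF fraction_graph_of[of \<one>] f _ *(1), of x] in_graph_of[of x \<one> x] c f *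
    by (intro fraction_eqI[where x = x and y = y]) (auto simp: fraction_graph_of)
  show "G \<otimes>\<^bsub>fraction_ring\<^esub> \<one>\<^bsub>fraction_ring\<^esub> = G"
    using in_fraction_mult[OF f fraction_graph_of[of \<one>] *(1), of y] in_graph_of[of y \<one> y] c f *
    by (intro fraction_eqI[where x = x and y = y]) (auto simp: fraction_graph_of)
next
  fix G H K assume "G \<in> carrier fraction_ring" "H \<in> carrier fraction_ring" "K \<in> carrier fraction_ring"
  then have f: "fraction G" "fraction H" "fraction K" by auto
  obtain w y z where *: "(w, y) \<in> G O H" "(y, z) \<in> K" "z \<noteq> \<zero>"
    using numerator_meets[OF partial_endo_comp[OF fraction_partial_endo[OF f(1)] fraction_partial_endo[OF f(2)]]
        fraction_partial_endo[OF f(3)]] .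
  then obtain x where **: "(w, x) \<in> G" "(x, y) \<in> H" by auto
  show "G \<otimes>\<^bsub>fraction_ring\<^esub> H \<otimes>\<^bsub>fraction_ring\<^esub> K = G \<otimes>\<^bsub>fraction_ring\<^esub> (H \<otimes>\<^bsub>fraction_ring\<^esub> K)"
    by (rule fraction_eqI[where x = w and y = z]) (use f * ** in \<open>auto intro: in_fraction_mult\<close>)
qed (auto simp: fraction_graph_of)

lemma ring_fraction_ring: "ring fraction_ring"
proof (rule ringI[OF abelian_group_fraction_ring monoid_fraction_ring])
  fix G H K assume "G \<in> carrier fraction_ring" "H \<in> carrier fraction_ring" "K \<in> carrier fraction_ring"
  then have f: "fraction G" "fraction H" "fraction K" by auto
  note p = fraction_partial_endo[OF f(1)] fraction_partial_endo[OF f(2)] fraction_partial_endo[OF f(3)]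
  show "(G \<oplus>\<^bsub>fraction_ring\<^esub> H) \<otimes>\<^bsub>fraction_ring\<^esub> K = G \<otimes>\<^bsub>fraction_ring\<^esub> K \<oplus>\<^bsub>fraction_ring\<^esub> H \<otimes>\<^bsub>fraction_ring\<^esub> K"
  proof -
    obtain w y z where "(w, y) \<in> graph_sum G H" and yz: "(y, z) \<in> K" "z \<noteq> \<zero>"
      using numerator_meets[OF partial_endo_sum[OF p(1,2)] p(3)] .
    then obtain a b where ab: "w = a \<oplus> b" "(a, y) \<in> G" "(b, y) \<in> H" unfolding graph_sum_def by blast
    show ?thesis
      by (rule fraction_eqI[where x = w and y = z])
        (use f yz ab in \<open>auto intro: in_fraction_mult in_fraction_add\<close>)
  qed
  show "K \<otimes>\<^bsub>fraction_ring\<^esub> (G \<oplus>\<^bsub>fraction_ring\<^esub> H) = K \<otimes>\<^bsub>fraction_ring\<^esub> G \<oplus>\<^bsub>fraction_ring\<^esub> K \<otimes>\<^bsub>fraction_ring\<^esub> H"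
  proof -
    obtain c d z where "(c, z) \<in> K O G" "(d, z) \<in> K O H" and z: "z \<noteq> \<zero>"
      using denominator_meets[OF partial_endo_comp[OF p(3,1)] partial_endo_comp[OF p(3,2)]] .
    then obtain a b where ab: "(c, a) \<in> K" "(a, z) \<in> G" "(d, b) \<in> K" "(b, z) \<in> H" by auto
    show ?thesis
    proof (rule fraction_eqI[where x = "c \<oplus> d" and y = z])
      show "(c \<oplus> d, z) \<in> K \<otimes>\<^bsub>fraction_ring\<^esub> (G \<oplus>\<^bsub>fraction_ring\<^esub> H)"
        using f ab partial_endoD(3)[OF p(3) ab(1,3)] by (auto intro: in_fraction_mult in_fraction_add)
    qed (use f z ab in \<open>auto intro: in_fraction_mult in_fraction_add\<close>)
  qed
qed

lemma k_algebra_fraction_ring: "k_algebra fraction_ring"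
proof (rule k_algebraI[OF ring_fraction_ring])
  fix c d G assume "G \<in> carrier fraction_ring"
  then have f: "fraction G" by simp
  obtain x y where *: "(x, y) \<in> G" "y \<noteq> \<zero>" using partial_endo_nonzero[OF fraction_partial_endo[OF f]] .
  note cr = fraction_carrier[OF f *(1)]
  show "c \<odot>\<^bsub>fraction_ring\<^esub> G \<in> carrier fraction_ring" using f by auto
  show "(c + d) \<odot>\<^bsub>fraction_ring\<^esub> G = c \<odot>\<^bsub>fraction_ring\<^esub> G \<oplus>\<^bsub>fraction_ring\<^esub> d \<odot>\<^bsub>fraction_ring\<^esub> G"
    using in_fraction_smult[OF f *(1), of "c + d"] f * cr
    by (intro fraction_eqI[where x = "(c + d) \<odot> x" and y = y])
      (auto simp: smult_add_left intro!: in_fraction_add in_fraction_smult)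
  show "(c * d) \<odot>\<^bsub>fraction_ring\<^esub> G = c \<odot>\<^bsub>fraction_ring\<^esub> (d \<odot>\<^bsub>fraction_ring\<^esub> G)"
    using in_fraction_smult[OF f *(1), of "c * d"] f * cr
    by (intro fraction_eqI[where x = "(c * d) \<odot> x" and y = y])
      (auto simp: smult_smult[symmetric] intro!: in_fraction_smult)
  show "1 \<odot>\<^bsub>fraction_ring\<^esub> G = G"
    using in_fraction_smult[OF f *(1), of 1] f * cr
    by (intro fraction_eqI[where x = "x" and y = y]) auto
next
  fix c G H assume "G \<in> carrier fraction_ring" "H \<in> carrier fraction_ring"
  then have f: "fraction G" "fraction H" by auto
  note p = fraction_partial_endo[OF f(1)] fraction_partial_endo[OF f(2)]
  obtain x x' y where *: "(x, y) \<in> G" "(x', y) \<in> H" "y \<noteq> \<zero>" using fraction_meet2[OF f] .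
  have "(c \<odot> (x \<oplus> x'), y) \<in> c \<odot>\<^bsub>fraction_ring\<^esub> (G \<oplus>\<^bsub>fraction_ring\<^esub> H)"
    using f * by (intro in_fraction_smult in_fraction_add fraction_ops fraction_smult)
  moreover have "(c \<odot> x \<oplus> c \<odot> x', y) \<in> c \<odot>\<^bsub>fraction_ring\<^esub> G \<oplus>\<^bsub>fraction_ring\<^esub> c \<odot>\<^bsub>fraction_ring\<^esub> H"
    using f * by (intro in_fraction_smult in_fraction_add fraction_ops fraction_smult)
  ultimately show "c \<odot>\<^bsub>fraction_ring\<^esub> (G \<oplus>\<^bsub>fraction_ring\<^esub> H) = c \<odot>\<^bsub>fraction_ring\<^esub> G \<oplus>\<^bsub>fraction_ring\<^esub> c \<odot>\<^bsub>fraction_ring\<^esub> H"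
    using smult_add_right[of x x' c] fraction_carrier(1)[OF f(1) *(1)] fraction_carrier(1)[OF f(2) *(2)] f *(3)
    by (intro fraction_eqI[where x = "c \<odot> (x \<oplus> x')" and y = y]) auto
  obtain x y z where **: "(x, y) \<in> G" "(y, z) \<in> H" "z \<noteq> \<zero>" using numerator_meets[OF p] .
  have xz: "(c \<odot> x, z) \<in> c \<odot>\<^bsub>fraction_ring\<^esub> (G \<otimes>\<^bsub>fraction_ring\<^esub> H)"
    using f ** by (intro in_fraction_smult in_fraction_mult fraction_ops fraction_smult)
  then show "(c \<odot>\<^bsub>fraction_ring\<^esub> G) \<otimes>\<^bsub>fraction_ring\<^esub> H = c \<odot>\<^bsub>fraction_ring\<^esub> (G \<otimes>\<^bsub>fraction_ring\<^esub> H)"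
    by (intro fraction_eqI[where x = "c \<odot> x" and y = z])
      (use f ** in \<open>auto intro!: in_fraction_smult intro: in_fraction_mult\<close>)
  \<comment> \<open>Scaling is right multiplication by \<open>c \<odot> \<one>\<close>, under which
    graphs are closed; this is what makes scalars central.\<close>
  have "(c \<odot> x, c \<odot> y) \<in> G"
    using partial_endoD(4)[OF p(1) **(1), of "c \<odot> \<one>"] fraction_carrier[OF f(1) **(1)]
    by (simp add: smult_mult)
  then show "G \<otimes>\<^bsub>fraction_ring\<^esub> (c \<odot>\<^bsub>fraction_ring\<^esub> H) = c \<odot>\<^bsub>fraction_ring\<^esub> (G \<otimes>\<^bsub>fraction_ring\<^esub> H)"
    by (intro fraction_eqI[where x = "c \<odot> x" and y = z])
      (use f ** xz in \<open>auto intro: in_fraction_smult in_fraction_mult\<close>)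
qed

lemma graph_of_hom: "graph_of \<in> alg_hom R fraction_ring"
  unfolding alg_hom_def
proof (intro CollectI conjI ring_hom_memI allI ballI)
  fix a assume a: "a \<in> carrier R"
  show "graph_of a \<in> carrier fraction_ring" using a by (simp add: fraction_graph_of)
  show "graph_of (c \<odot> a) = c \<odot>\<^bsub>fraction_ring\<^esub> graph_of a" for c
    by (rule fraction_eqI[where x = "c \<odot> a" and y = \<one>])
      (use a one_not_zero in \<open>auto simp: fraction_graph_of intro!: in_fraction_smult in_graph_of\<close>)
next
  fix a b assume a: "a \<in> carrier R" and b: "b \<in> carrier R"
  show "graph_of (a \<otimes> b) = graph_of a \<otimes>\<^bsub>fraction_ring\<^esub> graph_of b"
    by (rule fraction_eqI[where x = "a \<otimes> b" and y = \<one>])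
      (use a b one_not_zero in \<open>auto simp: fraction_graph_of intro!: in_fraction_mult[of _ _ _ b] in_graph_of\<close>)
  show "graph_of (a \<oplus> b) = graph_of a \<oplus>\<^bsub>fraction_ring\<^esub> graph_of b"
    by (rule fraction_eqI[where x = "a \<oplus> b" and y = \<one>])
      (use a b one_not_zero in \<open>auto simp: fraction_graph_of intro!: in_fraction_add in_graph_of\<close>)
qed simp

lemma regular_elements_eq: "regular_elements R = carrier R - {\<zero>}"
proof
  show "regular_elements R \<subseteq> carrier R - {\<zero>}"
  proof
    fix s assume "s \<in> regular_elements R"
    note s = CollectD[OF this[unfolded regular_elements_def]]
    from conjunct1[OF bspec[OF conjunct2[OF s] one_closed]] conjunct1[OF s]
    show "s \<in> carrier R - {\<zero>}" using one_not_zero by auto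
  qed
  show "carrier R - {\<zero>} \<subseteq> regular_elements R"
  proof
    fix s assume s: "s \<in> carrier R - {\<zero>}"
    have *: "(s \<otimes> x = \<zero> \<longrightarrow> x = \<zero>) \<and> (x \<otimes> s = \<zero> \<longrightarrow> x = \<zero>)" if "x \<in> carrier R" for x
      using domain[OF _ that, of s] domain[OF that, of s] s by auto
    have "s \<in> carrier R" using s by simp
    then show "s \<in> regular_elements R"
      unfolding regular_elements_def by (intro CollectI conjI[OF _ ballI]) (assumption | rule *)+
  qed
qed

lemma Units_graph_of:
  assumes s: "s \<in> carrier R" "s \<noteq> \<zero>"
  shows "graph_of s \<in> Units fraction_ring"
proof -
  \<comment> \<open>The converse relation of \<open>graph_of s\<close>. Its denominators form only
    the right ideal generated by \<open>s\<close>, so it has to be saturated.\<close>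
  let ?G = "{(y, s \<otimes> y) | y. y \<in> carrier R}"
  have G: "partial_endo ?G"
    unfolding partial_endo_def
  proof (intro conjI allI impI)
    show "x = \<zero>" if x: "(x, \<zero>) \<in> ?G" for x
    proof -
      from x have "x \<in> carrier R" "s \<otimes> x = \<zero>" by auto
      from domain[OF s(1) this] s(2) show ?thesis by simp
    qed
    show "\<exists>x y. (x, y) \<in> ?G \<and> y \<noteq> \<zero>" using s by (intro exI[of _ \<one>] exI[of _ s]) auto
    show "(x \<oplus> x', y \<oplus> y') \<in> ?G" if "(x, y) \<in> ?G" "(x', y') \<in> ?G" for x y x' y'
      using that s by (auto simp: r_distr)
    show "(x \<otimes> r, y \<otimes> r) \<in> ?G" if "(x, y) \<in> ?G" "r \<in> carrier R" for x y r
      using that s by (auto simp: m_assoc)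
  qed (use s in auto)
  define H where "H = saturation ?G"
  have H: "fraction H" unfolding H_def using fraction_saturation[OF G] .
  have 1: "(\<one>, s) \<in> H" unfolding H_def using saturation_superset[OF G] s by auto
  have 2: "(s, \<one>) \<in> graph_of s" using s by (auto intro!: in_graph_of)
  have "H \<otimes>\<^bsub>fraction_ring\<^esub> graph_of s = graph_of \<one>"
    by (rule fraction_eqI[where x = \<one> and y = \<one>])
      (use H s one_not_zero in_fraction_mult[OF H fraction_graph_of 1 2] in \<open>auto simp: fraction_graph_of intro!: in_graph_of\<close>)
  moreover have "graph_of s \<otimes>\<^bsub>fraction_ring\<^esub> H = graph_of \<one>"
    by (rule fraction_eqI[where x = s and y = s])
      (use H s in_fraction_mult[OF fraction_graph_of H 2 1] in \<open>auto simp: fraction_graph_of intro!: in_graph_of\<close>)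
  ultimately show ?thesis
    unfolding Units_def using H fraction_graph_of[OF s(1)] by (intro CollectI conjI bexI[of _ H]) simp_all
qed

text \<open>The choice in \<open>Fract\<close> ranges over localizations on the type of sets of
  pairs, so a witness on exactly this type is required. The graphs are that witness.\<close>

theorem is_right_localization_fraction_ring:
  "is_right_localization R (regular_elements R) fraction_ring graph_of"
  unfolding is_right_localization_def
proof (intro conjI ballI)
  interpret Q: ring fraction_ring by (rule ring_fraction_ring)
  show "k_algebra fraction_ring" by (rule k_algebra_fraction_ring)
  show "graph_of \<in> alg_hom R fraction_ring" by (rule graph_of_hom)
  show "graph_of s \<in> Units fraction_ring" if "s \<in> regular_elements R" for s
    using that Units_graph_of by (auto simp: regular_elements_eq)
  show "\<exists>a\<in>carrier R. \<exists>s\<in>regular_elements R. G = graph_of a \<otimes>\<^bsub>fraction_ring\<^esub> inv\<^bsub>fraction_ring\<^esub> graph_of s"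
    if "G \<in> carrier fraction_ring" for G
  proof -
    have f: "fraction G" using that by simp
    obtain a s where as: "(a, s) \<in> G" "s \<noteq> \<zero>" using partial_endo_nonzero[OF fraction_partial_endo[OF f]] .
    note c = fraction_carrier[OF f as(1)]
    \<comment> \<open>The pair (a, s) of \<open>G\<close> composes with the pair (s, 1) of
      \<open>graph_of s\<close>, so both sides contain (a, 1).\<close>
    have "G \<otimes>\<^bsub>fraction_ring\<^esub> graph_of s = graph_of a"
      by (rule fraction_eqI[where x = a and y = \<one>])
        (use f c as one_not_zero in \<open>auto simp: fraction_graph_of intro!: in_graph_of intro: in_fraction_mult[of _ _ a s]\<close>)
    then have "G = graph_of a \<otimes>\<^bsub>fraction_ring\<^esub> inv\<^bsub>fraction_ring\<^esub> graph_of s"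
      using Units_graph_of[OF c(2) as(2)] f by (metis Q.Units_closed Q.Units_inv_closed Q.Units_r_inv Q.m_assoc Q.r_one that)
    then show ?thesis using c as by (auto simp: regular_elements_eq)
  qed
  show "(graph_of a = \<zero>\<^bsub>fraction_ring\<^esub>) = (\<exists>s\<in>regular_elements R. a \<otimes> s = \<zero>)" if "a \<in> carrier R" for a
  proof -
    have "graph_of a = graph_of \<zero> \<longleftrightarrow> a = \<zero>"
      using in_graph_of[of \<one> a a] that by (auto simp: graph_of_def[of \<zero>])
    moreover have "(\<exists>s\<in>regular_elements R. a \<otimes> s = \<zero>) \<longleftrightarrow> a = \<zero>"
      using that domain[of a] one_not_zero by (auto simp: regular_elements_eq intro!: bexI[of _ \<one>])
    ultimately show ?thesis by simp
  qed
qed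

lemma is_right_localization_Fract:
  "\<exists>\<iota>. is_right_localization R (regular_elements R) (Fract R) \<iota>"
  unfolding Fract_def by (rule someI_ex) (use is_right_localization_fraction_ring in blast)

end

section \<open>Subalgebras of twisted group algebras are Ore domains\<close>

lemma underdetermined_system:
  fixes M :: "'j \<Rightarrow> 'i \<Rightarrow> 'k::field"
  assumes "finite J" "finite I" "card J < card I"
  shows "\<exists>\<alpha>. (\<exists>i\<in>I. \<alpha> i \<noteq> 0) \<and> (\<forall>j\<in>J. (\<Sum>i\<in>I. M j i * \<alpha> i) = 0)"
  using assms
proof (induction J arbitrary: I M rule: finite_induct)
  case empty
  then show ?case by (intro exI[of _ "\<lambda>_. 1"]) (auto simp: card_gt_0_iff)
next
  case (insert j J)
  show ?case
  proof (cases "\<forall>i\<in>I. M j i = 0")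
    case True
    have "card J < card I" using insert by simp
    then obtain \<alpha> where "\<exists>i\<in>I. \<alpha> i \<noteq> 0" "\<forall>j\<in>J. (\<Sum>i\<in>I. M j i * \<alpha> i) = 0"
      using insert.IH[OF insert.prems(1)] by blast
    with True show ?thesis by auto
  next
    case False
    then obtain i0 where i0: "i0 \<in> I" "M j i0 \<noteq> 0" by auto
    define I' where "I' = I - {i0}"
    have I': "finite I'" "card J < card I'" "i0 \<notin> I'" "I = insert i0 I'"
      using insert i0 by (auto simp: I'_def)
    obtain \<alpha> where \<alpha>: "\<exists>i\<in>I'. \<alpha> i \<noteq> 0"
      "\<forall>j'\<in>J. (\<Sum>i\<in>I'. (M j' i - M j' i0 * M j i / M j i0) * \<alpha> i) = 0"
      using insert.IH[OF I'(1,2), of "\<lambda>j' i. M j' i - M j' i0 * M j i / M j i0"] by blast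
    \<comment> \<open>Back substitution: the value at the eliminated unknown \<open>i0\<close> that
      equation \<open>j\<close> forces.\<close>
    define c where "c = - (\<Sum>i\<in>I'. M j i * \<alpha> i) / M j i0"
    have sum: "(\<Sum>i\<in>I. M j' i * (\<alpha>(i0 := c)) i) = M j' i0 * c + (\<Sum>i\<in>I'. M j' i * \<alpha> i)" for j'
      unfolding I'(4) using I'(1,3) by (auto intro!: sum.cong)
    have "M j i0 * c + (\<Sum>i\<in>I'. M j i * \<alpha> i) = 0"
      using i0(2) by (simp add: c_def)
    moreover have "M j' i0 * c + (\<Sum>i\<in>I'. M j' i * \<alpha> i) = 0" if "j' \<in> J" for j'
    proof -
      have "0 = (\<Sum>i\<in>I'. M j' i * \<alpha> i - M j' i0 / M j i0 * (M j i * \<alpha> i))"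
        using \<alpha>(2) that by (simp add: algebra_simps)
      also have "\<dots> = (\<Sum>i\<in>I'. M j' i * \<alpha> i) - M j' i0 / M j i0 * (\<Sum>i\<in>I'. M j i * \<alpha> i)"
        by (simp only: sum_subtractf sum_distrib_left)
      finally show ?thesis by (simp add: c_def)
    qed
    ultimately have "\<forall>j'\<in>insert j J. (\<Sum>i\<in>I. M j' i * (\<alpha>(i0 := c)) i) = 0"
      unfolding sum by blast
    moreover have "\<exists>i\<in>I. (\<alpha>(i0 := c)) i \<noteq> 0"
      using \<alpha>(1) I' by auto
    ultimately show ?thesis by blast
  qed
qed

lemma card_box:
  "finite {s :: int ^ 'n::finite. \<forall>i. s $ i \<in> {a..<b}}"
  "card {s :: int ^ 'n::finite. \<forall>i. s $ i \<in> {a..<b}} = nat (b - a) ^ CARD('n)"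
proof -
  have eq: "{s :: int ^ 'n::finite. \<forall>i. s $ i \<in> {a..<b}} = vec_lambda ` (PiE UNIV (\<lambda>_. {a..<b}))"
  proof safe
    fix s :: "int ^ 'n" assume "\<forall>i. s $ i \<in> {a..<b}"
    then show "s \<in> vec_lambda ` (PiE UNIV (\<lambda>_. {a..<b}))"
      by (intro image_eqI[of _ _ "vec_nth s"]) auto
  qed (auto simp: PiE_def)
  have inj: "inj_on vec_lambda (PiE UNIV (\<lambda>_ :: 'n. {a..<b}))"
    by (rule inj_onI) (simp add: vec_lambda_inject)
  show "finite {s :: int ^ 'n::finite. \<forall>i. s $ i \<in> {a..<b}}"
    unfolding eq by (intro finite_imageI finite_PiE) auto
  show "card {s :: int ^ 'n::finite. \<forall>i. s $ i \<in> {a..<b}} = nat (b - a) ^ CARD('n)"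
    unfolding eq card_image[OF inj] by (simp add: card_PiE)
qed

text \<open>The quotient of the two powers is (1 + 2d/N)^n, which tends to 1. Hence for large N a
  box of side N has less than doubled in size after an enlargement by d on either side.\<close>

lemma exists_growth: "\<exists>N>0. (N + 2 * d) ^ n < 2 * N ^ n" for d n :: nat
proof -
  have "(\<lambda>N. (1 + real (2 * d) / real N) ^ n) \<longlonglongrightarrow> (1 + 0) ^ n"
    by (intro tendsto_power tendsto_add tendsto_const lim_const_over_n)
  then have "\<forall>\<^sub>F N in sequentially. (1 + real (2 * d) / real N) ^ n < 2"
    by (rule order_tendstoD(2)) simp
  then have "\<forall>\<^sub>F N in sequentially. (1 + real (2 * d) / real N) ^ n < 2 \<and> N > 0"
    using eventually_gt_at_top[of 0] by eventually_elim simp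
  then obtain N where N: "(1 + real (2 * d) / real N) ^ n < 2" "N > 0"
    using eventually_sequentially by auto
  have "real ((N + 2 * d) ^ n) = (1 + real (2 * d) / real N) ^ n * real N ^ n"
    using N(2) by (simp add: field_simps flip: power_mult_distrib)
  also have "\<dots> < 2 * real N ^ n"
    using N by (intro mult_strict_right_mono) auto
  finally have "real ((N + 2 * d) ^ n) < real (2 * N ^ n)" by simp
  then show ?thesis using N(2) by (auto simp only: of_nat_less_iff)
qed

text \<open>An embedding \<open>h\<close> instead of a literal subset lets a twist, whose carrier
  consists of torus elements, be treated through its coordinates. Of the inclusion of the quantum
  affine space only \<open>h_affine\<close> remains.\<close>

locale twisted_subalgebra = assoc_algebra R for R :: "('k::field, 'a) module" (structure) +
  fixes \<kappa> :: "int ^ 'n::finite \<Rightarrow> int ^ 'n \<Rightarrow> 'k" and h :: "'a \<Rightarrow> (int ^ 'n \<Rightarrow>\<^sub>0 'k)"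
  assumes cocycle: "\<kappa> \<in> cocycles2" and cocycle_one: "\<kappa> 0 0 = 1"
    and h_inj: "inj_on h (carrier R)"
    and h_add: "x \<in> carrier R \<Longrightarrow> y \<in> carrier R \<Longrightarrow> h (x \<oplus> y) = h x + h y"
    and h_smult: "x \<in> carrier R \<Longrightarrow> h (c \<odot> x) = pscale c (h x)"
    and h_mult: "x \<in> carrier R \<Longrightarrow> y \<in> carrier R \<Longrightarrow> h (x \<otimes> y) = tmul \<kappa> (h x) (h y)"
    and h_one: "h \<one> = Poly_Mapping.single 0 1"
    and h_affine: "(\<And>i. 0 \<le> s $ i) \<Longrightarrow> \<exists>x\<in>carrier R. h x = Poly_Mapping.single s 1"
begin

lemma h_zero [simp]: "h \<zero> = 0"
  using h_add[of \<zero> \<zero>] by simp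

lemma h_eq_0_iff: "x \<in> carrier R \<Longrightarrow> h x = 0 \<longleftrightarrow> x = \<zero>"
  using h_inj by (metis h_zero inj_on_eq_iff zero_closed)

lemma exists_index_list: "\<exists>is :: 'n list. set is = UNIV"
  by (rule finite_list) simp

definition positive :: "int ^ 'n \<Rightarrow> bool" where
  "positive = lex_pos (SOME is. set is = UNIV)"

sublocale lex: positive_cone positive
  unfolding positive_def by (rule positive_cone_lex) (rule someI_ex[OF exists_index_list])

lemma cocycle_nonzero: "\<kappa> s t \<noteq> 0"
  using cocycle by (simp add: cocycles2D)

lemma tmul_nonzero: "p \<noteq> 0 \<Longrightarrow> q \<noteq> 0 \<Longrightarrow> tmul \<kappa> p q \<noteq> 0"
  using lex.lead_tmul(1) cocycle_nonzero by blast

lemma h_range_affine: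
  assumes "finite S" "\<And>s i. s \<in> S \<Longrightarrow> 0 \<le> s $ i"
  shows "\<exists>x\<in>carrier R. h x = (\<Sum>s\<in>S. Poly_Mapping.single s (c s))"
  using assms
proof (induction S rule: finite_induct)
  case empty
  then show ?case by (intro bexI[of _ \<zero>]) auto
next
  case (insert s S)
  then obtain x where x: "x \<in> carrier R" "h x = (\<Sum>s\<in>S. Poly_Mapping.single s (c s))" by auto
  obtain y where y: "y \<in> carrier R" "h y = Poly_Mapping.single s 1"
    using h_affine[of s] insert.prems by blast
  show ?case
    by (rule bexI[of _ "c s \<odot> y \<oplus> x"]) (use insert.hyps x y in \<open>simp_all add: h_add h_smult\<close>)
qed

text \<open>Dimension count: the coefficients of \<open>u\<close> and \<open>v\<close> on a box of
  side N are 2 N^n unknowns, and the equation between the two products involves only the exponents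
  in a box of side N + 2d, which are fewer.\<close>

lemma right_ore:
  assumes xy: "x \<in> carrier R" "y \<in> carrier R" "x \<noteq> \<zero>" "y \<noteq> \<zero>"
  shows "\<exists>u\<in>carrier R. \<exists>v\<in>carrier R. x \<otimes> u = y \<otimes> v \<and> x \<otimes> u \<noteq> \<zero>"
proof -
  define p q where "p = h x" and "q = h y"
  have pq: "p \<noteq> 0" "q \<noteq> 0" using xy h_eq_0_iff by (auto simp: p_def q_def)
  \<comment> \<open>A crude bound for the absolute values of all exponent entries in
    \<open>p\<close> and \<open>q\<close>.\<close>
  define d where "d = (\<Sum>s\<in>Poly_Mapping.keys p \<union> Poly_Mapping.keys q. \<Sum>i\<in>UNIV. nat \<bar>s $ i\<bar>)"
  have bound: "\<bar>s $ i\<bar> \<le> int d" if "s \<in> Poly_Mapping.keys p \<union> Poly_Mapping.keys q" for s i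
  proof -
    have "nat \<bar>s $ i\<bar> \<le> (\<Sum>i\<in>UNIV. nat \<bar>s $ i\<bar>)" by (rule member_le_sum) auto
    also have "\<dots> \<le> d" unfolding d_def using that by (intro member_le_sum) auto
    finally show ?thesis by simp
  qed
  obtain N where N: "N > 0" "(N + 2 * d) ^ CARD('n) < 2 * N ^ CARD('n)"
    using exists_growth by blast
  \<comment> \<open>The exponents allowed in \<open>u\<close> and \<open>v\<close>. They are
    nonnegative, so that both are values of \<open>h\<close>.\<close>
  define S where "S = {s :: int ^ 'n. \<forall>i. s $ i \<in> {0..<int N}}"
  define D where "D = {s :: int ^ 'n. \<forall>i. s $ i \<in> {- int d..<int (N + d)}}"
  have fin: "finite S" "finite D" unfolding S_def D_def by (rule card_box)+
  have "nat (int (N + d) - - int d) = N + 2 * d" by simp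
  then have cards: "card S = N ^ CARD('n)" "card D = (N + 2 * d) ^ CARD('n)"
    unfolding S_def D_def card_box(2) by (simp_all only:) simp
  define M where "M j i = (case i of Inl s \<Rightarrow> Poly_Mapping.lookup (tmul \<kappa> p (Poly_Mapping.single s 1)) j
     | Inr s \<Rightarrow> Poly_Mapping.lookup (tmul \<kappa> q (Poly_Mapping.single s 1)) j)" for j i
  have "card D < card (S <+> S)" using cards N fin by (simp add: card_Plus)
  then obtain \<alpha> where \<alpha>: "\<exists>i\<in>S <+> S. \<alpha> i \<noteq> 0" "\<forall>j\<in>D. (\<Sum>i\<in>S <+> S. M j i * \<alpha> i) = 0"
    using underdetermined_system[of D "S <+> S" M] fin by auto
  \<comment> \<open>The sign in \<open>v\<close> turns the homogeneous system into an equality of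
    two products.\<close>
  define u v where "u = (\<Sum>s\<in>S. Poly_Mapping.single s (\<alpha> (Inl s)))"
    and "v = (\<Sum>s\<in>S. Poly_Mapping.single s (- \<alpha> (Inr s)))"
  have lookup_uv: "Poly_Mapping.lookup u s = (if s \<in> S then \<alpha> (Inl s) else 0)"
    "Poly_Mapping.lookup v s = (if s \<in> S then - \<alpha> (Inr s) else 0)" for s
  proof -
    have "(\<Sum>s'\<in>S. f s' when s' = s) = (if s \<in> S then f s else 0)" for f :: "int ^ 'n \<Rightarrow> 'k"
      using fin(1) by (simp add: when_def)
    then show "Poly_Mapping.lookup u s = (if s \<in> S then \<alpha> (Inl s) else 0)"
    "Poly_Mapping.lookup v s = (if s \<in> S then - \<alpha> (Inr s) else 0)"
      unfolding u_def v_def lookup_sum lookup_single by auto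
  qed
  have keys_uv: "Poly_Mapping.keys u \<subseteq> S" "Poly_Mapping.keys v \<subseteq> S"
    by (auto simp: in_keys_iff lookup_uv split: if_splits)
  have tmul_expand: "tmul \<kappa> r (\<Sum>s\<in>S. Poly_Mapping.single s (c s))
      = (\<Sum>s\<in>S. pscale (c s) (tmul \<kappa> r (Poly_Mapping.single s 1)))" for r c
    unfolding tmul_sum_right tmul_pscale_right[symmetric] by simp
  have "tmul \<kappa> p u = tmul \<kappa> q v"
  proof (rule poly_mapping_eqI)
    fix j
    show "Poly_Mapping.lookup (tmul \<kappa> p u) j = Poly_Mapping.lookup (tmul \<kappa> q v) j"
    proof (cases "j \<in> D")
      case True
      have "(\<Sum>i\<in>S <+> S. M j i * \<alpha> i) = (\<Sum>s\<in>S. M j (Inl s) * \<alpha> (Inl s)) + (\<Sum>s\<in>S. M j (Inr s) * \<alpha> (Inr s))"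
        using fin(1) by (simp add: sum.Plus)
      with \<alpha>(2) True have "(\<Sum>s\<in>S. M j (Inl s) * \<alpha> (Inl s)) = - (\<Sum>s\<in>S. M j (Inr s) * \<alpha> (Inr s))"
        by (simp add: eq_neg_iff_add_eq_0)
      then show ?thesis
        unfolding u_def v_def tmul_expand by (simp add: lookup_sum M_def sum_negf mult.commute)
    next
      case False
      have notin: "j \<notin> Poly_Mapping.keys (tmul \<kappa> r w)"
        if r: "Poly_Mapping.keys r \<subseteq> Poly_Mapping.keys p \<union> Poly_Mapping.keys q" and w: "Poly_Mapping.keys w \<subseteq> S" for r w
      proof
        assume "j \<in> Poly_Mapping.keys (tmul \<kappa> r w)"
        then obtain s t where st: "j = s + t" "s \<in> Poly_Mapping.keys r" "t \<in> S" using keys_tmul w by blast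
        have "j $ i \<in> {- int d..<int (N + d)}" for i
          using st bound[of s i] r unfolding S_def by (auto simp: abs_le_iff) (smt (verit) subsetD UnE)+
        then show False using False by (simp add: D_def)
      qed
      show ?thesis using notin[OF Un_upper1 keys_uv(1)] notin[OF Un_upper2 keys_uv(2)]
        by (simp add: in_keys_iff)
    qed
  qed
  moreover obtain x' y' where x': "x' \<in> carrier R" "h x' = u" and y': "y' \<in> carrier R" "h y' = v"
    using h_range_affine[OF fin(1), of "\<lambda>s. \<alpha> (Inl s)"] h_range_affine[OF fin(1), of "\<lambda>s. - \<alpha> (Inr s)"]
    by (auto simp: S_def u_def v_def)
  ultimately have "h (x \<otimes> x') = h (y \<otimes> y')" using xy by (simp add: h_mult p_def q_def)
  then have eq: "x \<otimes> x' = y \<otimes> y'" using h_inj xy x' y' by (simp add: inj_on_eq_iff)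
  \<comment> \<open>A vanishing common multiple would force \<open>u\<close> and \<open>v\<close> to
    be zero, as there are no zero divisors, whereas the solution of the system is
    nontrivial.\<close>
  have "x \<otimes> x' \<noteq> \<zero>"
  proof
    assume z: "x \<otimes> x' = \<zero>"
    then have "h (x \<otimes> x') = 0" "h (y \<otimes> y') = 0" using eq by auto
    then have "tmul \<kappa> p u = 0" "tmul \<kappa> q v = 0" using xy x' y' by (simp_all add: h_mult p_def q_def)
    then have "u = 0" "v = 0" using tmul_nonzero pq by blast+
    then have "\<alpha> (Inl s) = 0" "\<alpha> (Inr s) = 0" if "s \<in> S" for s using that lookup_uv[of s] by simp_all
    with \<alpha>(1) show False by auto
  qed
  with eq x' y' show ?thesis by blast
qed

sublocale ore_domain R
proof
  have "Poly_Mapping.single (0 :: int ^ 'n) (1 :: 'k) \<noteq> 0"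
    by (metis lookup_single_eq lookup_zero one_neq_zero)
  then show "\<one> \<noteq> \<zero>" using h_one h_zero by metis
  show "x = \<zero> \<or> y = \<zero>" if "x \<in> carrier R" "y \<in> carrier R" "x \<otimes> y = \<zero>" for x y
    using that(3) tmul_nonzero[of "h x" "h y"] h_mult[OF that(1,2)] h_eq_0_iff[OF that(1)] h_eq_0_iff[OF that(2)]
    by auto
qed (rule right_ore)

end

section \<open>Right Ore domains are semiprime right Goldie\<close>

context ore_domain
begin

lemma semiprime: "semiprime R"
  unfolding semiprime_def
proof (intro allI impI, elim conjE)
  fix I assume I: "ideal I R" and sq: "\<forall>x\<in>I. \<forall>y\<in>I. x \<otimes> y = \<zero>"
  have sub: "I \<subseteq> carrier R" and z: "\<zero> \<in> I"
    using additive_subgroup.a_subset[OF ideal.axioms(1)[OF I]] additive_subgroup.zero_closed[OF ideal.axioms(1)[OF I]] .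
  have "x = \<zero>" if x: "x \<in> I" for x
    using domain[OF subsetD[OF sub x] subsetD[OF sub x] bspec[OF bspec[OF sq x] x]] by simp
  then have "I \<subseteq> {\<zero>}" by blast
  with z show "I = {\<zero>}" by blast
qed

lemma right_annihilator_eq:
  assumes "B \<subseteq> carrier R"
  shows "right_annihilator R B = (if B \<subseteq> {\<zero>} then carrier R else {\<zero>})"
proof (cases "B \<subseteq> {\<zero>}")
  case True
  then show ?thesis by (auto simp: right_annihilator_def)
next
  case False
  then obtain b where b: "b \<in> B" "b \<noteq> \<zero>" by auto
  have "r = \<zero>" if "r \<in> carrier R" "\<forall>x\<in>B. x \<otimes> r = \<zero>" for r
    using domain[OF subsetD[OF assms b(1)] that(1) bspec[OF that(2) b(1)]] b(2) by simp
  then have "right_annihilator R B \<subseteq> {\<zero>}" unfolding right_annihilator_def by blast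
  moreover have "\<zero> \<in> right_annihilator R B"
    unfolding right_annihilator_def using subsetD[OF assms] by simp
  ultimately show ?thesis using False by auto
qed

text \<open>Right annihilators in a domain are zero or everything, so chains of them stabilise. By
  the Ore condition two nonzero right ideals always meet, so already two of them cannot form a
  direct sum.\<close>

lemma right_goldie: "right_goldie R"
  unfolding right_goldie_def
proof (intro conjI allI impI notI)
  fix B :: "nat \<Rightarrow> 'a set"
  assume "\<forall>i. B i \<subseteq> carrier R \<and> right_annihilator R (B i) \<subseteq> right_annihilator R (B (Suc i))"
  then have B: "\<And>i. B i \<subseteq> carrier R" and mono: "right_annihilator R (B i) \<subseteq> right_annihilator R (B (Suc i))" for i
    by auto
  have le: "right_annihilator R (B i) \<subseteq> right_annihilator R (B j)" if "i \<le> j" for i j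
    using lift_Suc_mono_le[of "\<lambda>i. right_annihilator R (B i)", OF mono that] .
  show "\<exists>N. \<forall>i\<ge>N. right_annihilator R (B i) = right_annihilator R (B N)"
  proof (cases "\<exists>N. B N \<subseteq> {\<zero>}")
    case True
    then obtain N where "B N \<subseteq> {\<zero>}" by blast
    then have "right_annihilator R (B N) = carrier R" using right_annihilator_eq[OF B] by simp
    moreover have "right_annihilator R (B i) \<subseteq> carrier R" for i by (auto simp: right_annihilator_def)
    ultimately show ?thesis using le by blast
  next
    case False
    then show ?thesis using right_annihilator_eq[OF B] by auto
  qed
next
  assume "\<exists>J :: nat \<Rightarrow> 'a set. (\<forall>i. right_ideal (J i) R \<and> J i \<noteq> {\<zero>}) \<and>
          (\<forall>m f. (\<forall>i\<le>m. f i \<in> J i) \<and> finsum R f {..m} = \<zero> \<longrightarrow> (\<forall>i\<le>m. f i = \<zero>))"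
  then obtain J :: "nat \<Rightarrow> 'a set" where J: "\<And>i. right_ideal (J i) R" "\<And>i. J i \<noteq> {\<zero>}"
    "\<And>m f. (\<forall>i\<le>m. f i \<in> J i) \<and> finsum R f {..m} = \<zero> \<longrightarrow> (\<forall>i\<le>m. f i = \<zero>)"
    by blast
  have sub: "J i \<subseteq> carrier R" and mult: "\<And>x r. x \<in> J i \<Longrightarrow> r \<in> carrier R \<Longrightarrow> x \<otimes> r \<in> J i"
    and add: "additive_subgroup (J i) R" for i
    using J(1)[of i] additive_subgroup.a_subset[of "J i" R] by (auto simp: right_ideal_def)
  have "\<exists>x\<in>J i. x \<noteq> \<zero>" for i
    using J(2)[of i] additive_subgroup.zero_closed[OF add[of i]] by blast
  then obtain x y where xy: "x \<in> J 0" "x \<noteq> \<zero>" "y \<in> J 1" "y \<noteq> \<zero>" by metis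
  then obtain u v where uv: "u \<in> carrier R" "v \<in> carrier R" "x \<otimes> u = y \<otimes> v" "x \<otimes> u \<noteq> \<zero>"
    using ore[of x y] sub by blast
  \<comment> \<open>A nonzero element of both \<open>J 0\<close> and \<open>J 1\<close>, taken once
    with each sign, violates directness.\<close>
  define f where "f i = (if i = 0 then x \<otimes> u else \<ominus> (y \<otimes> v))" for i :: nat
  have "\<ominus> (y \<otimes> v) \<in> J 1"
    using mult[OF xy(3) uv(2)] additive_subgroup.a_inv_closed[OF add[of 1]] by blast
  then have "\<forall>i\<le>1. f i \<in> J i"
    using mult[OF xy(1) uv(1)] by (auto simp: f_def le_Suc_eq)
  moreover have "finsum R f {..1} = \<zero>"
  proof -
    have "y \<otimes> v \<in> carrier R" using xy(3) sub uv(2) by blast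
    then have "f 0 \<in> carrier R" "f 1 \<in> carrier R" "f 1 \<oplus> f 0 = \<zero>" using uv(3) by (auto simp: f_def l_neg)
    moreover have "{..1::nat} = {1, 0}" by auto
    ultimately show ?thesis by simp
  qed
  ultimately have "f 0 = \<zero>" using J(3)[of 1 f] by blast
  then show False using uv(4) by (simp add: f_def)
qed

lemma semiprime_right_goldie: "semiprime_right_goldie R"
  using k_algebra semiprime right_goldie by (simp add: semiprime_right_goldie_def)

end

section \<open>Commutators in the classical quotient ring\<close>

text \<open>\<open>Q\<close> is any ring of fractions on any type; it is specialised to
  \<open>Fract R\<close> only when \<open>AD\<close> is computed.\<close>

locale right_quotient_ring = ore_domain R for R :: "('k::field, 'a) module" (structure) +
  fixes Q :: "('k, 'b) module" and \<iota> :: "'a \<Rightarrow> 'b"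
  assumes localization: "is_right_localization R (regular_elements R) Q \<iota>"
begin

sublocale Q: assoc_algebra Q
  using localization by (simp add: assoc_algebra_def is_right_localization_def)

lemma \<iota>_alg_hom: "\<iota> \<in> alg_hom R Q"
  using localization by (simp add: is_right_localization_def)

lemma \<iota>_ring_hom: "\<iota> \<in> ring_hom R Q"
  using \<iota>_alg_hom by (simp add: alg_hom_def)

lemmas \<iota>_closed [simp] = ring_hom_closed[OF \<iota>_ring_hom]
  and \<iota>_mult = ring_hom_mult[OF \<iota>_ring_hom]
  and \<iota>_add = ring_hom_add[OF \<iota>_ring_hom]
  and \<iota>_one = ring_hom_one[OF \<iota>_ring_hom]

lemma \<iota>_smult: "x \<in> carrier R \<Longrightarrow> \<iota> (c \<odot> x) = c \<odot>\<^bsub>Q\<^esub> \<iota> x"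
  using \<iota>_alg_hom by (simp add: alg_hom_def)

lemma \<iota>_eq_0_iff: "x \<in> carrier R \<Longrightarrow> \<iota> x = \<zero>\<^bsub>Q\<^esub> \<longleftrightarrow> x = \<zero>"
proof -
  assume x: "x \<in> carrier R"
  have "\<iota> x = \<zero>\<^bsub>Q\<^esub> \<longleftrightarrow> (\<exists>s\<in>regular_elements R. x \<otimes> s = \<zero>)"
    using localization x by (simp add: is_right_localization_def)
  also have "\<dots> \<longleftrightarrow> x = \<zero>"
  proof
    assume "\<exists>s\<in>regular_elements R. x \<otimes> s = \<zero>"
    then obtain s where "s \<in> carrier R" "s \<noteq> \<zero>" "x \<otimes> s = \<zero>" by (auto simp: regular_elements_eq)
    with domain[OF x, of s] show "x = \<zero>" by auto
  next
    assume "x = \<zero>"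
    then have "x \<otimes> \<one> = \<zero>" by simp
    then show "\<exists>s\<in>regular_elements R. x \<otimes> s = \<zero>"
      using one_not_zero by (intro bexI[of _ \<one>]) (simp_all add: regular_elements_eq)
  qed
  finally show ?thesis .
qed

lemma \<iota>_inject:
  assumes "x \<in> carrier R" "y \<in> carrier R" "\<iota> x = \<iota> y"
  shows "x = y"
proof -
  have "\<iota> (x \<ominus> y) \<oplus>\<^bsub>Q\<^esub> \<iota> y = \<iota> x"
    using assms(1,2) by (simp add: minus_eq a_assoc l_neg flip: \<iota>_add)
  then have "\<iota> (x \<ominus> y) \<oplus>\<^bsub>Q\<^esub> \<iota> y = \<zero>\<^bsub>Q\<^esub> \<oplus>\<^bsub>Q\<^esub> \<iota> y"
    using assms by simp
  then have "\<iota> (x \<ominus> y) = \<zero>\<^bsub>Q\<^esub>"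
    using assms(1,2) by (subst (asm) Q.add.r_cancel) auto
  then show ?thesis
    using assms(1,2) by (simp add: \<iota>_eq_0_iff r_right_minus_eq)
qed

lemma \<iota>_Units: "s \<in> carrier R \<Longrightarrow> s \<noteq> \<zero> \<Longrightarrow> \<iota> s \<in> Units Q"
  using localization by (simp add: is_right_localization_def regular_elements_eq)

lemma fraction_form:
  assumes "q \<in> carrier Q"
  obtains a s where "a \<in> carrier R" "s \<in> carrier R" "s \<noteq> \<zero>" "q \<otimes>\<^bsub>Q\<^esub> \<iota> s = \<iota> a"
proof -
  obtain a s where as: "a \<in> carrier R" "s \<in> carrier R" "s \<noteq> \<zero>" "q = \<iota> a \<otimes>\<^bsub>Q\<^esub> inv\<^bsub>Q\<^esub> \<iota> s"
    using localization assms unfolding is_right_localization_def regular_elements_eq by blast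
  then show ?thesis
    using that[OF as(1-3)] \<iota>_Units[OF as(2,3)] by (simp add: Q.m_assoc)
qed

lemma numerator_nonzero:
  assumes "q \<in> Units Q" "a \<in> carrier R" "s \<in> carrier R" "s \<noteq> \<zero>" "q \<otimes>\<^bsub>Q\<^esub> \<iota> s = \<iota> a"
  shows "a \<noteq> \<zero>"
proof
  assume "a = \<zero>"
  then have "q \<otimes>\<^bsub>Q\<^esub> \<iota> s = q \<otimes>\<^bsub>Q\<^esub> \<zero>\<^bsub>Q\<^esub>" using assms \<iota>_eq_0_iff[of \<zero>] Q.Units_closed[OF assms(1)] by simp
  then have "\<iota> s = \<zero>\<^bsub>Q\<^esub>" using assms(1,3) Q.Units_l_cancel by auto
  then show False using assms \<iota>_eq_0_iff by simp
qed

end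

text \<open>\<open>L\<close> behaves like a valuation of which only multiplicativity is kept. The
  value group may be noncommutative, which is why the order of the factors in the extension to
  fractions matters.\<close>

locale valued_quotient_ring = right_quotient_ring R Q \<iota> + G: group G
  for R :: "('k::field, 'a) module" (structure) and Q :: "('k, 'b) module" and \<iota> :: "'a \<Rightarrow> 'b"
    and G :: "'v monoid" +
  fixes L :: "'a \<Rightarrow> 'v"
  assumes L_closed [simp]: "x \<in> carrier R \<Longrightarrow> x \<noteq> \<zero> \<Longrightarrow> L x \<in> carrier G"
    and L_mult: "x \<in> carrier R \<Longrightarrow> x \<noteq> \<zero> \<Longrightarrow> y \<in> carrier R \<Longrightarrow> y \<noteq> \<zero> \<Longrightarrow> L (x \<otimes> y) = L x \<otimes>\<^bsub>G\<^esub> L y"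
begin

text \<open>Over a common denominator the values of numerator and denominator acquire the same right
  factor, which cancels against its inverse.\<close>

lemma L_fraction_unique:
  assumes q: "q \<in> Units Q"
    and a: "a \<in> carrier R" "s \<in> carrier R" "s \<noteq> \<zero>" "q \<otimes>\<^bsub>Q\<^esub> \<iota> s = \<iota> a"
    and b: "b \<in> carrier R" "t \<in> carrier R" "t \<noteq> \<zero>" "q \<otimes>\<^bsub>Q\<^esub> \<iota> t = \<iota> b"
  shows "L a \<otimes>\<^bsub>G\<^esub> inv\<^bsub>G\<^esub> L s = L b \<otimes>\<^bsub>G\<^esub> inv\<^bsub>G\<^esub> L t"
proof -
  obtain u v where u: "u \<in> carrier R" "v \<in> carrier R" "s \<otimes> u = t \<otimes> v" "s \<otimes> u \<noteq> \<zero>"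
    using ore[OF a(2) b(2) a(3) b(3)] by blast
  have nz: "a \<noteq> \<zero>" "b \<noteq> \<zero>" using numerator_nonzero q a b by blast+
  have unz: "u \<noteq> \<zero>" using u(1,4) a(2) by auto
  have vnz: "v \<noteq> \<zero>" using u(2,3,4) b(2) by auto
  have "\<iota> (a \<otimes> u) = q \<otimes>\<^bsub>Q\<^esub> \<iota> (s \<otimes> u)"
    using q a u(1) by (simp add: \<iota>_mult Q.m_assoc[symmetric] Q.Units_closed)
  also have "\<dots> = \<iota> (b \<otimes> v)"
    unfolding u(3) using q b u(2) by (simp add: \<iota>_mult Q.m_assoc[symmetric] Q.Units_closed)
  finally have "a \<otimes> u = b \<otimes> v" using \<iota>_inject a(1) b(1) u(1,2) by simp
  then have 1: "L a \<otimes>\<^bsub>G\<^esub> L u = L b \<otimes>\<^bsub>G\<^esub> L v" and 2: "L s \<otimes>\<^bsub>G\<^esub> L u = L t \<otimes>\<^bsub>G\<^esub> L v"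
    using L_mult a b u unz vnz nz by metis+
  note cl = L_closed[OF a(1) nz(1)] L_closed[OF b(1) nz(2)] L_closed[OF a(2,3)] L_closed[OF b(2,3)]
    L_closed[OF u(1) unz] L_closed[OF u(2) vnz]
  have "L a \<otimes>\<^bsub>G\<^esub> inv\<^bsub>G\<^esub> L s = (L a \<otimes>\<^bsub>G\<^esub> L u) \<otimes>\<^bsub>G\<^esub> inv\<^bsub>G\<^esub> (L s \<otimes>\<^bsub>G\<^esub> L u)"
    using cl by (simp add: G.inv_mult_group G.m_assoc) (simp add: G.m_assoc[symmetric])
  also have "\<dots> = L b \<otimes>\<^bsub>G\<^esub> inv\<^bsub>G\<^esub> L t"
    unfolding 1 2 using cl by (simp add: G.inv_mult_group G.m_assoc) (simp add: G.m_assoc[symmetric])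
  finally show ?thesis .
qed

definition L_ext :: "'b \<Rightarrow> 'v" where
  "L_ext q = (SOME g. \<exists>a s. a \<in> carrier R \<and> s \<in> carrier R \<and> s \<noteq> \<zero> \<and> q \<otimes>\<^bsub>Q\<^esub> \<iota> s = \<iota> a \<and>
     g = L a \<otimes>\<^bsub>G\<^esub> inv\<^bsub>G\<^esub> L s)"

lemma L_ext_eq:
  assumes "q \<in> Units Q" "a \<in> carrier R" "s \<in> carrier R" "s \<noteq> \<zero>" "q \<otimes>\<^bsub>Q\<^esub> \<iota> s = \<iota> a"
  shows "L_ext q = L a \<otimes>\<^bsub>G\<^esub> inv\<^bsub>G\<^esub> L s"
  unfolding L_ext_def
proof (rule some_equality)
  show "\<exists>a' s'. a' \<in> carrier R \<and> s' \<in> carrier R \<and> s' \<noteq> \<zero> \<and> q \<otimes>\<^bsub>Q\<^esub> \<iota> s' = \<iota> a' \<and>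
     L a \<otimes>\<^bsub>G\<^esub> inv\<^bsub>G\<^esub> L s = L a' \<otimes>\<^bsub>G\<^esub> inv\<^bsub>G\<^esub> L s'"
    using assms by blast
qed (use L_fraction_unique[OF assms(1) _ _ _ _ assms(2-5)] in blast)

lemma L_ext_hom: "L_ext \<in> hom (units_of Q) G"
  unfolding hom_def units_of_carrier units_of_mult
proof (intro CollectI conjI ballI Pi_I)
  fix q assume q: "q \<in> Units Q"
  obtain a s where as: "a \<in> carrier R" "s \<in> carrier R" "s \<noteq> \<zero>" "q \<otimes>\<^bsub>Q\<^esub> \<iota> s = \<iota> a"
    using fraction_form[OF Q.Units_closed[OF q]] .
  show "L_ext q \<in> carrier G"
    unfolding L_ext_eq[OF q as] using as numerator_nonzero[OF q as] by simp
next
  fix p q assume p: "p \<in> Units Q" and q: "q \<in> Units Q"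
  obtain a s where as: "a \<in> carrier R" "s \<in> carrier R" "s \<noteq> \<zero>" "q \<otimes>\<^bsub>Q\<^esub> \<iota> s = \<iota> a"
    using fraction_form[OF Q.Units_closed[OF q]] .
  obtain b t where bt: "b \<in> carrier R" "t \<in> carrier R" "t \<noteq> \<zero>" "p \<otimes>\<^bsub>Q\<^esub> \<iota> t = \<iota> b"
    using fraction_form[OF Q.Units_closed[OF p]] .
  have nz: "a \<noteq> \<zero>" "b \<noteq> \<zero>" using numerator_nonzero[OF q as] numerator_nonzero[OF p bt] .
  \<comment> \<open>The numerator of \<open>q\<close> and the denominator of \<open>p\<close> are
    given a common right multiple, so that the product of the two fractions telescopes.\<close>
  obtain u v where u: "u \<in> carrier R" "v \<in> carrier R" "a \<otimes> u = t \<otimes> v" "a \<otimes> u \<noteq> \<zero>"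
    using ore[OF as(1) bt(2) nz(1) bt(3)] by blast
  have unz: "u \<noteq> \<zero>" "v \<noteq> \<zero>" using u(4) as(1) u(3) bt(2) by auto
  have su: "s \<otimes> u \<in> carrier R" "s \<otimes> u \<noteq> \<zero>" using domain[OF as(2) u(1)] as unz u by auto
  have bv: "b \<otimes> v \<in> carrier R" "b \<otimes> v \<noteq> \<zero>" using domain[OF bt(1) u(2)] bt nz unz u by auto
  have au: "a \<otimes> u \<in> carrier R" using as(1) u(1) by simp
  have 1: "q \<otimes>\<^bsub>Q\<^esub> \<iota> (s \<otimes> u) = \<iota> (a \<otimes> u)"
    using q as u(1) by (simp add: \<iota>_mult Q.m_assoc[symmetric] Q.Units_closed)
  have 2: "p \<otimes>\<^bsub>Q\<^esub> \<iota> (a \<otimes> u) = \<iota> (b \<otimes> v)"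
    unfolding u(3) using p bt u(2) by (simp add: \<iota>_mult Q.m_assoc[symmetric] Q.Units_closed)
  have 3: "p \<otimes>\<^bsub>Q\<^esub> q \<otimes>\<^bsub>Q\<^esub> \<iota> (s \<otimes> u) = \<iota> (b \<otimes> v)"
    using 1 2 p q su by (simp add: Q.m_assoc Q.Units_closed)
  have "L_ext (p \<otimes>\<^bsub>Q\<^esub> q) = L (b \<otimes> v) \<otimes>\<^bsub>G\<^esub> inv\<^bsub>G\<^esub> L (s \<otimes> u)"
    by (rule L_ext_eq[OF Q.Units_m_closed[OF p q] bv(1) su 3])
  moreover have "L_ext p = L (b \<otimes> v) \<otimes>\<^bsub>G\<^esub> inv\<^bsub>G\<^esub> L (a \<otimes> u)"
    by (rule L_ext_eq[OF p bv(1) au u(4) 2])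
  moreover have "L_ext q = L (a \<otimes> u) \<otimes>\<^bsub>G\<^esub> inv\<^bsub>G\<^esub> L (s \<otimes> u)"
    by (rule L_ext_eq[OF q au su 1])
  ultimately show "L_ext (p \<otimes>\<^bsub>Q\<^esub> q) = L_ext p \<otimes>\<^bsub>G\<^esub> L_ext q"
    using L_closed[OF bv] L_closed[OF su] L_closed[OF au u(4)]
    by (simp add: G.m_assoc) (simp add: G.m_assoc[symmetric])
qed

lemma scalar_Units: "c \<noteq> 0 \<Longrightarrow> c \<odot>\<^bsub>Q\<^esub> \<one>\<^bsub>Q\<^esub> \<in> Units Q"
  unfolding Units_def
  by (auto intro!: bexI[of _ "inverse c \<odot>\<^bsub>Q\<^esub> \<one>\<^bsub>Q\<^esub>"] simp: Q.smult_mult Q.smult_smult)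

text \<open>Homomorphisms map the derived subgroup into the derived subgroup, and a scalar is the
  fraction with denominator \<open>\<one>\<close>, whose value is the neutral element.\<close>

lemma scalar_in_derived:
  assumes "c \<noteq> 0" "c \<odot>\<^bsub>Q\<^esub> \<one>\<^bsub>Q\<^esub> \<in> derived (units_of Q) (carrier (units_of Q))"
  shows "L (c \<odot> \<one>) \<in> derived G (carrier G)"
proof -
  interpret U: group "units_of Q" by (rule Q.units_group)
  interpret E: group_hom "units_of Q" G L_ext
    by (intro group_hom.intro U.is_group G.is_group group_hom_axioms.intro L_ext_hom)
  have "L_ext (c \<odot>\<^bsub>Q\<^esub> \<one>\<^bsub>Q\<^esub>) \<in> derived G (L_ext ` carrier (units_of Q))"
    using assms(2) by (simp add: E.derived_img)
  also have "\<dots> \<subseteq> derived G (carrier G)"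
    by (rule G.mono_derived) (use E.hom_closed in auto)
  finally have "L_ext (c \<odot>\<^bsub>Q\<^esub> \<one>\<^bsub>Q\<^esub>) \<in> derived G (carrier G)" .
  moreover have nz: "c \<odot> \<one> \<noteq> \<zero>" using assms(1) one_not_zero by (simp add: smult_eq_zero_iff)
  have "L_ext (c \<odot>\<^bsub>Q\<^esub> \<one>\<^bsub>Q\<^esub>) = L (c \<odot> \<one>) \<otimes>\<^bsub>G\<^esub> inv\<^bsub>G\<^esub> L \<one>"
    by (rule L_ext_eq[OF scalar_Units[OF assms(1)]]) (use one_not_zero in \<open>simp_all add: \<iota>_smult \<iota>_one Q.smult_mult\<close>)
  moreover have "L \<one> = \<one>\<^bsub>G\<^esub>"
    using L_mult[of \<one> \<one>] L_closed[of \<one>] one_not_zero by simp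
  ultimately show ?thesis using L_closed[OF _ nz] by simp
qed

end

section \<open>The central extension formed by leading terms\<close>

lemma group_mult_of_type: "group (Multiplicative_Group.mult_of (ring_of_type_algebra :: 'k::field ring))"
  using field.field_mult_group[OF field_from_type_algebra] .

lemma inv_mult_of_type:
  assumes "c \<noteq> (0 :: 'k::field)"
  shows "inv\<^bsub>Multiplicative_Group.mult_of (ring_of_type_algebra :: 'k ring)\<^esub> c = inverse c"
  using group.inv_equality[OF group_mult_of_type, of "inverse c" c] assms by simp

context twisted_subalgebra
begin

text \<open>The group of nonzero monomials under the twisted product: the central extension of the
  exponent group by the nonzero scalars that belongs to \<open>\<kappa>\<close>.\<close>

definition lead_group :: "('k \<times> (int ^ 'n)) monoid" where
  "lead_group = \<lparr>carrier = {(a, s). a \<noteq> 0},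
     monoid.mult = (\<lambda>(a, s) (b, t). (a * b * \<kappa> s t, s + t)), one = (1, 0)\<rparr>"

lemma lead_group_simps [simp]:
  "(a, s) \<in> carrier lead_group \<longleftrightarrow> a \<noteq> 0"
  "(a, s) \<otimes>\<^bsub>lead_group\<^esub> (b, t) = (a * b * \<kappa> s t, s + t)"
  "\<one>\<^bsub>lead_group\<^esub> = (1, 0)"
  by (simp_all add: lead_group_def)

lemma cocycle_zero [simp]: "\<kappa> 0 t = 1" "\<kappa> s 0 = 1"
  using cocycles2_zero[OF cocycle] cocycle_one by metis+

lemma group_lead_group: "group lead_group"
proof (rule groupI)
  fix x assume x: "x \<in> carrier lead_group"
  obtain a s where as: "x = (a, s)" by (cases x)
  show "\<one>\<^bsub>lead_group\<^esub> \<otimes>\<^bsub>lead_group\<^esub> x = x" by (simp add: as)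
  show "\<exists>y\<in>carrier lead_group. y \<otimes>\<^bsub>lead_group\<^esub> x = \<one>\<^bsub>lead_group\<^esub>"
    by (rule bexI[of _ "(inverse (a * \<kappa> (- s) s), - s)"]) (use x as cocycle_nonzero in \<open>simp_all add: field_simps\<close>)
next
  fix x y assume "x \<in> carrier lead_group" "y \<in> carrier lead_group"
  then show "x \<otimes>\<^bsub>lead_group\<^esub> y \<in> carrier lead_group"
    by (cases x; cases y) (simp add: cocycle_nonzero)
next
  fix x y z assume "x \<in> carrier lead_group" "y \<in> carrier lead_group" "z \<in> carrier lead_group"
  obtain a s b t c u where xyz: "x = (a, s)" "y = (b, t)" "z = (c, u)" by (cases x; cases y; cases z)
  have "a * b * \<kappa> s t * c * \<kappa> (s + t) u = a * b * c * (\<kappa> (s + t) u * \<kappa> s t)" by (simp add: mult_ac)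
  also have "\<dots> = a * b * c * (\<kappa> s (t + u) * \<kappa> t u)" by (simp only: cocycles2D(2)[OF cocycle])
  also have "\<dots> = a * (b * c * \<kappa> t u) * \<kappa> s (t + u)" by (simp add: mult_ac)
  finally show "x \<otimes>\<^bsub>lead_group\<^esub> y \<otimes>\<^bsub>lead_group\<^esub> z = x \<otimes>\<^bsub>lead_group\<^esub> (y \<otimes>\<^bsub>lead_group\<^esub> z)"
    unfolding xyz by (simp add: add.assoc)
qed simp

definition alt_group :: "'k set" where
  "alt_group = generate (Multiplicative_Group.mult_of ring_of_type_algebra) {alt_of \<kappa> s t | s t. True}"

lemma alt_group_subgroup: "subgroup alt_group (Multiplicative_Group.mult_of ring_of_type_algebra)"
  unfolding alt_group_def
  by (rule group.generate_is_subgroup[OF group_mult_of_type]) (auto simp: alt_of_nonzero[OF cocycle])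

text \<open>The coefficients cancel in a commutator, which is therefore the central scalar
  \<open>alt_of \<kappa> s t\<close> in degree 0.\<close>

lemma derived_lead_group: "derived lead_group (carrier lead_group) \<subseteq> {(a, 0) | a. a \<in> alt_group}"
proof -
  interpret LG: group lead_group by (rule group_lead_group)
  note H = subgroup.one_closed[OF alt_group_subgroup] subgroup.m_closed[OF alt_group_subgroup]
    subgroup.m_inv_closed[OF alt_group_subgroup] subgroup.subset[OF alt_group_subgroup]
  have nz: "a \<noteq> 0" if "a \<in> alt_group" for a using H(4) that by auto
  have inv: "inv\<^bsub>lead_group\<^esub> (a, 0) = (inverse a, 0)" if "a \<in> alt_group" for a
    using nz[OF that] by (intro LG.inv_equality) auto
  have "subgroup {(a, 0) | a. a \<in> alt_group} lead_group"
  proof (rule LG.subgroupI)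
    show "inv\<^bsub>lead_group\<^esub> x \<in> {(a, 0) | a. a \<in> alt_group}" if "x \<in> {(a, 0) | a. a \<in> alt_group}" for x
      using that inv H(3) nz by (auto simp: inv_mult_of_type)
    show "x \<otimes>\<^bsub>lead_group\<^esub> y \<in> {(a, 0) | a. a \<in> alt_group}"
      if "x \<in> {(a, 0) | a. a \<in> alt_group}" "y \<in> {(a, 0) | a. a \<in> alt_group}" for x y
      using that H(2) by auto
  qed (use H(1) nz in auto)
  moreover have "derived_set lead_group (carrier lead_group) \<subseteq> {(a, 0) | a. a \<in> alt_group}"
  proof
    fix x assume "x \<in> derived_set lead_group (carrier lead_group)"
    then obtain a s b t where st: "(a, s) \<in> carrier lead_group" "(b, t) \<in> carrier lead_group"
      and x: "x = (a, s) \<otimes>\<^bsub>lead_group\<^esub> (b, t) \<otimes>\<^bsub>lead_group\<^esub> inv\<^bsub>lead_group\<^esub> (a, s) \<otimes>\<^bsub>lead_group\<^esub> inv\<^bsub>lead_group\<^esub> (b, t)"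
      by auto
    let ?z = "(alt_of \<kappa> s t, 0 :: int ^ 'n)"
    have z: "?z \<in> carrier lead_group" by (simp add: alt_of_nonzero[OF cocycle])
    have comm: "(a, s) \<otimes>\<^bsub>lead_group\<^esub> (b, t) = ?z \<otimes>\<^bsub>lead_group\<^esub> ((b, t) \<otimes>\<^bsub>lead_group\<^esub> (a, s))"
      using cocycle_nonzero[of t s] by (simp add: alt_of_def add.commute)
    have "x = ?z"
      unfolding x comm using st z by (simp only: LG.m_assoc LG.m_closed LG.inv_closed LG.r_inv LG.r_one)
    moreover have "alt_of \<kappa> s t \<in> alt_group"
      unfolding alt_group_def by (rule generate.incl) blast
    ultimately show "x \<in> {(a, 0) | a. a \<in> alt_group}" by blast
  qed
  ultimately show ?thesis
    unfolding derived_def using LG.generate_subgroup_incl by blast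
qed

definition lead_term :: "'a \<Rightarrow> 'k \<times> (int ^ 'n)" where
  "lead_term x = (lex.lcoeff (h x), lex.lead (h x))"

lemma valued_quotient_ring_lead_term:
  assumes "is_right_localization R (regular_elements R) Q \<iota>"
  shows "valued_quotient_ring R Q \<iota> lead_group lead_term"
proof -
  interpret LG: group lead_group by (rule group_lead_group)
  show ?thesis
  proof
    show "is_right_localization R (regular_elements R) Q \<iota>" by fact
  next
    fix x assume "x \<in> carrier R" "x \<noteq> \<zero>"
    then show "lead_term x \<in> carrier lead_group"
      by (simp add: lead_term_def lex.lcoeff_nonzero h_eq_0_iff)
  next
    fix x y assume "x \<in> carrier R" "x \<noteq> \<zero>" "y \<in> carrier R" "y \<noteq> \<zero>"
    then show "lead_term (x \<otimes> y) = lead_term x \<otimes>\<^bsub>lead_group\<^esub> lead_term y"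
      by (simp add: lead_term_def h_mult lex.lead_tmul cocycle_nonzero h_eq_0_iff mult_ac)
  qed
qed

text \<open>The upper bound comes from leading terms, since the leading term of a scalar is that
  scalar in degree 0. The lower bound comes from commutators of monomials lying in the
  algebra.\<close>

theorem AD_eq: "AD R = alt_group"
proof
  obtain \<iota> where loc: "is_right_localization R (regular_elements R) (Fract R) \<iota>"
    using is_right_localization_Fract by blast
  interpret V: valued_quotient_ring R "Fract R" \<iota> lead_group lead_term
    by (rule valued_quotient_ring_lead_term[OF loc])
  let ?Q = "Fract R"
  let ?U = "units_of ?Q"
  interpret U: group ?U by (rule V.Q.units_group)
  show "AD R \<subseteq> alt_group"
  proof
    fix c assume "c \<in> AD R"
    then have c: "c \<noteq> 0" "c \<odot>\<^bsub>?Q\<^esub> \<one>\<^bsub>?Q\<^esub> \<in> derived ?U (carrier ?U)" by (auto simp: AD_def)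
    from V.scalar_in_derived[OF c] derived_lead_group have "lead_term (c \<odot> \<one>) \<in> {(a, 0) | a. a \<in> alt_group}"
      by blast
    then show "c \<in> alt_group" using c(1) by (auto simp: lead_term_def h_smult h_one)
  qed
  have dsub: "subgroup (derived ?U (carrier ?U)) ?U"
    by (rule U.derived_is_subgroup) simp
  have inv: "inv\<^bsub>?U\<^esub> (c \<odot>\<^bsub>?Q\<^esub> \<one>\<^bsub>?Q\<^esub>) = inverse c \<odot>\<^bsub>?Q\<^esub> \<one>\<^bsub>?Q\<^esub>" if "c \<noteq> 0" for c
    using that V.scalar_Units[OF that] V.scalar_Units[of "inverse c"]
    by (intro U.inv_equality) (simp_all add: units_of_carrier units_of_mult units_of_one V.Q.smult_mult V.Q.smult_smult)
  have AD_mult: "a * b \<in> AD R" if "a \<in> AD R" "b \<in> AD R" for a b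
    using that subgroup.m_closed[OF dsub, of "a \<odot>\<^bsub>?Q\<^esub> \<one>\<^bsub>?Q\<^esub>" "b \<odot>\<^bsub>?Q\<^esub> \<one>\<^bsub>?Q\<^esub>"]
    by (auto simp: AD_def units_of_mult V.Q.smult_mult V.Q.smult_smult mult.commute)
  have AD_inv: "inverse a \<in> AD R" if "a \<in> AD R" for a
    using that subgroup.m_inv_closed[OF dsub, of "a \<odot>\<^bsub>?Q\<^esub> \<one>\<^bsub>?Q\<^esub>"] inv[of a] by (auto simp: AD_def)
  have AD_one: "1 \<in> AD R"
    using subgroup.one_closed[OF dsub] by (simp add: AD_def units_of_one)
  \<comment> \<open>Monomials with nonnegative exponents are available in \<open>R\<close> and
    become units in the quotient ring, where their commutator can be formed.\<close>
  have affine: "alt_of \<kappa> s t \<in> AD R" if s: "\<And>i. 0 \<le> s $ i" and t: "\<And>i. 0 \<le> t $ i" for s t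
  proof -
    obtain x y where x: "x \<in> carrier R" "h x = Poly_Mapping.single s 1"
      and y: "y \<in> carrier R" "h y = Poly_Mapping.single t 1"
      using h_affine[of s] h_affine[of t] s t by blast
    have single_nz: "Poly_Mapping.single u (1 :: 'k) \<noteq> 0" for u :: "int ^ 'n"
      by (metis lookup_single_eq lookup_zero one_neq_zero)
    have nz: "x \<noteq> \<zero>" "y \<noteq> \<zero>" using x y single_nz h_zero by metis+
    let ?a = "alt_of \<kappa> s t"
    have "h (x \<otimes> y) = h (?a \<odot> (y \<otimes> x))"
      using x y cocycle_nonzero[of t s] by (simp add: h_mult h_smult alt_of_def add.commute)
    then have xy: "x \<otimes> y = ?a \<odot> (y \<otimes> x)" using x y h_inj by (simp add: inj_on_eq_iff)
    have ux: "\<iota> x \<in> Units ?Q" and uy: "\<iota> y \<in> Units ?Q" using V.\<iota>_Units x(1) y(1) nz by auto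
    let ?z = "?a \<odot>\<^bsub>?Q\<^esub> \<one>\<^bsub>?Q\<^esub>"
    have z: "?z \<in> Units ?Q" using V.scalar_Units alt_of_nonzero[OF cocycle] .
    have comm: "\<iota> x \<otimes>\<^bsub>?U\<^esub> \<iota> y = ?z \<otimes>\<^bsub>?U\<^esub> (\<iota> y \<otimes>\<^bsub>?U\<^esub> \<iota> x)"
      using x y xy by (simp add: units_of_mult V.Q.smult_mult flip: V.\<iota>_mult V.\<iota>_smult)
    have cl: "\<iota> x \<in> carrier ?U" "\<iota> y \<in> carrier ?U" "?z \<in> carrier ?U" using ux uy z by (simp_all add: units_of_carrier)
    have "?z = \<iota> x \<otimes>\<^bsub>?U\<^esub> \<iota> y \<otimes>\<^bsub>?U\<^esub> inv\<^bsub>?U\<^esub> \<iota> x \<otimes>\<^bsub>?U\<^esub> inv\<^bsub>?U\<^esub> \<iota> y"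
    proof -
      have "\<iota> x \<otimes>\<^bsub>?U\<^esub> \<iota> y \<otimes>\<^bsub>?U\<^esub> inv\<^bsub>?U\<^esub> \<iota> x = ?z \<otimes>\<^bsub>?U\<^esub> \<iota> y"
        unfolding comm using cl by (simp add: U.m_assoc)
      then show ?thesis using cl by (simp add: U.m_assoc)
    qed
    then have "?z \<in> derived ?U (carrier ?U)"
      unfolding derived_def using cl by (intro generate.incl) blast
    then show ?thesis by (simp add: AD_def alt_of_nonzero[OF cocycle])
  qed
  \<comment> \<open>Positive and negative parts; bimultiplicativity of \<open>alt_of\<close> then
    removes the sign conditions, first from the left and then from the right argument.\<close>
  have decomp: "\<exists>s' s''. s = s' - s'' \<and> (\<forall>i. 0 \<le> s' $ i) \<and> (\<forall>i. 0 \<le> s'' $ i)" for s :: "int ^ 'n"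
    by (rule exI[of _ "\<chi> i. max 0 (s $ i)"], rule exI[of _ "\<chi> i. max 0 (- s $ i)"]) (auto simp: vec_eq_iff)
  have alt_diff: "alt_of \<kappa> (s - s') t = alt_of \<kappa> s t * inverse (alt_of \<kappa> s' t)" for s s' t
    using alt_of_add_left[OF cocycle, of "s - s'" s' t] alt_of_nonzero[OF cocycle, of s' t]
    by (simp add: field_simps)
  have half: "alt_of \<kappa> s t \<in> AD R" if t: "\<And>i. 0 \<le> t $ i" for s t
  proof -
    obtain s' s'' where "s = s' - s''" "\<And>i. 0 \<le> s' $ i" "\<And>i. 0 \<le> s'' $ i" using decomp by blast
    then show ?thesis using affine AD_mult AD_inv t by (simp add: alt_diff)
  qed
  have all: "alt_of \<kappa> s t \<in> AD R" for s t
  proof -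
    obtain t' t'' where t: "t = t' - t''" "\<And>i. 0 \<le> t' $ i" "\<And>i. 0 \<le> t'' $ i" using decomp by blast
    have "alt_of \<kappa> t s \<in> AD R"
      unfolding t(1) alt_diff
      using AD_mult AD_inv half[OF t(2), of s] half[OF t(3), of s] alt_of_swap[OF cocycle] by metis
    then show ?thesis using AD_inv alt_of_swap[OF cocycle] by metis
  qed
  show "alt_group \<subseteq> AD R"
  proof
    fix c assume "c \<in> alt_group"
    then show "c \<in> AD R"
      unfolding alt_group_def
    proof (induction rule: generate.induct)
      case (inv c)
      then show ?case using all AD_inv by (auto simp: inv_mult_of_type alt_of_nonzero[OF cocycle])
    qed (use all AD_one AD_mult in auto)
  qed
qed

end

section \<open>A bicharacter with prescribed alternation\<close>

locale alternating =
  fixes chi :: "int ^ 'n::finite \<Rightarrow> int ^ 'n \<Rightarrow> 'k::field"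
  assumes alternating_bicharacter: "alternating_bicharacter chi"
begin

lemma chi_nonzero [simp]: "chi s t \<noteq> 0"
  and chi_add_left: "chi (s + s') t = chi s t * chi s' t"
  and chi_add_right: "chi s (t + t') = chi s t * chi s t'"
  and chi_self [simp]: "chi s s = 1"
  using alternating_bicharacter by (auto simp: alternating_bicharacter_def bicharacter_def)

lemma chi_zero [simp]: "chi 0 t = 1" "chi s 0 = 1"
  using chi_add_left[of 0 0 t] chi_add_right[of s 0 0] by auto

lemma chi_swap: "chi s t * chi t s = 1"
proof -
  have "chi (s + t) (s + t) = chi s s * chi t s * (chi s t * chi t t)"
    by (simp only: chi_add_left chi_add_right)
  then show ?thesis by (simp add: mult.commute)
qed

lemma chi_uminus_left: "chi (- s) t * chi s t = 1"
  using chi_add_left[of "- s" s t] by simp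

fun restrict_to :: "'n list \<Rightarrow> int ^ 'n \<Rightarrow> int ^ 'n" where
  "restrict_to [] s = 0"
| "restrict_to (i # is) s = axis i (s $ i) + restrict_to is s"

text \<open>The product of \<open>chi (axis j (s_j)) (axis i (t_i))\<close> over all
  \<open>i\<close> listed before \<open>j\<close>. This is the scalar picked up when the product of
  two ordered monomials is sorted, as each power from the second factor passes the later powers of
  the first.\<close>

fun ordered_bichar :: "'n list \<Rightarrow> int ^ 'n \<Rightarrow> int ^ 'n \<Rightarrow> 'k" where
  "ordered_bichar [] s t = 1"
| "ordered_bichar (i # is) s t = chi (restrict_to is s) (axis i (t $ i)) * ordered_bichar is s t"

lemma axis_zero [simp]: "axis i (0 :: int) = 0"
  by (simp add: vec_eq_iff axis_def)

lemma axis_add: "axis i (a + b :: int) = axis i a + axis i b"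
  by (simp add: vec_eq_iff axis_def)

lemma restrict_to_add: "restrict_to is (s + t) = restrict_to is s + restrict_to is t"
  by (induction "is") (simp_all add: axis_add)

lemma restrict_to_nth: "distinct is \<Longrightarrow> restrict_to is s $ j = (if j \<in> set is then s $ j else 0)"
  by (induction "is") (auto simp: axis_def)

lemma ordered_bichar_nonzero: "ordered_bichar is s t \<noteq> 0"
  by (induction "is") simp_all

lemma ordered_bichar_add:
  "ordered_bichar is (s + s') t = ordered_bichar is s t * ordered_bichar is s' t"
  "ordered_bichar is s (t + t') = ordered_bichar is s t * ordered_bichar is s t'"
  by (induction "is") (simp_all add: restrict_to_add axis_add chi_add_left chi_add_right)

text \<open>The two sides collect the factors with \<open>i\<close> before \<open>j\<close> and,
  inverted, those with \<open>j\<close> before \<open>i\<close>; together these make up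
  \<open>chi\<close>, because the diagonal factors are 1.\<close>

lemma ordered_bichar_alternation:
  "ordered_bichar is s t = chi (restrict_to is s) (restrict_to is t) * ordered_bichar is t s"
proof (induction "is")
  case (Cons i "is")
  let ?r = "restrict_to is"
  \<comment> \<open>Both arguments are multiples of one basis vector, where \<open>chi\<close> is 1
    by alternation; induction on naturals, inverses and a swap of arguments cover all
    integers.\<close>
  have ax: "chi (axis i a) (axis i b) = 1" for a b :: int
  proof -
    have nat: "chi (axis i (int n)) (axis i 1) = 1" for n
      by (induction n) (simp_all add: axis_add chi_add_left add.commute[of 1])
    have neg: "chi (axis i (- a)) t = 1" if t: "chi (axis i a) t = 1" for a t
      using chi_add_left[of "axis i (- a)" "axis i a" t] unfolding t axis_add[symmetric] by simp
    have 1: "chi (axis i a) (axis i 1) = 1" for a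
      using nat neg[OF nat] by (cases a rule: int_cases2) simp_all
    have swap: "chi t s = 1" if st: "chi s t = 1" for s t
      using chi_swap[of s t] unfolding st by simp
    have nat': "chi (axis i a) (axis i (int n)) = 1" for n
      by (induction n) (simp_all add: axis_add chi_add_right add.commute[of 1] 1)
    have "chi (axis i (- int n)) (axis i a) = 1" for n
      by (rule neg[OF swap[OF nat']])
    then have "chi (axis i a) (axis i (- int n)) = 1" for n
      by (rule swap)
    with nat' show ?thesis by (cases b rule: int_cases2) simp_all
  qed
  have eq: "chi (axis i (s $ i) + ?r s) (axis i (t $ i) + ?r t)
      = chi (axis i (s $ i)) (?r t) * chi (?r s) (axis i (t $ i)) * chi (?r s) (?r t)"
    by (simp add: chi_add_left chi_add_right ax)
  have inv: "chi (axis i (s $ i)) (?r t) * chi (?r t) (axis i (s $ i)) = 1"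
    by (rule chi_swap)
  have "chi (restrict_to (i # is) s) (restrict_to (i # is) t) * ordered_bichar (i # is) t s
    = (chi (axis i (s $ i)) (?r t) * chi (?r t) (axis i (s $ i))) * chi (?r s) (axis i (t $ i)) *
      (chi (?r s) (?r t) * ordered_bichar is t s)"
    by (simp add: eq mult_ac)
  also have "\<dots> = ordered_bichar (i # is) s t"
    by (simp add: inv flip: Cons.IH)
  finally show ?case ..
qed simp

definition indices :: "'n list" where
  "indices = (SOME is. set is = UNIV \<and> distinct is)"

lemma indices: "set indices = UNIV" "distinct indices"
proof -
  have "\<exists>is :: 'n list. set is = UNIV \<and> distinct is"
    using finite_distinct_list[of "UNIV :: 'n set"] by simp
  from someI_ex[OF this] show "set indices = UNIV" "distinct indices"
    by (simp_all add: indices_def)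
qed

lemma restrict_to_indices [simp]: "restrict_to indices s = s"
  by (simp add: vec_eq_iff restrict_to_nth indices)

definition \<beta> :: "int ^ 'n \<Rightarrow> int ^ 'n \<Rightarrow> 'k" where
  "\<beta> = ordered_bichar indices"

lemma \<beta>_nonzero [simp]: "\<beta> s t \<noteq> 0"
  and \<beta>_add: "\<beta> (s + s') t = \<beta> s t * \<beta> s' t" "\<beta> s (t + t') = \<beta> s t * \<beta> s t'"
  and \<beta>_alternation: "\<beta> s t = chi s t * \<beta> t s"
  unfolding \<beta>_def by (simp_all add: ordered_bichar_nonzero ordered_bichar_add) (subst ordered_bichar_alternation, simp)

lemma \<beta>_zero [simp]: "\<beta> 0 t = 1" "\<beta> s 0 = 1"
  using \<beta>_add(1)[of 0 0 t] \<beta>_add(2)[of s 0 0] \<beta>_nonzero by (metis add_0 mult_cancel_right1)+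

lemma \<beta>_cocycle: "\<beta> \<in> cocycles2"
  by (simp add: cocycles2_def \<beta>_add)

end

lemma ring_type_ring: "Ring.ring (ring_of_type_algebra :: 'r::ring_1 ring)"
proof -
  have "\<exists>y. x + y = 0" "\<exists>y. y + x = 0" for x :: 'r
    by (rule exI[of _ "- x"], simp)+
  then show ?thesis
    by (intro ringI abelian_groupI monoidI) (auto simp: algebra_simps)
qed

section \<open>Quantum tori are twisted group algebras\<close>

locale quantum_torus = alternating chi
  for chi :: "int ^ 'n::finite \<Rightarrow> int ^ 'n \<Rightarrow> 'k::field" +
  fixes T :: "('k, 'a) module" (structure) and \<iota> :: "('n, 'k) free_algebra set \<Rightarrow> 'a"
  assumes is_quantum_torus: "is_quantum_torus (bicharacter_matrix chi) T \<iota>"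
begin

sublocale assoc_algebra T
  using is_quantum_torus by (simp add: assoc_algebra_def is_quantum_torus_def is_right_localization_def)

abbreviation "q \<equiv> bicharacter_matrix chi"
abbreviation "FA \<equiv> ring_of_type_algebra :: ('n, 'k) free_algebra ring"
abbreviation "Aff \<equiv> quantum_affine q"
abbreviation "I \<equiv> quantum_ideal q"

definition \<pi> :: "('n, 'k) free_algebra \<Rightarrow> ('n, 'k) free_algebra set" where
  "\<pi> f = I +>\<^bsub>FA\<^esub> f"

interpretation FA: ring FA by (rule ring_type_ring)

lemma ideal_I: "ideal I FA"
  unfolding quantum_ideal_def by (rule FA.genideal_ideal) simp

interpretation I: ideal I FA by (rule ideal_I)

lemma Aff_simps:
  "carrier Aff = carrier (FA Quot I)" "x \<otimes>\<^bsub>Aff\<^esub> y = x \<otimes>\<^bsub>FA Quot I\<^esub> y" "x \<oplus>\<^bsub>Aff\<^esub> y = x \<oplus>\<^bsub>FA Quot I\<^esub> y"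
  "\<one>\<^bsub>Aff\<^esub> = \<one>\<^bsub>FA Quot I\<^esub>" "\<zero>\<^bsub>Aff\<^esub> = \<zero>\<^bsub>FA Quot I\<^esub>" "c \<odot>\<^bsub>Aff\<^esub> x = \<pi> (free_scalar c) \<otimes>\<^bsub>FA Quot I\<^esub> x"
  by (simp_all add: quantum_affine_def Let_def \<pi>_def)

lemma \<pi>_hom: "\<pi> \<in> ring_hom FA Aff"
proof -
  have "\<pi> \<in> ring_hom FA (FA Quot I)"
    unfolding \<pi>_def[abs_def] by (rule I.rcos_ring_hom)
  then show ?thesis by (simp add: ring_hom_def Aff_simps)
qed

lemma \<pi>_closed [simp]: "\<pi> f \<in> carrier Aff"
  and \<pi>_mult: "\<pi> (f * laurent) = \<pi> f \<otimes>\<^bsub>Aff\<^esub> \<pi> laurent"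
  and \<pi>_add: "\<pi> (f + laurent) = \<pi> f \<oplus>\<^bsub>Aff\<^esub> \<pi> laurent"
  and \<pi>_one: "\<pi> 1 = \<one>\<^bsub>Aff\<^esub>"
  using ring_hom_closed[OF \<pi>_hom, of f] ring_hom_mult[OF \<pi>_hom, of f laurent]
    ring_hom_add[OF \<pi>_hom, of f laurent] ring_hom_one[OF \<pi>_hom] by simp_all

lemma \<pi>_surj:
  assumes "x \<in> carrier Aff"
  obtains f where "x = \<pi> f"
  using assms by (auto simp: Aff_simps FactRing_def A_RCOSETS_def' \<pi>_def)

lemma \<pi>_eq_zero: "\<pi> f = \<zero>\<^bsub>Aff\<^esub> \<Longrightarrow> f \<in> I"
  using I.a_rcos_self[of f] by (simp add: \<pi>_def Aff_simps FactRing_def)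

lemma \<iota>_hom: "\<iota> \<in> alg_hom Aff T"
  and \<iota>_Units: "s \<in> generated_submonoid Aff (range (affine_gen q)) \<Longrightarrow> \<iota> s \<in> Units T"
  and \<iota>_zero: "a \<in> carrier Aff \<Longrightarrow> \<iota> a = \<zero> \<Longrightarrow> \<exists>s\<in>generated_submonoid Aff (range (affine_gen q)). a \<otimes>\<^bsub>Aff\<^esub> s = \<zero>\<^bsub>Aff\<^esub>"
  using is_quantum_torus unfolding is_quantum_torus_def is_right_localization_def by blast+

lemma \<iota>_ring_hom: "\<iota> \<in> ring_hom Aff T"
  using \<iota>_hom by (simp add: alg_hom_def)

definition \<psi> :: "('n, 'k) free_algebra \<Rightarrow> 'a" where
  "\<psi> f = \<iota> (\<pi> f)"

lemma \<psi>_closed [simp]: "\<psi> f \<in> carrier T"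
  and \<psi>_mult: "\<psi> (f * laurent) = \<psi> f \<otimes> \<psi> laurent"
  and \<psi>_add: "\<psi> (f + laurent) = \<psi> f \<oplus> \<psi> laurent"
  and \<psi>_one: "\<psi> 1 = \<one>"
  unfolding \<psi>_def using \<iota>_ring_hom
  by (simp_all add: \<pi>_mult \<pi>_add \<pi>_one ring_hom_closed ring_hom_mult ring_hom_add ring_hom_one)

lemma \<psi>_scalar: "\<psi> (free_scalar c) = c \<odot> \<one>"
proof -
  have "\<psi> (free_scalar c) = \<iota> (\<pi> (free_scalar c) \<otimes>\<^bsub>Aff\<^esub> \<pi> 1)"
    by (simp add: \<psi>_def flip: \<pi>_mult)
  also have "\<dots> = \<iota> (c \<odot>\<^bsub>Aff\<^esub> \<one>\<^bsub>Aff\<^esub>)"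
    by (simp add: Aff_simps \<pi>_one)
  also have "\<dots> = c \<odot> \<iota> \<one>\<^bsub>Aff\<^esub>"
    using \<iota>_hom \<pi>_closed[of 1] by (simp add: alg_hom_def \<pi>_one)
  also have "\<iota> \<one>\<^bsub>Aff\<^esub> = \<one>"
    using ring_hom_one[OF \<iota>_ring_hom] .
  finally show ?thesis .
qed

section \<open>The generators of the torus and their ordered monomials\<close>

definition y :: "'n \<Rightarrow> 'a" where
  "y i = \<iota> (affine_gen q i)"

lemma y_eq: "y i = \<psi> (free_gen i)"
  by (simp add: y_def affine_gen_def \<psi>_def \<pi>_def)

lemma y_closed [simp]: "y i \<in> carrier T"
  by (simp add: y_eq)

lemma y_Units [simp]: "y i \<in> Units T"
proof -
  have "\<one>\<^bsub>Aff\<^esub> \<otimes>\<^bsub>Aff\<^esub> affine_gen q i \<in> generated_submonoid Aff (range (affine_gen q))"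
    by (intro generated_submonoid.intros) simp
  moreover have "affine_gen q i = \<pi> (free_gen i)"
    by (simp add: affine_gen_def \<pi>_def)
  then have "\<one>\<^bsub>Aff\<^esub> \<otimes>\<^bsub>Aff\<^esub> affine_gen q i = affine_gen q i"
    using \<pi>_mult[of 1 "free_gen i"] by (simp add: \<pi>_one)
  ultimately show ?thesis using \<iota>_Units by (simp add: y_def)
qed

lemma \<psi>_ideal:
  assumes "f \<in> I"
  shows "\<psi> f = \<zero>"
proof -
  have "\<pi> f = \<zero>\<^bsub>Aff\<^esub>"
    using I.a_rcos_const[OF assms] by (simp add: \<pi>_def Aff_simps FactRing_def)
  moreover have "\<pi> 0 = \<zero>\<^bsub>Aff\<^esub>"
    using I.a_rcos_const[OF additive_subgroup.zero_closed[OF I.is_additive_subgroup]]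
    by (simp add: \<pi>_def Aff_simps FactRing_def)
  ultimately have "\<psi> f = \<psi> 0" by (simp add: \<psi>_def)
  moreover have "\<psi> 0 = \<zero>" using \<psi>_add[of 0 0] by simp
  ultimately show ?thesis by simp
qed

lemma y_comm: "y i \<otimes> y j = chi (axis i 1) (axis j 1) \<odot> (y j \<otimes> y i)"
proof -
  have "free_gen i * free_gen j - free_scalar (q i j) * free_gen j * free_gen i \<in> I"
    unfolding quantum_ideal_def by (rule subsetD[OF FA.genideal_self]) auto
  then have "\<psi> (free_gen i * free_gen j - free_scalar (q i j) * free_gen j * free_gen i) = \<zero>"
    by (rule \<psi>_ideal)
  moreover have "\<psi> (free_gen i * free_gen j) = \<psi> (free_gen i * free_gen j - free_scalar (q i j) * free_gen j * free_gen i)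
      \<oplus> \<psi> (free_scalar (q i j) * free_gen j * free_gen i)"
    by (simp flip: \<psi>_add)
  ultimately show ?thesis
    by (simp add: \<psi>_mult \<psi>_scalar smult_mult flip: y_eq) (simp add: bicharacter_matrix_def)
qed

text \<open>The commutation rule of homogeneous elements of degrees \<open>s\<close> and
  \<open>t\<close>. The degrees are mere labels here, so the rule can be propagated through products
  and inverses before any grading is available.\<close>

definition qcomm :: "'a \<Rightarrow> int ^ 'n \<Rightarrow> 'a \<Rightarrow> int ^ 'n \<Rightarrow> bool" where
  "qcomm x s z t \<longleftrightarrow> x \<otimes> z = chi s t \<odot> (z \<otimes> x)"

lemma qcomm_swap:
  assumes "x \<in> carrier T" "z \<in> carrier T" "qcomm x s z t"
  shows "qcomm z t x s"
proof -
  have "chi t s \<odot> (x \<otimes> z) = (chi t s * chi s t) \<odot> (z \<otimes> x)"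
    using assms by (simp add: qcomm_def smult_smult)
  then show ?thesis using assms by (simp add: qcomm_def chi_swap)
qed

lemma qcomm_one: "z \<in> carrier T \<Longrightarrow> qcomm \<one> 0 z t"
  by (simp add: qcomm_def)

lemma qcomm_mult:
  assumes c: "x \<in> carrier T" "x' \<in> carrier T" "z \<in> carrier T" and *: "qcomm x s z t" "qcomm x' s' z t"
  shows "qcomm (x \<otimes> x') (s + s') z t"
proof -
  have "x \<otimes> x' \<otimes> z = x \<otimes> (chi s' t \<odot> (z \<otimes> x'))"
    using c *(2) by (simp add: m_assoc qcomm_def)
  also have "\<dots> = chi s' t \<odot> (x \<otimes> z \<otimes> x')"
    using c by (simp add: smult_mult m_assoc)
  also have "\<dots> = chi s' t \<odot> (chi s t \<odot> (z \<otimes> x) \<otimes> x')"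
    using *(1) by (simp add: qcomm_def)
  also have "\<dots> = chi (s + s') t \<odot> (z \<otimes> (x \<otimes> x'))"
    using c by (simp add: smult_mult smult_smult m_assoc chi_add_left mult.commute)
  finally show ?thesis by (simp add: qcomm_def)
qed

lemma qcomm_inv:
  assumes c: "x \<in> Units T" "z \<in> carrier T" and *: "qcomm x s z t"
  shows "qcomm (inv x) (- s) z t"
proof -
  note [simp] = Units_closed[OF c(1)] Units_inv_closed[OF c(1)]
  have "z \<otimes> inv x = inv x \<otimes> (x \<otimes> z) \<otimes> inv x"
    using c by (simp add: m_assoc[symmetric])
  also have "\<dots> = chi s t \<odot> (inv x \<otimes> z \<otimes> (x \<otimes> inv x))"
    using c * by (simp add: qcomm_def smult_mult m_assoc del: Units_r_inv)
  also have "\<dots> = chi s t \<odot> (inv x \<otimes> z)"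
    using c by simp
  finally have "chi (- s) t \<odot> (z \<otimes> inv x) = inv x \<otimes> z"
    using c by (simp add: smult_smult chi_uminus_left)
  then show ?thesis by (simp add: qcomm_def)
qed

abbreviation "U \<equiv> units_of T"

sublocale U: group U by (rule units_group)

lemma U_simps: "carrier U = Units T" "x \<otimes>\<^bsub>U\<^esub> z = x \<otimes> z" "\<one>\<^bsub>U\<^esub> = \<one>"
  by (simp_all add: units_of_carrier units_of_mult units_of_one)

definition ypow :: "'n \<Rightarrow> int \<Rightarrow> 'a" where
  "ypow i a = y i [^]\<^bsub>U\<^esub> a"

lemma ypow_Units [simp]: "ypow i a \<in> Units T"
  using U.int_pow_closed[of "y i" a] by (simp add: ypow_def U_simps)

lemma ypow_closed [simp]: "ypow i a \<in> carrier T"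
  by (simp add: Units_closed)

lemma ypow_add: "ypow i (a + b) = ypow i a \<otimes> ypow i b"
  using U.int_pow_mult[of "y i" a b] by (simp add: ypow_def U_simps)

lemma ypow_0 [simp]: "ypow i 0 = \<one>"
  by (simp add: ypow_def U_simps)

lemma ypow_1 [simp]: "ypow i 1 = y i"
  using U.int_pow_1[of "y i"] by (simp add: ypow_def U_simps)

lemma ypow_minus_1 [simp]: "ypow i (- 1) = inv (y i)"
  using U.int_pow_neg[of "y i" 1] U.int_pow_1[of "y i"] by (simp add: ypow_def U_simps units_of_inv)

lemma qcomm_ypow:
  assumes z: "z \<in> carrier T" and c: "qcomm (y i) (axis i 1) z t"
  shows "qcomm (ypow i a) (axis i a) z t"
proof (induction a rule: int_induct[where k = 0])
  case base
  then show ?case using qcomm_one[OF z] by simp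
next
  case (step1 a)
  then show ?case using qcomm_mult[OF _ _ z step1(2) c] by (simp add: ypow_add axis_add)
next
  case (step2 a)
  have "axis i (a - 1) = axis i a + - axis i (1 :: int)" by (simp add: vec_eq_iff axis_def)
  then show ?case
    using qcomm_mult[OF _ _ z step2(2) qcomm_inv[OF _ z c]] ypow_add[of i a "-1"] by (simp add: Units_inv_closed)
qed

text \<open>\<open>qcomm_ypow\<close> raises only the left element to a power; it is applied twice,
  with the sides swapped in between.\<close>

lemma qcomm_ypow_ypow: "qcomm (ypow i a) (axis i a) (ypow j b) (axis j b)"
proof -
  have "qcomm (y i) (axis i 1) (y j) (axis j 1)" unfolding qcomm_def by (rule y_comm)
  from qcomm_ypow[OF y_closed this] have "qcomm (y j) (axis j 1) (ypow i a) (axis i a)"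
    by (rule qcomm_swap[OF ypow_closed y_closed])
  from qcomm_ypow[OF ypow_closed this] show ?thesis
    by (rule qcomm_swap[OF ypow_closed ypow_closed])
qed

fun ymon_list :: "'n list \<Rightarrow> int ^ 'n \<Rightarrow> 'a" where
  "ymon_list [] s = \<one>"
| "ymon_list (i # is) s = ypow i (s $ i) \<otimes> ymon_list is s"

lemma ymon_list_closed [simp]: "ymon_list is s \<in> carrier T"
  by (induction "is") simp_all

lemma qcomm_ymon_list: "qcomm (ymon_list is s) (restrict_to is s) (ypow j b) (axis j b)"
  by (induction "is") (simp_all add: qcomm_one qcomm_mult qcomm_ypow_ypow)

text \<open>Moving the first power of the second monomial to the left past the tail of the first one
  produces exactly one recursive factor of \<open>ordered_bichar\<close>.\<close>

lemma ymon_list_mult: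
  "ymon_list is s \<otimes> ymon_list is t = ordered_bichar is s t \<odot> ymon_list is (s + t)"
proof (induction "is")
  case (Cons i "is")
  let ?M = "ymon_list is" and ?p = "ypow i"
  have "ymon_list (i # is) s \<otimes> ymon_list (i # is) t = ?p (s $ i) \<otimes> (?M s \<otimes> ?p (t $ i)) \<otimes> ?M t"
    by (simp add: m_assoc)
  also have "?M s \<otimes> ?p (t $ i) = chi (restrict_to is s) (axis i (t $ i)) \<odot> (?p (t $ i) \<otimes> ?M s)"
    using qcomm_ymon_list[of "is" s i "t $ i"] by (simp add: qcomm_def)
  also have "?p (s $ i) \<otimes> \<dots> \<otimes> ?M t
      = chi (restrict_to is s) (axis i (t $ i)) \<odot> (?p (s $ i) \<otimes> ?p (t $ i) \<otimes> (?M s \<otimes> ?M t))"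
    by (simp add: smult_mult m_assoc)
  also have "\<dots> = ordered_bichar (i # is) s t \<odot> ymon_list (i # is) (s + t)"
    by (simp add: Cons.IH smult_mult smult_smult ypow_add m_assoc)
  finally show ?case .
qed simp

definition ymon :: "int ^ 'n \<Rightarrow> 'a" where
  "ymon = ymon_list indices"

lemma ymon_closed [simp]: "ymon s \<in> carrier T"
  by (simp add: ymon_def)

lemma ymon_mult: "ymon s \<otimes> ymon t = \<beta> s t \<odot> ymon (s + t)"
  by (simp add: ymon_def \<beta>_def ymon_list_mult)

lemma ymon_list_axis: "distinct is \<Longrightarrow> ymon_list is (axis i 1) = (if i \<in> set is then y i else \<one>)"
  by (induction "is") (auto simp: axis_def)

lemma ymon_axis [simp]: "ymon (axis i 1) = y i"
  by (simp add: ymon_def ymon_list_axis indices)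

lemma ymon_zero [simp]: "ymon 0 = \<one>"
proof -
  have "ymon_list is 0 = \<one>" for "is" by (induction "is") simp_all
  then show ?thesis by (simp add: ymon_def)
qed

definition laurent :: "(int ^ 'n \<Rightarrow>\<^sub>0 'k) \<Rightarrow> 'a" where
  "laurent p = finsum T (\<lambda>s. Poly_Mapping.lookup p s \<odot> ymon s) (Poly_Mapping.keys p)"

lemma laurent_superset:
  assumes "finite S" "Poly_Mapping.keys p \<subseteq> S"
  shows "laurent p = finsum T (\<lambda>s. Poly_Mapping.lookup p s \<odot> ymon s) S"
  unfolding laurent_def
  by (rule add.finprod_mono_neutral_cong_left) (use assms in \<open>auto simp: in_keys_iff\<close>)

lemma laurent_closed [simp]: "laurent p \<in> carrier T"
  unfolding laurent_def by (rule finsum_closed) auto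

lemma laurent_add: "laurent (p + p') = laurent p \<oplus> laurent p'"
proof -
  let ?S = "Poly_Mapping.keys p \<union> Poly_Mapping.keys p'"
  have "laurent (p + p') = finsum T (\<lambda>s. Poly_Mapping.lookup p s \<odot> ymon s \<oplus> Poly_Mapping.lookup p' s \<odot> ymon s) ?S"
    by (subst laurent_superset[of ?S]) (auto simp: lookup_add smult_add_left keys_add)
  also have "\<dots> = laurent p \<oplus> laurent p'"
    by (simp add: laurent_superset[of ?S] finsum_addf)
  finally show ?thesis .
qed

lemma laurent_single [simp]: "laurent (Poly_Mapping.single s a) = a \<odot> ymon s"
  by (subst laurent_superset[of "{s}"]) auto

lemma laurent_zero [simp]: "laurent 0 = \<zero>"
  by (simp add: laurent_def)

lemma laurent_pscale: "laurent (pscale c p) = c \<odot> laurent p"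
  by (induction p rule: poly_mapping_single_induct)
    (simp_all add: pscale_add laurent_add smult_add_right smult_smult)

lemma laurent_tmul: "laurent (tmul \<beta> p p') = laurent p \<otimes> laurent p'"
proof (induction p rule: poly_mapping_single_induct)
  case (single s a)
  show ?case
    by (induction p' rule: poly_mapping_single_induct)
      (simp_all add: tmul_add_right laurent_add r_distr smult_mult smult_smult ymon_mult mult_ac)
qed (simp_all add: tmul_add_left laurent_add l_distr)

lemma laurent_uminus: "laurent (- p) = \<ominus> laurent p"
  using laurent_add[of p "- p"] by (simp add: minus_equality[symmetric] a_comm)

subsection \<open>Injectivity and surjectivity\<close>

fun word_image :: "'n list \<Rightarrow> (int ^ 'n \<Rightarrow>\<^sub>0 'k)" where
  "word_image [] = Poly_Mapping.single 0 1"
| "word_image (i # w) = tmul \<beta> (Poly_Mapping.single (axis i 1) 1) (word_image w)"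

fun word_degree :: "'n list \<Rightarrow> int ^ 'n" where
  "word_degree [] = 0"
| "word_degree (i # w) = axis i 1 + word_degree w"

lemma word_image_append: "word_image (v @ w) = tmul \<beta> (word_image v) (word_image w)"
  by (induction v) (simp_all add: tmul_assoc[OF \<beta>_cocycle] tmul_one[OF \<beta>_cocycle])

lemma word_image_single: "\<exists>c. c \<noteq> 0 \<and> word_image w = Poly_Mapping.single (word_degree w) c"
proof (induction w)
  case (Cons i w)
  then obtain c where "c \<noteq> 0" "word_image w = Poly_Mapping.single (word_degree w) c" by blast
  then show ?case
    by (intro exI[of _ "\<beta> (axis i 1) (word_degree w) * c"]) simp
qed (auto intro!: exI[of _ 1])

text \<open>The algebra map from the free algebra to the twisted group algebra of
  \<open>\<beta>\<close> that sends generators to basis monomials. As the relations die under it, it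
  detects which elements are nonzero in the quantum affine space.\<close>

definition free_image :: "('n, 'k) free_algebra \<Rightarrow> (int ^ 'n \<Rightarrow>\<^sub>0 'k)" where
  "free_image f = (\<Sum>w\<in>Poly_Mapping.keys f. pscale (Poly_Mapping.lookup f w) (word_image (letters w)))"

lemma free_image_superset:
  assumes "finite S" "Poly_Mapping.keys f \<subseteq> S"
  shows "free_image f = (\<Sum>w\<in>S. pscale (Poly_Mapping.lookup f w) (word_image (letters w)))"
  unfolding free_image_def by (rule sum.mono_neutral_left) (use assms in \<open>auto simp: in_keys_iff pscale_eq_0_iff\<close>)

lemma free_image_add: "free_image (f + f') = free_image f + free_image f'"
proof -
  let ?S = "Poly_Mapping.keys f \<union> Poly_Mapping.keys f'"
  show ?thesis
    using keys_add[of f f'] by (simp add: free_image_superset[of ?S] lookup_add pscale_add_left sum.distrib)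
qed

lemma free_image_zero [simp]: "free_image 0 = 0"
  by (simp add: free_image_def)

lemma free_image_uminus: "free_image (- f) = - free_image f"
  using free_image_add[of f "- f"] by (simp add: eq_neg_iff_add_eq_0 add.commute)

lemma free_image_diff: "free_image (f - f') = free_image f - free_image f'"
  using free_image_add[of f "- f'"] by (simp add: free_image_uminus)

lemma free_image_single [simp]: "free_image (Poly_Mapping.single w a) = pscale a (word_image (letters w))"
  by (subst free_image_superset[of "{w}"]) auto

lemma free_image_mult: "free_image (f * f') = tmul \<beta> (free_image f) (free_image f')"
proof (induction f rule: poly_mapping_single_induct)
  case (single w a)
  show ?case
    by (induction f' rule: poly_mapping_single_induct)
      (simp_all add: distrib_left tmul_add_right free_image_add mult_single plus_free_monoid_def
        word_image_append tmul_pscale_left tmul_pscale_right mult_ac)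
qed (simp_all add: distrib_right tmul_add_left free_image_add)

text \<open>The kernel is an ideal, and it contains the relations precisely because the alternation
  of \<open>\<beta>\<close> is \<open>chi\<close>.\<close>

lemma free_image_ideal: "f \<in> I \<Longrightarrow> free_image f = 0"
proof -
  have "ideal {f. free_image f = 0} FA"
  proof (rule idealI[OF ring_type_ring])
    have "group (add_monoid FA)" by (rule FA.add.is_group)
    then show "subgroup {f. free_image f = 0} (add_monoid FA)"
    proof (rule group.subgroupI)
      fix a assume a: "a \<in> {f. free_image f = 0}"
      have "inv\<^bsub>add_monoid FA\<^esub> a = - a"
        using group.inv_equality[OF FA.add.is_group, of "- a" a] by simp
      then show "inv\<^bsub>add_monoid FA\<^esub> a \<in> {f. free_image f = 0}" using a by (simp add: free_image_uminus)
    qed (auto simp: free_image_add intro!: exI[of _ 0])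
  qed (auto simp: free_image_mult)
  moreover have "{free_gen i * free_gen j - free_scalar (q i j) * free_gen j * free_gen i | i j. True} \<subseteq> {f. free_image f = 0}"
  proof safe
    fix i j :: 'n
    have "free_image (free_gen i * free_gen j - free_scalar (q i j) * free_gen j * free_gen i)
        = Poly_Mapping.single (axis i 1 + axis j 1) (\<beta> (axis i 1) (axis j 1)) -
          Poly_Mapping.single (axis i 1 + axis j 1) (chi (axis i 1) (axis j 1) * \<beta> (axis j 1) (axis i 1))"
      by (simp add: free_image_diff free_image_mult free_gen_def free_scalar_def zero_free_monoid_def bicharacter_matrix_def
          tmul_one[OF \<beta>_cocycle] tmul_pscale_left mult_ac add.commute)
    also have "\<dots> = 0" by (subst \<beta>_alternation) simp
    finally show "free_image (free_gen i * free_gen j - free_scalar (q i j) * free_gen j * free_gen i) = 0" .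
  qed
  ultimately have "I \<subseteq> {f. free_image f = 0}"
    unfolding quantum_ideal_def by (rule FA.genideal_minimal)
  then show "f \<in> I \<Longrightarrow> free_image f = 0" by auto
qed

text \<open>Both sides are algebra homomorphisms with the same values on the generators.\<close>

lemma \<psi>_eq: "\<psi> f = laurent (free_image f)"
proof (induction f rule: poly_mapping_single_induct)
  case zero
  then show ?case using \<psi>_add[of 0 0] by simp
next
  case (single w a)
  have word: "\<psi> (Poly_Mapping.single (Word v) 1) = laurent (word_image v)" for v
  proof (induction v)
    case Nil
    have "Poly_Mapping.single (Word ([] :: 'n list)) (1 :: 'k) = 1"
      by (simp add: zero_free_monoid_def[symmetric] single_one)
    then show ?case by (simp add: \<psi>_one)
  next
    case (Cons i v)
    have "Poly_Mapping.single (Word (i # v)) 1 = free_gen i * Poly_Mapping.single (Word v) (1 :: 'k)"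
      by (simp add: free_gen_def mult_single plus_free_monoid_def)
    then show ?case by (simp add: \<psi>_mult Cons.IH laurent_tmul flip: y_eq)
  qed
  have 1: "\<psi> (Poly_Mapping.single w 1) = laurent (word_image (letters w))"
    using word[of "letters w"] by simp
  have "\<psi> (Poly_Mapping.single w a) = \<psi> (free_scalar a * Poly_Mapping.single w 1)"
    by (simp add: free_scalar_def mult_single)
  also have "\<dots> = laurent (free_image (Poly_Mapping.single w a))"
    by (simp add: \<psi>_mult \<psi>_scalar smult_mult 1 laurent_pscale)
  finally show ?case .
qed (simp add: \<psi>_add free_image_add laurent_add)

lemma word_degree_append: "word_degree (v @ w) = word_degree v + word_degree w"
  by (induction v) (simp_all add: add.assoc)

lemma word_degree_surj:
  assumes "\<And>i. 0 \<le> s $ i"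
  shows "\<exists>w. word_degree w = s"
proof -
  have rep: "word_degree (replicate k i) = axis i (int k)" for k i
    by (induction k) (simp_all add: axis_add)
  have "word_degree (concat (map (\<lambda>i. replicate (nat (s $ i)) i) is)) = restrict_to is s" for "is"
    using assms by (induction "is") (simp_all add: word_degree_append rep)
  from this[of indices] show ?thesis by (metis restrict_to_indices)
qed

text \<open>A word with the prescribed degree has as image a nonzero multiple of the monomial, and
  rescaling removes the factor.\<close>

lemma free_image_surj_affine:
  assumes "\<And>s i. s \<in> Poly_Mapping.keys p \<Longrightarrow> 0 \<le> s $ i"
  shows "\<exists>f. free_image f = p"
proof -
  have "\<exists>f. free_image f = Poly_Mapping.single s c" if s: "s \<in> Poly_Mapping.keys p" for s c
  proof -
    obtain w where w: "word_degree w = s" using word_degree_surj[OF assms[OF s]] by blast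
    obtain d where "d \<noteq> 0" "word_image w = Poly_Mapping.single s d"
      using word_image_single[of w] w by auto
    then have "free_image (Poly_Mapping.single (Word w) (c / d)) = Poly_Mapping.single s c" by simp
    then show ?thesis by blast
  qed
  then obtain F where F: "\<And>s c. s \<in> Poly_Mapping.keys p \<Longrightarrow> free_image (F s c) = Poly_Mapping.single s c" by metis
  have "free_image (\<Sum>s\<in>S. F s (Poly_Mapping.lookup p s)) = (\<Sum>s\<in>S. Poly_Mapping.single s (Poly_Mapping.lookup p s))"
    if "finite S" "S \<subseteq> Poly_Mapping.keys p" for S
    using that by (induction S rule: finite_induct) (auto simp: free_image_add F)
  from this[of "Poly_Mapping.keys p"] show ?thesis
    using poly_mapping_expand[of "Poly_Mapping.keys p" p] by auto
qed

lemma generated_word: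
  assumes "s \<in> generated_submonoid Aff (range (affine_gen q))"
  shows "\<exists>w. s = \<pi> (Poly_Mapping.single (Word w) 1)"
  using assms
proof (induction rule: generated_submonoid.induct)
  case one
  then show ?case using \<pi>_one by (intro exI[of _ "[]"]) (simp add: zero_free_monoid_def[symmetric] single_one)
next
  case (mult m x)
  then obtain w i where "m = \<pi> (Poly_Mapping.single (Word w) 1)" "x = \<pi> (free_gen i)"
    by (auto simp: affine_gen_def \<pi>_def)
  then have "m \<otimes>\<^bsub>Aff\<^esub> x = \<pi> (Poly_Mapping.single (Word (w @ [i])) 1)"
    by (simp add: free_gen_def mult_single plus_free_monoid_def flip: \<pi>_mult)
  then show ?case by blast
qed

lemma tmul_\<beta>_nonzero:
  assumes "p \<noteq> 0" "p' \<noteq> 0"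
  shows "tmul \<beta> p p' \<noteq> 0"
  using positive_cone.lead_tmul(1)[OF positive_cone_lex[OF indices(1)] assms, of \<beta>] by simp

lemma single_nonzero: "c \<noteq> 0 \<Longrightarrow> Poly_Mapping.single s c \<noteq> 0"
  by (metis lookup_single_eq lookup_zero)

text \<open>An element in the kernel is shifted into the quantum affine space and lifted to the free
  algebra. A zero in the localization is killed by a word, and applying \<open>free_image\<close>
  gives a vanishing product of nonzero elements.\<close>

lemma laurent_kernel:
  assumes "laurent p = \<zero>"
  shows "p = 0"
proof (rule ccontr)
  assume p: "p \<noteq> 0"
  \<comment> \<open>A shift large enough to make every exponent of \<open>p\<close>
    nonnegative.\<close>
  define m :: "int ^ 'n" where "m = (\<chi> i. \<Sum>s\<in>Poly_Mapping.keys p. \<bar>s $ i\<bar>)"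
  have m: "0 \<le> s $ i + m $ i" if "s \<in> Poly_Mapping.keys p" for s i
  proof -
    have "\<bar>s $ i\<bar> \<le> (\<Sum>s\<in>Poly_Mapping.keys p. \<bar>s $ i\<bar>)"
      using that by (intro member_le_sum) auto
    then show ?thesis by (simp add: m_def)
  qed
  let ?r = "tmul \<beta> p (Poly_Mapping.single m 1)"
  have "0 \<le> s $ i" if s: "s \<in> Poly_Mapping.keys ?r" for s i
  proof -
    obtain s' where "s = s' + m" "s' \<in> Poly_Mapping.keys p"
      using subsetD[OF keys_tmul s] by (auto split: if_splits)
    then show ?thesis using m[of s' i] by simp
  qed
  then obtain f where f: "free_image f = ?r" using free_image_surj_affine by metis
  have "\<iota> (\<pi> f) = \<zero>"
    using \<psi>_eq[of f] assms by (simp add: \<psi>_def f laurent_tmul)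
  then obtain w where "\<pi> f \<otimes>\<^bsub>Aff\<^esub> \<pi> (Poly_Mapping.single (Word w) 1) = \<zero>\<^bsub>Aff\<^esub>"
    using \<iota>_zero[of "\<pi> f"] generated_word by auto
  then have "f * Poly_Mapping.single (Word w) 1 \<in> I"
    by (intro \<pi>_eq_zero) (simp add: \<pi>_mult)
  from free_image_ideal[OF this] have "tmul \<beta> ?r (word_image w) = 0"
    by (simp add: free_image_mult f)
  moreover have "word_image w \<noteq> 0"
    using word_image_single[of w] single_nonzero by metis
  moreover have "?r \<noteq> 0"
    by (rule tmul_\<beta>_nonzero[OF p single_nonzero]) simp
  ultimately show False using tmul_\<beta>_nonzero by blast
qed

lemma laurent_inject: "laurent p = laurent p' \<longleftrightarrow> p = p'"
proof
  assume eq: "laurent p = laurent p'"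
  have "laurent (p - p') = laurent p \<oplus> laurent (- p')" by (simp flip: laurent_add)
  also have "\<dots> = \<zero>" by (simp add: eq laurent_uminus r_neg)
  finally show "p = p'" using laurent_kernel[of "p - p'"] by simp
qed simp

lemma inv_laurent_single:
  assumes "c \<noteq> 0" "laurent (Poly_Mapping.single s c) \<in> Units T"
  shows "\<exists>d. inv (laurent (Poly_Mapping.single s c)) = laurent (Poly_Mapping.single (- s) d)"
proof -
  let ?d = "inverse (\<beta> s (- s) * c)"
  have "laurent (Poly_Mapping.single s c) \<otimes> laurent (Poly_Mapping.single (- s) ?d) = \<one>"
    unfolding laurent_tmul[symmetric] tmul_single using assms(1) by (simp add: field_simps)
  then have "inv (laurent (Poly_Mapping.single s c)) = laurent (Poly_Mapping.single (- s) ?d)"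
    using assms(2) by (metis Units_inv_closed Units_l_inv laurent_closed l_one m_assoc r_one)
  then show ?thesis by blast
qed

text \<open>The denominators of the localization are words, hence scalar multiples of monomials, and
  so are their inverses.\<close>

lemma laurent_surj:
  assumes "x \<in> carrier T"
  obtains p where "x = laurent p"
proof -
  obtain a s where as: "a \<in> carrier Aff" "s \<in> generated_submonoid Aff (range (affine_gen q))" "x = \<iota> a \<otimes> inv (\<iota> s)"
    using is_quantum_torus assms unfolding is_quantum_torus_def is_right_localization_def by blast
  obtain f where f: "a = \<pi> f" using \<pi>_surj[OF as(1)] .
  obtain w where w: "s = \<pi> (Poly_Mapping.single (Word w) 1)" using generated_word[OF as(2)] by blast
  obtain c where c: "c \<noteq> 0" "word_image w = Poly_Mapping.single (word_degree w) c" using word_image_single by blast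
  have s: "\<iota> s = laurent (Poly_Mapping.single (word_degree w) c)"
    using \<psi>_eq[of "Poly_Mapping.single (Word w) 1"] c by (simp add: \<psi>_def w)
  then obtain d where d: "inv (\<iota> s) = laurent (Poly_Mapping.single (- word_degree w) d)"
    using inv_laurent_single[OF c(1)] \<iota>_Units[OF as(2)] by metis
  have "x = laurent (tmul \<beta> (free_image f) (Poly_Mapping.single (- word_degree w) d))"
    unfolding as(3) d laurent_tmul using \<psi>_eq[of f] by (simp add: \<psi>_def f)
  then show ?thesis by (rule that)
qed

section \<open>Degrees and coordinates in the torus\<close>

lemma degree_monomial_laurent:
  assumes "degree_monomial T y m s"
  shows "\<exists>c. m = laurent (Poly_Mapping.single s c)"
  using assms
proof (induction rule: degree_monomial.induct)
  case one
  show ?case by (intro exI[of _ 1]) simp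
next
  case (gen m s i)
  then obtain c where "m = laurent (Poly_Mapping.single s c)" by blast
  then have "m \<otimes> y i = laurent (tmul \<beta> (Poly_Mapping.single s c) (Poly_Mapping.single (axis i 1) 1))"
    unfolding laurent_tmul by simp
  then show ?case unfolding tmul_single by blast
next
  case (gen_inv m s i)
  then obtain c where m: "m = laurent (Poly_Mapping.single s c)" by blast
  have "laurent (Poly_Mapping.single (axis i 1) 1) = y i" by simp
  then obtain d where d: "inv (y i) = laurent (Poly_Mapping.single (- axis i 1) d)"
    using inv_laurent_single[of 1 "axis i 1"] by (metis one_neq_zero y_Units)
  have "m \<otimes> inv (y i) = laurent (tmul \<beta> (Poly_Mapping.single s c) (Poly_Mapping.single (- axis i 1) d))"
    unfolding laurent_tmul m d ..
  then show ?case unfolding tmul_single by auto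
qed

lemma submodule_laurent_keys: "submodule {laurent p | p. Poly_Mapping.keys p \<subseteq> K} (ring_of_type_algebra :: 'k ring) T"
proof (rule module.submoduleI[OF module_R])
  show "\<zero> \<in> {laurent p | p. Poly_Mapping.keys p \<subseteq> K}"
    by (rule CollectI, rule exI[of _ 0]) simp
  show "\<ominus> x \<in> {laurent p | p. Poly_Mapping.keys p \<subseteq> K}" if x: "x \<in> {laurent p | p. Poly_Mapping.keys p \<subseteq> K}" for x
  proof -
    obtain p where "x = laurent p" "Poly_Mapping.keys p \<subseteq> K" using x by blast
    then show ?thesis by (intro CollectI exI[of _ "- p"]) (simp add: laurent_uminus)
  qed
  show "x \<oplus> x' \<in> {laurent p | p. Poly_Mapping.keys p \<subseteq> K}"
    if x: "x \<in> {laurent p | p. Poly_Mapping.keys p \<subseteq> K}" "x' \<in> {laurent p | p. Poly_Mapping.keys p \<subseteq> K}" for x x'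
  proof -
    obtain p p' where "x = laurent p" "Poly_Mapping.keys p \<subseteq> K" "x' = laurent p'" "Poly_Mapping.keys p' \<subseteq> K"
      using x by blast
    then show ?thesis using keys_add[of p p'] by (intro CollectI exI[of _ "p + p'"]) (auto simp: laurent_add)
  qed
  show "c \<odot>\<^bsub>T\<^esub> x \<in> {laurent p | p. Poly_Mapping.keys p \<subseteq> K}" if x: "x \<in> {laurent p | p. Poly_Mapping.keys p \<subseteq> K}" for c x
  proof -
    obtain p where "x = laurent p" "Poly_Mapping.keys p \<subseteq> K" using x by blast
    then show ?thesis using keys_pscale[of c p] by (intro CollectI exI[of _ "pscale c p"]) (auto simp: laurent_pscale)
  qed
qed auto

lemma lin_span_least:
  "submodule H (ring_of_type_algebra :: 'k ring) T \<Longrightarrow> B \<subseteq> H \<Longrightarrow> lin_span T B \<subseteq> H"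
  unfolding lin_span_def by auto

text \<open>Prescribing the support gives a submodule, and \<open>lin_span\<close> is the least
  submodule; this is used for both nested spans.\<close>

lemma induced_grading_subset:
  "induced_grading T (standard_grading T y) phi \<gamma> \<subseteq> {laurent p | p. Poly_Mapping.keys p \<subseteq> {s. phi s = \<gamma>}}"
  unfolding induced_grading_def standard_grading_def
proof (rule lin_span_least[OF submodule_laurent_keys], rule UN_least, rule lin_span_least[OF submodule_laurent_keys])
  fix s assume s: "s \<in> {s. phi s = \<gamma>}"
  show "{m. degree_monomial T y m s} \<subseteq> {laurent p | p. Poly_Mapping.keys p \<subseteq> {s. phi s = \<gamma>}}"
  proof
    fix m assume "m \<in> {m. degree_monomial T y m s}"
    then obtain c where "m = laurent (Poly_Mapping.single s c)" using degree_monomial_laurent by blast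
    then show "m \<in> {laurent p | p. Poly_Mapping.keys p \<subseteq> {s. phi s = \<gamma>}}"
      using s by (intro CollectI exI[of _ "Poly_Mapping.single s c"]) auto
  qed
qed

definition coords :: "'a \<Rightarrow> (int ^ 'n \<Rightarrow>\<^sub>0 'k)" where
  "coords x = (THE p. laurent p = x)"

lemma coords_laurent [simp]: "coords (laurent p) = p"
  unfolding coords_def by (rule the_equality) (simp_all add: laurent_inject)

lemma laurent_coords [simp]: "x \<in> carrier T \<Longrightarrow> laurent (coords x) = x"
  using laurent_surj[of x] by (metis coords_laurent)

end

section \<open>Sections of epimorphisms onto free abelian groups\<close>

text \<open>Free abelian groups are projective: preimages of the basis elements are chosen and
  extended additively.\<close>

lemma additive_section_exists:
  fixes phi :: "int ^ 'n::finite \<Rightarrow> 'g::ab_group_add"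
  assumes "additive phi" "surj phi" "free_abelian TYPE('g)"
  shows "\<exists>\<sigma>. additive \<sigma> \<and> (\<forall>x. phi (\<sigma> x) = x)"
proof -
  interpret phi: additive phi by fact
  obtain B and f :: "'g \<Rightarrow> ('g \<Rightarrow>\<^sub>0 int)" where
    f: "f \<in> iso \<lparr>carrier = (UNIV :: 'g set), monoid.mult = (+), one = 0\<rparr> (free_Abelian_group B)"
    using assms(3) by (auto simp: free_abelian_def is_iso_def)
  have f_add: "f (x + x') = f x + f x'" and f_keys: "Poly_Mapping.keys (f x) \<subseteq> B" and f_inj: "inj f"
    and f_surj: "f ` UNIV = {c. Poly_Mapping.keys c \<subseteq> B}" for x x'
  proof -
    have hom: "f \<in> hom \<lparr>carrier = (UNIV :: 'g set), monoid.mult = (+), one = 0\<rparr> (free_Abelian_group B)"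
      and bij: "bij_betw f UNIV (carrier (free_Abelian_group B))"
      using f by (simp_all add: iso_def)
    show "f (x + x') = f x + f x'" using hom_mult[OF hom, of x x'] by simp
    show "Poly_Mapping.keys (f x) \<subseteq> B" using bij_betwE[OF bij] by simp
    show "inj f" using bij by (rule bij_betw_imp_inj_on)
    show "f ` UNIV = {c. Poly_Mapping.keys c \<subseteq> B}"
      using bij_betw_imp_surj_on[OF bij] by (simp add: free_Abelian_group_def)
  qed
  interpret f: additive f by standard (rule f_add)
  define r where "r b = (SOME s. f (phi s) = frag_of b)" for b
  have r: "f (phi (r b)) = frag_of b" if b: "b \<in> B" for b
  proof -
    have "frag_of b \<in> f ` UNIV" unfolding f_surj using b by (simp add: keys_frag_of)
    then obtain x where "f x = frag_of b" by auto
    moreover obtain s where "x = phi s" using surjD[OF assms(2)] by blast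
    ultimately have "\<exists>s. f (phi s) = frag_of b" by auto
    then show ?thesis unfolding r_def by (rule someI_ex)
  qed
  \<comment> \<open>The additive extension of \<open>r\<close> to integer combinations of all
    elements of the group type; it is a section on those supported in \<open>B\<close>.\<close>
  define \<tau> where "\<tau> c = (\<chi> i. \<Sum>b\<in>Poly_Mapping.keys c. Poly_Mapping.lookup c b * r b $ i)" for c :: "'g \<Rightarrow>\<^sub>0 int"
  have \<tau>_superset: "\<tau> c = (\<chi> i. \<Sum>b\<in>S. Poly_Mapping.lookup c b * r b $ i)"
    if "finite S" "Poly_Mapping.keys c \<subseteq> S" for c S
    unfolding \<tau>_def using that by (auto simp: vec_eq_iff in_keys_iff intro!: sum.mono_neutral_left)
  have \<tau>_add: "\<tau> (c + d) = \<tau> c + \<tau> d" for c d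
    using keys_add[of c d]
    by (simp add: \<tau>_superset[of "Poly_Mapping.keys c \<union> Poly_Mapping.keys d"] vec_eq_iff lookup_add distrib_right sum.distrib)
  interpret \<tau>: additive \<tau> by standard (rule \<tau>_add)
  have f\<tau>: "f (phi (\<tau> c)) = c" if "Poly_Mapping.keys c \<subseteq> B" for c
    using that
  proof (induction c rule: frag_induction)
    case zero
    show ?case by (simp add: \<tau>.zero phi.zero f.zero)
  next
    case (one b)
    have "\<tau> (frag_of b) = r b" by (simp add: \<tau>_superset[of "{b}"] vec_eq_iff)
    then show ?case using r[OF one] by simp
  next
    case (diff c d)
    then show ?case by (simp add: \<tau>.diff phi.diff f.diff)
  qed
  have 1: "phi (\<tau> (f x)) = x" for x
    by (rule injD[OF f_inj f\<tau>[OF f_keys]])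
  have "additive (\<lambda>x. \<tau> (f x))" by standard (simp add: f_add \<tau>_add)
  with 1 show ?thesis by auto
qed

section \<open>Intermediate graded algebras and their twists\<close>

text \<open>\<open>A\<close> is a subset of the torus with the inherited operations.
  \<open>\<iota>_A\<close> expresses that it contains the quantum affine space, and
  \<open>GA_sub\<close> ties its grading to the degrees of Laurent monomials.\<close>

locale intermediate_algebra = quantum_torus chi T \<iota>
  for chi :: "int ^ 'n::finite \<Rightarrow> int ^ 'n \<Rightarrow> 'k::field"
    and T :: "('k, 'a) module" and \<iota> :: "('n, 'k) free_algebra set \<Rightarrow> 'a" +
  fixes phi :: "int ^ 'n \<Rightarrow> 'g::ab_group_add" and A :: "'a set" and GA :: "'g \<Rightarrow> 'a set"
  assumes additive_phi: "additive phi"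
    and graded_A: "graded_algebra (T\<lparr>carrier := A\<rparr>) GA"
    and \<iota>_A: "\<iota> \<in> alg_hom (quantum_affine (bicharacter_matrix chi)) (T\<lparr>carrier := A\<rparr>)"
    and A_sub: "A \<subseteq> carrier T"
    and GA_sub: "GA \<gamma> \<subseteq> induced_grading T (standard_grading T (\<lambda>i. \<iota> (affine_gen (bicharacter_matrix chi) i))) phi \<gamma>"
begin

abbreviation "RA \<equiv> T\<lparr>carrier := A\<rparr>"

lemmas graded_A_unfolded = graded_A[unfolded graded_algebra_def]

sublocale A: assoc_algebra RA
  by (rule assoc_algebra.intro) (rule conjunct1[OF graded_A_unfolded])

sublocale phi: additive phi by (rule additive_phi)

lemma A_closed [simp]: "x \<in> A \<Longrightarrow> x \<in> carrier T"
  using A_sub by (rule subsetD)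

lemma coords_add: "x \<in> A \<Longrightarrow> x' \<in> A \<Longrightarrow> coords (x \<oplus>\<^bsub>T\<^esub> x') = coords x + coords x'"
  using laurent_add[of "coords x" "coords x'"] coords_laurent[of "coords x + coords x'"] by simp

lemma coords_mult: "x \<in> A \<Longrightarrow> x' \<in> A \<Longrightarrow> coords (x \<otimes>\<^bsub>T\<^esub> x') = tmul \<beta> (coords x) (coords x')"
  using laurent_tmul[of "coords x" "coords x'"] coords_laurent[of "tmul \<beta> (coords x) (coords x')"] by simp

lemma coords_smult: "x \<in> A \<Longrightarrow> coords (c \<odot>\<^bsub>T\<^esub> x) = pscale c (coords x)"
  using laurent_pscale[of c "coords x"] coords_laurent[of "pscale c (coords x)"] by simp

lemma coords_one: "coords \<one>\<^bsub>T\<^esub> = Poly_Mapping.single 0 1"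
  using coords_laurent[of "Poly_Mapping.single 0 1"] by simp

lemma coords_inj: "inj_on coords A"
proof (rule inj_onI)
  fix x x' assume "x \<in> A" "x' \<in> A" "coords x = coords x'"
  then have "laurent (coords x) = laurent (coords x')" by simp
  with \<open>x \<in> A\<close> \<open>x' \<in> A\<close> show "x = x'" by simp
qed

lemma coords_finsum:
  assumes "finite S" "\<And>x. x \<in> S \<Longrightarrow> f x \<in> A"
  shows "coords (finsum RA f S) = (\<Sum>x\<in>S. coords (f x))"
  using assms
proof (induction S rule: finite_induct)
  case empty
  have "coords \<zero>\<^bsub>T\<^esub> = 0" using coords_laurent[of 0] by simp
  then show ?case by (simp add: A.finsum_empty[simplified])
next
  case (insert x S)
  then have fin: "finsum RA f (insert x S) = f x \<oplus>\<^bsub>T\<^esub> finsum RA f S"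
    using A.finsum_insert[of S x f] by (auto simp: Pi_iff)
  have "finsum RA f S \<in> A" using A.finsum_closed[of f S] insert.prems by (auto simp: Pi_iff)
  with insert show ?case unfolding fin by (simp add: coords_add)
qed

lemma GA_subset_A: "GA \<gamma> \<subseteq> A"
proof -
  have "submodule (GA \<gamma>) (ring_of_type_algebra :: 'k ring) RA"
    by (rule spec[OF conjunct1[OF conjunct2[OF graded_A_unfolded]]])
  from subgroup.subset[OF submodule.axioms(1)[OF this]] show ?thesis by simp
qed

lemma keys_coords_GA:
  assumes "x \<in> GA \<gamma>" "s \<in> Poly_Mapping.keys (coords x)"
  shows "phi s = \<gamma>"
proof -
  have "x \<in> induced_grading T (standard_grading T y) phi \<gamma>"
    unfolding y_def[abs_def] by (rule subsetD[OF GA_sub assms(1)])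
  from subsetD[OF induced_grading_subset this]
  obtain p where "x = laurent p" "Poly_Mapping.keys p \<subseteq> {s. phi s = \<gamma>}"
    by blast
  with assms(2) show ?thesis by auto
qed

abbreviation "hc \<equiv> homogeneous_component RA GA"
abbreviation "hs \<equiv> homogeneous_support RA GA"

lemma homogeneous:
  assumes "x \<in> A"
  shows "hc \<gamma> x \<in> GA \<gamma>" "finite (hs x)" "coords x = (\<Sum>\<gamma>\<in>hs x. coords (hc \<gamma> x))"
proof -
  let ?f = "THE f. homogeneous_decomposition RA GA x f"
  have "\<forall>x\<in>carrier RA. \<exists>!f. homogeneous_decomposition RA GA x f"
    by (rule conjunct2[OF conjunct2[OF conjunct2[OF graded_A_unfolded]]])
  then have "\<exists>!f. homogeneous_decomposition RA GA x f"
    using assms by (rule_tac bspec) simp_all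
  then have "homogeneous_decomposition RA GA x ?f" by (rule theI')
  then have f: "\<And>s. ?f s \<in> GA s" "finite {s. ?f s \<noteq> \<zero>\<^bsub>T\<^esub>}" "x = finsum RA ?f {s. ?f s \<noteq> \<zero>\<^bsub>T\<^esub>}"
    by (auto simp: homogeneous_decomposition_def)
  have hs: "hs x = {s. ?f s \<noteq> \<zero>\<^bsub>T\<^esub>}"
    by (simp add: homogeneous_support_def homogeneous_component_def)
  show "hc \<gamma> x \<in> GA \<gamma>" using f(1) by (simp add: homogeneous_component_def)
  show "finite (hs x)" using f(2) by (simp add: hs)
  have "coords (finsum RA ?f {s. ?f s \<noteq> \<zero>\<^bsub>T\<^esub>}) = (\<Sum>\<gamma>\<in>{s. ?f s \<noteq> \<zero>\<^bsub>T\<^esub>}. coords (?f \<gamma>))"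
    using f(1,2) GA_subset_A by (intro coords_finsum) auto
  then show "coords x = (\<Sum>\<gamma>\<in>hs x. coords (hc \<gamma> x))"
    unfolding hs homogeneous_component_def f(3)[symmetric] .
qed

definition twisted_cocycle :: "('g \<Rightarrow> 'g \<Rightarrow> 'k) \<Rightarrow> int ^ 'n \<Rightarrow> int ^ 'n \<Rightarrow> 'k" where
  "twisted_cocycle c s t = \<beta> s t * c (phi s) (phi t)"

text \<open>On supports lying in single fibres of \<open>phi\<close> the factor coming from
  \<open>c\<close> is constant and can be pulled out.\<close>

lemma tmul_twisted_homogeneous:
  assumes "\<And>s. s \<in> Poly_Mapping.keys p \<Longrightarrow> phi s = \<gamma>" "\<And>s. s \<in> Poly_Mapping.keys p' \<Longrightarrow> phi s = \<delta>"
  shows "tmul (twisted_cocycle c) p p' = pscale (c \<gamma> \<delta>) (tmul \<beta> p p')"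
  unfolding tmul_def pscale_sum pscale_single twisted_cocycle_def
  by (intro sum.cong refl) (simp add: assms mult_ac)

lemma twist_simps [simp]:
  "carrier (twist RA GA c) = A" "x \<oplus>\<^bsub>twist RA GA c\<^esub> x' = x \<oplus>\<^bsub>T\<^esub> x'" "\<zero>\<^bsub>twist RA GA c\<^esub> = \<zero>\<^bsub>T\<^esub>"
  "a \<odot>\<^bsub>twist RA GA c\<^esub> x = a \<odot>\<^bsub>T\<^esub> x" "\<one>\<^bsub>twist RA GA c\<^esub> = inverse (c 0 0) \<odot>\<^bsub>T\<^esub> \<one>\<^bsub>T\<^esub>"
  by (simp_all add: twist_def)

text \<open>The twisted product is a double sum over homogeneous components. In coordinates each
  term is a product for one cocycle on the exponent group, and bilinearity reassembles the
  sum.\<close>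

lemma twist_mult:
  assumes "x \<in> A" "x' \<in> A"
  shows "x \<otimes>\<^bsub>twist RA GA c\<^esub> x' \<in> A"
    "coords (x \<otimes>\<^bsub>twist RA GA c\<^esub> x') = tmul (twisted_cocycle c) (coords x) (coords x')"
proof -
  let ?F = "\<lambda>(s, t). c s t \<odot>\<^bsub>T\<^esub> (hc s x \<otimes>\<^bsub>T\<^esub> hc t x')"
  have eq: "x \<otimes>\<^bsub>twist RA GA c\<^esub> x' = finsum RA ?F (hs x \<times> hs x')"
    by (simp add: twist_def)
  have cl: "hc s x \<in> A" "hc s x' \<in> A" for s
    using homogeneous(1) assms GA_subset_A by blast+
  have F: "?F z \<in> A" for z
    using A.smult_closed[simplified] A.m_closed[simplified] cl by (cases z) simp
  show "x \<otimes>\<^bsub>twist RA GA c\<^esub> x' \<in> A"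
    unfolding eq using A.finsum_closed[of ?F] F by auto
  have "coords (x \<otimes>\<^bsub>twist RA GA c\<^esub> x') = (\<Sum>z\<in>hs x \<times> hs x'. coords (?F z))"
    unfolding eq using F homogeneous(2) assms by (intro coords_finsum) auto
  also have "\<dots> = (\<Sum>(s, t)\<in>hs x \<times> hs x'. tmul (twisted_cocycle c) (coords (hc s x)) (coords (hc t x')))"
  proof (intro sum.cong refl)
    fix z :: "'g \<times> 'g"
    obtain s t where z: "z = (s, t)" by (cases z)
    have "hc s x \<otimes>\<^bsub>T\<^esub> hc t x' \<in> A" using A.m_closed[simplified] cl by simp
    then have "coords (?F z) = pscale (c s t) (tmul \<beta> (coords (hc s x)) (coords (hc t x')))"
      using cl by (simp add: z coords_smult coords_mult)
    also have "\<dots> = tmul (twisted_cocycle c) (coords (hc s x)) (coords (hc t x'))"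
      by (rule tmul_twisted_homogeneous[symmetric])
        (use keys_coords_GA[OF homogeneous(1)[OF assms(1)]] keys_coords_GA[OF homogeneous(1)[OF assms(2)]] in blast)+
    finally show "coords (?F z) = (case z of (s, t) \<Rightarrow> tmul (twisted_cocycle c) (coords (hc s x)) (coords (hc t x')))"
      by (simp add: z)
  qed
  also have "\<dots> = tmul (twisted_cocycle c) (coords x) (coords x')"
    unfolding homogeneous(3)[OF assms(1)] homogeneous(3)[OF assms(2)]
    by (simp add: tmul_sum_left tmul_sum_right sum.cartesian_product[symmetric])
      (rule sum.swap)
  finally show "coords (x \<otimes>\<^bsub>twist RA GA c\<^esub> x') = tmul (twisted_cocycle c) (coords x) (coords x')" .
qed

context
  fixes c :: "'g \<Rightarrow> 'g \<Rightarrow> 'k"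
  assumes c: "c \<in> cocycles2"
begin

text \<open>Dividing by \<open>c 0 0\<close> makes the twisted identity correspond to \<open>single 0 1\<close>.\<close>

definition \<kappa> :: "int ^ 'n \<Rightarrow> int ^ 'n \<Rightarrow> 'k" where
  "\<kappa> s t = twisted_cocycle c s t / c 0 0"

definition twist_coords :: "'a \<Rightarrow> (int ^ 'n \<Rightarrow>\<^sub>0 'k)" where
  "twist_coords x = pscale (c 0 0) (coords x)"

lemma c_nonzero [simp]: "c \<gamma> \<delta> \<noteq> 0"
  using c by (rule cocycles2D)

lemma \<kappa>_cocycle: "\<kappa> \<in> cocycles2"
  unfolding cocycles2_def
proof (intro CollectI conjI allI)
  fix s t u
  show "\<kappa> s t \<noteq> 0" by (simp add: \<kappa>_def twisted_cocycle_def)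
  have "\<kappa> s (t + u) * \<kappa> t u = (\<beta> s (t + u) * \<beta> t u) * (c (phi s) (phi t + phi u) * c (phi t) (phi u)) / (c 0 0 * c 0 0)"
    by (simp add: \<kappa>_def twisted_cocycle_def phi.add)
  also have "\<dots> = (\<beta> (s + t) u * \<beta> s t) * (c (phi s + phi t) (phi u) * c (phi s) (phi t)) / (c 0 0 * c 0 0)"
    by (simp only: cocycles2D(2)[OF c] cocycles2D(2)[OF \<beta>_cocycle])
  also have "\<dots> = \<kappa> (s + t) u * \<kappa> s t"
    by (simp add: \<kappa>_def twisted_cocycle_def phi.add)
  finally show "\<kappa> s (t + u) * \<kappa> t u = \<kappa> (s + t) u * \<kappa> s t" .
qed

lemma \<kappa>_one: "\<kappa> 0 0 = 1"
  by (simp add: \<kappa>_def twisted_cocycle_def phi.zero)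

lemma twist_coords_inj: "inj_on twist_coords A"
proof (rule inj_onI)
  fix x x' assume *: "x \<in> A" "x' \<in> A" "twist_coords x = twist_coords x'"
  then have "pscale (inverse (c 0 0)) (twist_coords x) = pscale (inverse (c 0 0)) (twist_coords x')" by simp
  then have "coords x = coords x'" by (simp add: twist_coords_def)
  then show "x = x'" using coords_inj * by (auto dest: inj_onD)
qed

lemma twist_coords_mult:
  assumes "x \<in> A" "x' \<in> A"
  shows "twist_coords (x \<otimes>\<^bsub>twist RA GA c\<^esub> x') = tmul \<kappa> (twist_coords x) (twist_coords x')"
proof -
  have "tmul \<kappa> p p' = pscale (inverse (c 0 0)) (tmul (twisted_cocycle c) p p')" for p p'
    unfolding tmul_def pscale_sum pscale_single \<kappa>_def by (simp add: field_simps)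
  then show ?thesis
    by (simp add: twist_coords_def tmul_pscale_left tmul_pscale_right twist_mult[OF assms])
qed

lemma twist_coords_one: "twist_coords \<one>\<^bsub>twist RA GA c\<^esub> = Poly_Mapping.single 0 1"
  using A.one_closed by (simp add: twist_coords_def coords_smult coords_one)

text \<open>The axioms that involve the product are pulled back along the injective coordinates from
  the twisted group algebra; the additive group is unchanged.\<close>

lemma k_algebra_twist: "k_algebra (twist RA GA c)"
proof -
  let ?S = "twist RA GA c"
  note A_simps = A.smult_closed[simplified] A.smult_add_left[simplified] A.smult_add_right[simplified]
    A.smult_smult[simplified] A.smult_one_left[simplified]
  have twist_coords_add: "twist_coords (x \<oplus>\<^bsub>T\<^esub> x') = twist_coords x + twist_coords x'" if "x \<in> A" "x' \<in> A" for x x'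
    using that by (simp add: twist_coords_def coords_add pscale_add)
  have twist_coords_smult: "twist_coords (a \<odot>\<^bsub>T\<^esub> x) = pscale a (twist_coords x)" if "x \<in> A" for a x
    using that by (simp add: twist_coords_def coords_smult mult.commute)
  have add_closed: "x \<oplus>\<^bsub>T\<^esub> x' \<in> A" if "x \<in> A" "x' \<in> A" for x x'
    using A.a_closed[simplified] that by simp
  have one: "\<one>\<^bsub>?S\<^esub> \<in> A" using A.one_closed A_simps(1) by simp
  note cl = add_closed twist_mult(1) one A_simps(1)
  have eqI: "x = x'" if "x \<in> A" "x' \<in> A" "twist_coords x = twist_coords x'" for x x'
    using that twist_coords_inj by (auto dest: inj_onD)
  have "abelian_group ?S"
  proof -
    have "add_monoid ?S = add_monoid RA" by (simp add: twist_def)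
    then show ?thesis
      using A.abelian_group_axioms by (simp add: abelian_group_def abelian_group_axioms_def abelian_monoid_def)
  qed
  moreover have "monoid ?S"
    by (rule monoidI)
      (auto intro!: eqI simp: cl twist_coords_mult twist_coords_one tmul_assoc[OF \<kappa>_cocycle] tmul_one[OF \<kappa>_cocycle \<kappa>_one] simp del: twist_simps(5))
  ultimately have ring: "ring ?S"
    by (rule ringI) (auto intro!: eqI simp: cl twist_coords_mult twist_coords_add tmul_add_left tmul_add_right)
  show ?thesis
    by (rule k_algebraI[OF ring])
      (auto intro!: eqI simp: cl twist_coords_mult twist_coords_smult tmul_pscale_left tmul_pscale_right A_simps)
qed

lemma twisted_subalgebra_twist: "twisted_subalgebra (twist RA GA c) \<kappa> twist_coords"
proof
  show "k_algebra (twist RA GA c)" by (rule k_algebra_twist)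
  show "\<kappa> \<in> cocycles2" "\<kappa> 0 0 = 1" by (fact \<kappa>_cocycle \<kappa>_one)+
  show "inj_on twist_coords (carrier (twist RA GA c))" using twist_coords_inj by simp
  show "twist_coords \<one>\<^bsub>twist RA GA c\<^esub> = Poly_Mapping.single 0 1" by (rule twist_coords_one)
  fix s :: "int ^ 'n" assume s: "\<And>i. 0 \<le> s $ i"
  obtain w where w: "word_degree w = s" using word_degree_surj[OF s] by blast
  obtain d where d: "d \<noteq> 0" "word_image w = Poly_Mapping.single s d" using word_image_single[of w] w by auto
  \<comment> \<open>The coefficient undoes both the scalar \<open>d\<close> from sorting the word
    and the factor \<open>c 0 0\<close> in \<open>twist_coords\<close>.\<close>
  let ?x = "\<psi> (Poly_Mapping.single (Word w) (inverse (c 0 0 * d)))"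
  have "?x \<in> A"
    using \<iota>_A by (auto simp: \<psi>_def alg_hom_def ring_hom_def)
  moreover have "twist_coords ?x = Poly_Mapping.single s 1"
    unfolding twist_coords_def \<psi>_eq coords_laurent using d by (simp add: field_simps)
  ultimately show "\<exists>x\<in>carrier (twist RA GA c). twist_coords x = Poly_Mapping.single s 1" by auto
qed (simp_all add: twist_coords_def coords_add coords_smult pscale_add mult.commute twist_coords_mult[unfolded twist_coords_def])

lemma semiprime_right_goldie_twist: "semiprime_right_goldie (twist RA GA c)"
proof -
  interpret S: twisted_subalgebra "twist RA GA c" \<kappa> twist_coords by (rule twisted_subalgebra_twist)
  show ?thesis by (rule S.semiprime_right_goldie)
qed

text \<open>In the alternation of \<open>\<kappa>\<close> the normalising constant cancels,
  \<open>\<beta>\<close> contributes \<open>chi\<close>, and the pullback of \<open>c\<close>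
  contributes its own alternation.\<close>

lemma AD_twist:
  "AD (twist RA GA c) = generate (Multiplicative_Group.mult_of ring_of_type_algebra)
     {chi s t * alt_of c (phi s) (phi t) | s t. True}"
proof -
  interpret S: twisted_subalgebra "twist RA GA c" \<kappa> twist_coords by (rule twisted_subalgebra_twist)
  have "alt_of \<kappa> s t = chi s t * alt_of c (phi s) (phi t)" for s t
    unfolding alt_of_def \<kappa>_def twisted_cocycle_def \<beta>_alternation[of s t] by simp
  then show ?thesis using S.AD_eq by (simp add: S.alt_group_def)
qed

end

text \<open>A cocycle takes the same value at (0, t) and (t, 0), so its alternation is trivial on
  degree 0 and the generators with \<open>s\<close> in the kernel survive every twist.\<close>

lemma AD_twist_superset:
  assumes "c \<in> cocycles2"
  shows "generate (Multiplicative_Group.mult_of ring_of_type_algebra) {chi s t | s t. phi s = 0} \<subseteq> AD (twist RA GA c)"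
  unfolding AD_twist[OF assms]
proof (rule group.mono_generate[OF group_mult_of_type], safe)
  fix s t assume s: "phi s = 0"
  have "alt_of c (phi s) (phi t) = 1"
    unfolding alt_of_def s cocycles2_zero(1)[OF assms, of "phi t"] cocycles2_zero(2)[OF assms, of "phi t"]
    using cocycles2D(1)[OF assms] by simp
  then show "\<exists>s' t'. chi s t = chi s' t' * alt_of c (phi s') (phi t') \<and> True"
    by (metis mult.right_neutral)
qed

text \<open>
  Choosing \<open>c\<close> inverse to \<open>\<beta>\<close> along a section of \<open>phi\<close> cancels the part of \<open>chi\<close> that does not
  involve the kernel of \<open>phi\<close>.
\<close>

lemma AD_twist_section:
  fixes \<sigma> :: "'g \<Rightarrow> int ^ 'n"
  assumes "additive \<sigma>" and section_phi: "\<And>\<gamma>. phi (\<sigma> \<gamma>) = \<gamma>"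
  defines "c \<equiv> \<lambda>\<gamma> \<delta>. inverse (\<beta> (\<sigma> \<gamma>) (\<sigma> \<delta>))"
  shows "c \<in> cocycles2"
    "AD (twist RA GA c) \<subseteq> generate (Multiplicative_Group.mult_of ring_of_type_algebra) {chi s t | s t. phi s = 0}"
proof -
  interpret \<sigma>: additive \<sigma> by (rule assms(1))
  let ?N = "generate (Multiplicative_Group.mult_of (ring_of_type_algebra :: 'k ring)) {chi s t | s t. phi s = 0}"
  show c: "c \<in> cocycles2"
    unfolding cocycles2_def c_def
  proof (intro CollectI conjI allI)
    fix \<gamma> \<delta> \<epsilon>
    show "inverse (\<beta> (\<sigma> \<gamma>) (\<sigma> \<delta>)) \<noteq> 0" by simp
    show "inverse (\<beta> (\<sigma> \<gamma>) (\<sigma> (\<delta> + \<epsilon>))) * inverse (\<beta> (\<sigma> \<delta>) (\<sigma> \<epsilon>)) =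
        inverse (\<beta> (\<sigma> (\<gamma> + \<delta>)) (\<sigma> \<epsilon>)) * inverse (\<beta> (\<sigma> \<gamma>) (\<sigma> \<delta>))"
      unfolding \<sigma>.add inverse_mult_distrib[symmetric] cocycles2D(2)[OF \<beta>_cocycle] ..
  qed
  have N: "subgroup ?N (Multiplicative_Group.mult_of ring_of_type_algebra)"
    by (rule group.generate_is_subgroup[OF group_mult_of_type]) auto
  have N_mult: "a * b \<in> ?N" if "a \<in> ?N" "b \<in> ?N" for a b
    using subgroup.m_closed[OF N that] by simp
  have N_inv: "inverse a \<in> ?N" if "a \<in> ?N" for a
    using subgroup.m_inv_closed[OF N that] subgroup.mem_carrier[OF N that] by (simp add: inv_mult_of_type)
  have alt: "alt_of c \<gamma> \<delta> = inverse (chi (\<sigma> \<gamma>) (\<sigma> \<delta>))" for \<gamma> \<delta>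
    unfolding alt_of_def c_def \<beta>_alternation[of "\<sigma> \<gamma>" "\<sigma> \<delta>"] by simp
  have "chi s t * alt_of c (phi s) (phi t) \<in> ?N" for s t
  proof -
    \<comment> \<open>The representatives of \<open>s\<close> and \<open>t\<close> in the image of
      the section. The differences lie in the kernel of \<open>phi\<close>, and the remaining factor
      \<open>chi s1 t1\<close> is what the twist cancels.\<close>
    define s1 t1 where "s1 = \<sigma> (phi s)" and "t1 = \<sigma> (phi t)"
    have "phi (s - s1) = 0" "phi (t - t1) = 0" by (simp_all add: phi.diff s1_def t1_def section_phi)
    then have 1: "chi (s - s1) t \<in> ?N" "chi (t - t1) s1 \<in> ?N" by (auto intro!: generate.incl)
    have "chi s t = chi (s - s1) t * chi s1 t" by (simp flip: chi_add_left)
    also have "chi s1 t = chi s1 (t - t1) * chi s1 t1" by (simp flip: chi_add_right)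
    \<comment> \<open>The kernel element has to stand in the first argument to match the
      generators.\<close>
    also have "chi s1 (t - t1) = inverse (chi (t - t1) s1)"
      using chi_swap[of s1 "t - t1"] by (simp add: field_simps)
    finally have "chi s t * alt_of c (phi s) (phi t) = chi (s - s1) t * inverse (chi (t - t1) s1)"
      by (simp add: alt s1_def t1_def)
    then show ?thesis using N_mult N_inv 1 by simp
  qed
  then have "{chi s t * alt_of c (phi s) (phi t) | s t. True} \<subseteq> ?N" by blast
  then show "AD (twist RA GA c) \<subseteq> ?N"
    unfolding AD_twist[OF c] using group.generate_subgroup_incl[OF group_mult_of_type _ N] by blast
qed

end

text \<open>The first conjunct gives the second its meaning, since \<open>AD\<close> and
  \<open>tw\<close> are intended for semiprime right Goldie algebras.\<close>

theorem theorem4p4: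
  fixes chi :: "int ^ 'n::finite \<Rightarrow> int ^ 'n \<Rightarrow> 'k::field"
    and phi :: "int ^ 'n \<Rightarrow> 'g::ab_group_add"
    and T :: "('k, 'a) module"
    and \<iota> :: "('n, 'k) free_algebra set \<Rightarrow> 'a"
    and A :: "'a set"
    and GA :: "'g \<Rightarrow> 'a set"
  defines "q \<equiv> bicharacter_matrix chi"
  defines "GO \<equiv> induced_grading (quantum_affine q)
                   (standard_grading (quantum_affine q) (affine_gen q)) phi"
    and "GT \<equiv> induced_grading T (standard_grading T (\<lambda>i. \<iota> (affine_gen q i))) phi"
  assumes "alternating_bicharacter chi"
    and "additive phi" and "surj phi" and "free_abelian TYPE('g)"
    and "is_quantum_torus q T \<iota>"
    and "graded_algebra (T\<lparr>carrier := A\<rparr>) GA"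
    and "graded_inclusion (quantum_affine q) GO (T\<lparr>carrier := A\<rparr>) GA \<iota>"
    and "graded_inclusion (T\<lparr>carrier := A\<rparr>) GA T GT id"
  shows "(\<forall>c\<in>cocycles2. semiprime_right_goldie (twist (T\<lparr>carrier := A\<rparr>) GA c)) \<and>
         tw (T\<lparr>carrier := A\<rparr>) GA =
           generate (Multiplicative_Group.mult_of (ring_of_type_algebra :: 'k ring)) {chi s t | s t. phi s = 0}"
proof -
  interpret intermediate_algebra chi T \<iota> phi A GA
  proof
    show "alternating_bicharacter chi" "graded_algebra (T\<lparr>carrier := A\<rparr>) GA" by fact+
    show "phi (s + t) = phi s + phi t" for s t by (rule additive.add[OF assms(5)])
    show "is_quantum_torus (bicharacter_matrix chi) T \<iota>"
      using assms(8) by (simp add: q_def)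
    show "\<iota> \<in> alg_hom (quantum_affine (bicharacter_matrix chi)) (T\<lparr>carrier := A\<rparr>)"
      using assms(10) by (simp add: graded_inclusion_def q_def)
    show "A \<subseteq> carrier T"
      using assms(11) by (auto simp: graded_inclusion_def alg_hom_def ring_hom_def Pi_iff)
    show "GA \<gamma> \<subseteq> induced_grading T (standard_grading T (\<lambda>i. \<iota> (affine_gen (bicharacter_matrix chi) i))) phi \<gamma>" for \<gamma>
      using assms(11) by (simp add: graded_inclusion_def GT_def q_def)
  qed
  from additive_section_exists[OF assms(5-7)]
  obtain \<sigma> where \<sigma>: "additive \<sigma>" "\<And>\<gamma>. phi (\<sigma> \<gamma>) = \<gamma>"
    by (elim exE conjE) simp
  show ?thesis
  proof (intro conjI ballI equalityI)
    show "semiprime_right_goldie (twist RA GA c)" if "c \<in> cocycles2" for c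
      using that by (rule semiprime_right_goldie_twist)
    \<comment> \<open>An intersection over all cocycles lies in its member for the cocycle built
      from the section.\<close>
    show "tw RA GA \<subseteq> generate (Multiplicative_Group.mult_of ring_of_type_algebra) {chi s t | s t. phi s = 0}"
      unfolding tw_def
      by (rule order_trans[OF _ AD_twist_section(2)[OF \<sigma>]]) (rule INF_lower, rule AD_twist_section(1)[OF \<sigma>])
    show "generate (Multiplicative_Group.mult_of ring_of_type_algebra) {chi s t | s t. phi s = 0} \<subseteq> tw RA GA"
      unfolding tw_def by (rule INF_greatest[OF AD_twist_superset])
  qed
qed

end
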